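(* Let $n\ge 2$ and let $\Pi_1,\dots,\Pi_n$ be general linear subspaces of codimension $2$ of $\mathbb{P}^n$. Then there exists a unique divisor $Q$ of degree $n-1$ in $\mathbb{P}^n$ containing $\Pi_j$ for all $j=1,\dots,n$. Moreover, $Q$ is reduced and irreducible, $Q$ is the union of the transversals for $\Pi_1,\dots,\Pi_n$, and for each point $q\in Q$ we have $\operatorname{mult}_q Q\ge r$, where $r$ is the number of indices $i\in\{1,\dots,n\}$ such that $q\in\Pi_i$. If $q$ is a general point of $Q$, then there is a unique transversal for $\Pi_1,\dots,\Pi_n$ through $q$.
   Context: $\mathbb{P}^n$ is projective space over a ground field $K$ of characteristic $0$; points and lines are understood geometrically (i.e. over an algebraic closure if $K$ is not algebraically closed). Given linear subspaces $\Lambda_1,\dots,\Lambda_s$ of $\mathbb{P}^n$, a transversal for $\Lambda_1,\dots,\Lambda_s$ is a line in $\mathbb{P}^n$ meeting every $\Lambda_i$. "General" means: for all choices of parameters in some dense Zariski-open subset of the corresponding parameter space. *)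

theory Defs
  imports
    "HOL-Analysis.Abstract_Topology"
    "HOL-Library.FuncSet"
    "HOL-Library.Function_Algebras"
    "HOL-Library.Poly_Mapping"
    "HOL-Computational_Algebra.Factorial_Ring"
    "HOL-Algebra.Algebraic_Closure_Type"
begin

section \<open>Multivariate polynomials\<close>

type_synonym ('v, 'a) mpoly = "('v \<Rightarrow>\<^sub>0 nat) \<Rightarrow>\<^sub>0 'a"

definition monom_degree :: "('v \<Rightarrow>\<^sub>0 nat) \<Rightarrow> nat" where
  "monom_degree m = (\<Sum>v\<in>Poly_Mapping.keys m. Poly_Mapping.lookup m v)"

definition mpoly_const :: "'a \<Rightarrow> ('v, 'a::zero) mpoly" where
  "mpoly_const c = Poly_Mapping.single 0 c"

definition mpoly_var :: "'v \<Rightarrow> ('v, 'a::zero_neq_one) mpoly" where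
  "mpoly_var v = Poly_Mapping.single (Poly_Mapping.single v 1) 1"

definition mpoly_subst ::
  "('a::zero \<Rightarrow> 'b::comm_semiring_1) \<Rightarrow> ('v \<Rightarrow> 'b) \<Rightarrow> ('v, 'a) mpoly \<Rightarrow> 'b" where
  "mpoly_subst \<phi> x p = (\<Sum>m\<in>Poly_Mapping.keys p.
     \<phi> (Poly_Mapping.lookup p m) * (\<Prod>v\<in>Poly_Mapping.keys m. x v ^ Poly_Mapping.lookup m v))"

abbreviation mpoly_eval :: "('v \<Rightarrow> 'a::comm_semiring_1) \<Rightarrow> ('v, 'a) mpoly \<Rightarrow> 'a" where
  "mpoly_eval \<equiv> mpoly_subst (\<lambda>c. c)"

text \<open>Forms of degree \<open>d\<close> in the variables \<open>X\<^sub>0, \<dots>, X\<^sub>n\<close>, including the zero form.\<close>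

definition forms :: "nat \<Rightarrow> nat \<Rightarrow> (nat, 'a::zero) mpoly set" where
  "forms n d = {f. \<forall>m\<in>Poly_Mapping.keys f. monom_degree m = d \<and> Poly_Mapping.keys m \<subseteq> {..n}}"


section \<open>Linear subspaces of projective space\<close>

definition coord_scale :: "'a::field \<Rightarrow> (nat \<Rightarrow> 'a) \<Rightarrow> nat \<Rightarrow> 'a" where
  "coord_scale c v = (\<lambda>i. c * v i)"

global_interpretation coord: vector_space "coord_scale :: 'a::field \<Rightarrow> (nat \<Rightarrow> 'a) \<Rightarrow> nat \<Rightarrow> 'a"
  by unfold_locales (auto simp: coord_scale_def fun_eq_iff algebra_simps)

text \<open>\<open>K\<^sup>n\<^sup>+\<^sup>1\<close>, as the functions on \<open>nat\<close> that vanish outside \<open>{..n}\<close>.\<close>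

definition coord_space :: "nat \<Rightarrow> (nat \<Rightarrow> 'a::field) set" where
  "coord_space n = {v. \<forall>i>n. v i = 0}"

text \<open>A linear subspace of \<open>\<bbbP>\<^sup>n\<close> of projective dimension \<open>d\<close> is a \<open>(d + 1)\<close>-dimensional vector
  subspace of \<open>K\<^sup>n\<^sup>+\<^sup>1\<close>. Points are the case \<open>d = 0\<close>, so a point \<open>P\<close> lies on a linear subspace
  \<open>W\<close> if and only if \<open>P \<subseteq> W\<close>.\<close>

definition proj_subspaces :: "nat \<Rightarrow> nat \<Rightarrow> (nat \<Rightarrow> 'a::field) set set" where
  "proj_subspaces n d = {W. coord.subspace W \<and> W \<subseteq> coord_space n \<and> coord.dim W = d + 1}"

abbreviation proj_points :: "nat \<Rightarrow> (nat \<Rightarrow> 'a::field) set set" where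
  "proj_points n \<equiv> proj_subspaces n 0"

abbreviation proj_lines :: "nat \<Rightarrow> (nat \<Rightarrow> 'a::field) set set" where
  "proj_lines n \<equiv> proj_subspaces n 1"

definition transversal :: "nat \<Rightarrow> 'i set \<Rightarrow> ('i \<Rightarrow> (nat \<Rightarrow> 'a::field) set) \<Rightarrow> (nat \<Rightarrow> 'a) set \<Rightarrow> bool" where
  "transversal n I \<Lambda> L \<longleftrightarrow>
     L \<in> proj_lines n \<and> (\<forall>i\<in>I. \<exists>P\<in>proj_points n. P \<subseteq> L \<and> P \<subseteq> \<Lambda> i)"


section \<open>Effective divisors on projective space\<close>

text \<open>An effective divisor of degree \<open>d\<close> on \<open>\<bbbP>\<^sup>n\<close> is a nonzero form of degree \<open>d\<close> up to nonzero
  constant factors. We represent it by the set of all its equations.\<close>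

definition divisor_of :: "(nat, 'a::field) mpoly \<Rightarrow> (nat, 'a) mpoly set" where
  "divisor_of f = {mpoly_const c * f | c. c \<noteq> 0}"

definition effective_divisors :: "nat \<Rightarrow> nat \<Rightarrow> (nat, 'a::field) mpoly set set" where
  "effective_divisors n d = divisor_of ` (forms n d - {0})"

definition divisor_points :: "nat \<Rightarrow> (nat, 'a::field) mpoly set \<Rightarrow> (nat \<Rightarrow> 'a) set set" where
  "divisor_points n Q = {P \<in> proj_points n. \<forall>f\<in>Q. \<forall>v\<in>P. mpoly_eval v f = 0}"

definition divisor_contains :: "nat \<Rightarrow> (nat, 'a::field) mpoly set \<Rightarrow> (nat \<Rightarrow> 'a) set \<Rightarrow> bool" where
  "divisor_contains n Q \<Lambda> \<longleftrightarrow> {P \<in> proj_points n. P \<subseteq> \<Lambda>} \<subseteq> divisor_points n Q"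

text \<open>As an element of the free abelian group on the prime divisors, \<open>Q\<close> is the sum of the
  divisors of the irreducible factors of its equation, counted with multiplicity. So \<open>Q\<close> is
  reduced and irreducible, i.e. a prime divisor with coefficient one, if and only if its equation
  is an irreducible polynomial. (Factors of a polynomial in \<open>X\<^sub>0, \<dots>, X\<^sub>n\<close> involve no
  further variables, so it does not matter that the polynomial ring has infinitely many.)\<close>

definition reduced_irreducible :: "(nat, 'a::field) mpoly set \<Rightarrow> bool" where
  "reduced_irreducible Q \<longleftrightarrow> (\<forall>f\<in>Q. Factorial_Ring.irreducible f)"

text \<open>The equation of the divisor of \<open>f\<close> near the point \<open>P\<close>: with \<open>i\<close> the first coordinate that does
  not vanish at \<open>P\<close> and \<open>w\<close> the coordinate vector of \<open>P\<close> with \<open>w i = 1\<close>, put \<open>X\<^sub>i = 1\<close> and translate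
  \<open>P\<close> to the origin of the affine chart \<open>X\<^sub>i \<noteq> 0\<close>.\<close>

definition local_equation ::
  "(nat \<Rightarrow> 'a::field) set \<Rightarrow> (nat, 'a) mpoly \<Rightarrow> (nat, 'a) mpoly" where
  "local_equation P f =
     (let i = (LEAST i. \<exists>v\<in>P. v i \<noteq> 0);
          w = (THE w. w \<in> P \<and> w i = 1)
      in mpoly_subst mpoly_const
           (\<lambda>j. if j = i then 1 else mpoly_const (w j) + mpoly_var j) f)"

text \<open>The multiplicity is the lowest degree of a term of the local equation. It does not depend on
  the chosen equation \<open>f\<close> of \<open>Q\<close>.\<close>

definition divisor_mult :: "(nat, 'a::field) mpoly set \<Rightarrow> (nat \<Rightarrow> 'a) set \<Rightarrow> nat" where
  "divisor_mult Q P =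
     (let f = (SOME f. f \<in> Q)
      in LEAST d. \<exists>m\<in>Poly_Mapping.keys (local_equation P f). monom_degree m = d)"


section \<open>Passing to the algebraic closure\<close>

definition subspace_ac :: "(nat \<Rightarrow> 'a::field) set \<Rightarrow> (nat \<Rightarrow> 'a alg_closure) set" where
  "subspace_ac W = coord.span ((\<lambda>v i. to_ac (v i)) ` W)"

definition divisor_ac :: "(nat, 'a::field) mpoly set \<Rightarrow> (nat, 'a alg_closure) mpoly set" where
  "divisor_ac Q = (\<Union>f\<in>Q. divisor_of (Poly_Mapping.map to_ac f))"


section \<open>Zariski topologies\<close>

definition affine_zariski :: "'v set \<Rightarrow> ('v \<Rightarrow> 'a::field) topology" where
  "affine_zariski I =
     topology_generated_by {{x \<in> I \<rightarrow>\<^sub>E UNIV. mpoly_eval x F \<noteq> 0} | F :: ('v, 'a) mpoly. True}"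

definition proj_zariski :: "nat \<Rightarrow> (nat \<Rightarrow> 'a::field) set topology" where
  "proj_zariski n = topology_generated_by
     {{P \<in> proj_points n. \<exists>v\<in>P. mpoly_eval v G \<noteq> 0} | G :: (nat, 'a) mpoly. \<exists>d. G \<in> forms n d}"

text \<open>The parameter space: \<open>n\<close>-tuples, indexed by \<open>{1..n}\<close>, of linear subspaces of codimension
  two, i.e. the \<open>K\<close>-points of the \<open>n\<close>-fold product of Grassmannians.\<close>

definition codim2_tuples :: "nat \<Rightarrow> (nat \<Rightarrow> (nat \<Rightarrow> 'a::field) set) set" where
  "codim2_tuples n = {1..n} \<rightarrow>\<^sub>E proj_subspaces n (n - 2)"

text \<open>Given \<open>n\<close> pairs of linear forms, the \<open>i\<close>-th coefficient of the \<open>k\<close>-th form of the \<open>j\<close>-th pair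
  being \<open>a (j, k, i)\<close>, the tuple of their common zero loci. A pair is linearly independent if and
  only if its zero locus has codimension two, and every subspace of codimension two arises.\<close>

definition zero_loci :: "nat \<Rightarrow> (nat \<times> nat \<times> nat \<Rightarrow> 'a::field) \<Rightarrow> nat \<Rightarrow> (nat \<Rightarrow> 'a) set" where
  "zero_loci n a = (\<lambda>j\<in>{1..n}. {v \<in> coord_space n. \<forall>k<2. (\<Sum>i\<le>n. a (j, k, i) * v i) = 0})"

abbreviation pair_coeffs :: "nat \<Rightarrow> (nat \<times> nat \<times> nat) set" where
  "pair_coeffs n \<equiv> {1..n} \<times> {..<2} \<times> {..n}"

definition independent_pairs :: "nat \<Rightarrow> (nat \<times> nat \<times> nat \<Rightarrow> 'a::field) set" where
  "independent_pairs n = {a \<in> pair_coeffs n \<rightarrow>\<^sub>E UNIV. zero_loci n a \<in> codim2_tuples n}"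

text \<open>The Zariski topology on the product of Grassmannians, as the quotient topology under
  \<open>zero_loci\<close>.\<close>

definition codim2_zariski :: "nat \<Rightarrow> (nat \<Rightarrow> (nat \<Rightarrow> 'a::field) set) topology" where
  "codim2_zariski n = topology (\<lambda>U. U \<subseteq> codim2_tuples n \<and>
     openin (subtopology (affine_zariski (pair_coeffs n)) (independent_pairs n))
       {a \<in> independent_pairs n. zero_loci n a \<in> U})"

lemma topspace_affine_zariski:
  "topspace (affine_zariski I :: ('v \<Rightarrow> 'a::field) topology) = I \<rightarrow>\<^sub>E UNIV" (is "_ = ?X")
proof -
  have "?X = {x \<in> ?X. mpoly_eval x (1 :: ('v, 'a) mpoly) \<noteq> 0}"
    by (simp add: mpoly_subst_def)
  then have "?X \<in> {{x \<in> ?X. mpoly_eval x F \<noteq> 0} | F :: ('v, 'a) mpoly. True}"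
    by (intro CollectI exI[of _ 1] conjI TrueI)
  then show ?thesis
    unfolding affine_zariski_def topology_generated_by_topspace
    by (intro equalityI Union_least Union_upper) auto
qed

lemma openin_codim2_zariski:
  fixes U :: "(nat \<Rightarrow> (nat \<Rightarrow> 'a::field) set) set"
  shows "openin (codim2_zariski n) U \<longleftrightarrow> U \<subseteq> codim2_tuples n \<and>
     openin (subtopology (affine_zariski (pair_coeffs n)) (independent_pairs n))
       {a \<in> independent_pairs n. zero_loci n a \<in> U}"
proof -
  define T where "T = subtopology (affine_zariski (pair_coeffs n))
    (independent_pairs n :: (nat \<times> nat \<times> nat \<Rightarrow> 'a) set)"
  define p where "p S = {a \<in> independent_pairs n. zero_loci n a \<in> S}"
    for S :: "(nat \<Rightarrow> (nat \<Rightarrow> 'a) set) set"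
  have p_Int: "p (A \<inter> B) = p A \<inter> p B" for A B
    unfolding p_def by blast
  have p_Union: "p (\<Union>\<K>) = \<Union>(p ` \<K>)" for \<K>
    unfolding p_def by blast
  have "istopology (\<lambda>S. S \<subseteq> codim2_tuples n \<and> openin T (p S))"
    unfolding istopology_def p_Int p_Union by (auto intro!: openin_Int openin_Union)
  then show ?thesis
    unfolding codim2_zariski_def T_def p_def by (simp only: topology_inverse')
qed

lemma topspace_codim2_zariski:
  "topspace (codim2_zariski n) = (codim2_tuples n :: (nat \<Rightarrow> (nat \<Rightarrow> 'a::field) set) set)"
  (is "topspace ?Z = ?X")
proof (rule equalityI)
  show "topspace ?Z \<subseteq> ?X"
    using openin_topspace[of ?Z] unfolding openin_codim2_zariski by (rule conjunct1)
  define S where "S = (independent_pairs n :: (nat \<times> nat \<times> nat \<Rightarrow> 'a) set)"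
  define T where "T = subtopology (affine_zariski (pair_coeffs n)) S"
  have "{a \<in> S. zero_loci n a \<in> ?X} = S"
    by (auto simp: S_def independent_pairs_def)
  also have "S = topspace T"
    by (auto simp: T_def S_def topspace_affine_zariski independent_pairs_def)
  finally have "openin ?Z ?X"
    using openin_topspace[of T] unfolding openin_codim2_zariski T_def S_def by simp
  then show "?X \<subseteq> topspace ?Z"
    by (rule openin_subset)
qed

definition dense_open :: "'a topology \<Rightarrow> 'a set \<Rightarrow> bool" where
  "dense_open T U \<longleftrightarrow> openin T U \<and> T closure_of U = topspace T"

end

theory Submission
  imports Defs "Jordan_Normal_Form.Determinant"
begin

text \<open>
  Write the general subspaces as \<open>\<Pi>\<^sub>j = {y\<^sub>j = m\<^sub>j = 0}\<close>, where \<open>y\<^sub>0, \<dots>, y\<^sub>n\<close> are coordinates and, after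
  rescaling, \<open>m\<^sub>j = y\<^sub>0 + \<Sum>\<^sub>i b\<^sub>j\<^sub>i y\<^sub>i\<close>. General position then only means that the numbers
  \<open>b\<^sub>i\<^sub>j\<close> with \<open>i \<noteq> j\<close> are distinct for each \<open>j\<close> (locale \<open>pencil_frame\<close>).

  A linear relation among the \<open>2n\<close> forms has the shape \<open>\<Sum>\<^sub>j (\<beta>\<^sub>j m\<^sub>j - \<gamma>\<^sub>j y\<^sub>j) = 0\<close> with
  \<open>\<Sum>\<^sub>j \<beta>\<^sub>j = 0\<close> and \<open>\<gamma>\<^sub>j = \<Sum>\<^sub>i \<beta>\<^sub>i b\<^sub>i\<^sub>j\<close>, so the relations form a space of dimension
  \<open>n - 1\<close>. Each summand vanishes on \<open>\<Pi>\<^sub>j\<close>, and the summands of one relation are \<open>n\<close> dependent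
  forms, so they have at least a line of common zeros; generally this line is a transversal. The point
  \<open>v\<close> is a common zero of the summands of some nonzero relation if and only if the linear map that
  sends a relation to the values of its summands at \<open>v\<close> is not injective. As these values add up to
  zero, this map is a square matrix of size \<open>n - 1\<close> whose entries are linear in \<open>v\<close>. Its determinant
  is the form \<open>F\<close> of degree \<open>n - 1\<close> that defines \<open>Q\<close>; it is \<open>1 / y\<^sub>0\<close> times the determinant of an
  \<open>n \<times> n\<close> matrix whose rows have sum \<open>y\<^sub>0\<close>. \<open>F_zero_iff_transversal\<close> also
  treats the points of the \<open>\<Pi>\<^sub>j\<close> and the relations some of whose summands are zero forms.
  One column of the matrix vanishes at \<open>q\<close> for each \<open>\<Pi>\<^sub>j\<close> that contains \<open>q\<close>, which gives the bound
  on the multiplicity (\<open>multiplicity_bound\<close>).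

  The rest depends on restrictions to the subspaces spanned by the vertex \<open>e\<^sub>0\<close>, where all
  \<open>y\<^sub>j\<close> with \<open>j > 0\<close> vanish, and some of the other basis vectors \<open>e\<^sub>j\<close>. On the line through \<open>e\<^sub>0\<close> and
  \<open>e\<^sub>j\<close> the form \<open>F\<close> has the \<open>n - 1\<close> simple zeros \<open>e\<^sub>j - b\<^sub>i\<^sub>j e\<^sub>0\<close>, the nodes.

  \<^item> Uniqueness (\<open>F_unique\<close>): let \<open>G\<close> be a form of degree \<open>n - 1\<close> that vanishes on all \<open>\<Pi>\<^sub>j\<close> and at
    \<open>e\<^sub>0\<close>, and take a smallest set \<open>S\<close> of the variables \<open>y\<^sub>1, \<dots>, y\<^sub>n\<close> that occurs as support of a monomial
    of \<open>G\<close>. On the span of \<open>e\<^sub>0\<close> and the \<open>e\<^sub>j\<close> with \<open>j \<in> S\<close>, all monomials of \<open>G\<close> contain every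
    variable in \<open>S\<close>, so \<open>G\<close> has degree less than \<open>n - |S|\<close> in \<open>y\<^sub>0\<close>; but it vanishes on the
    \<open>n - |S|\<close> distinct hyperplanes cut out by the \<open>\<Pi>\<^sub>i\<close> with \<open>i \<notin> S\<close>. So \<open>G = 0\<close>.
  \<^item> Irreducibility (\<open>F_irreducible\<close>): if \<open>F = f g\<close>, each node is a zero of exactly one of \<open>f\<close> and \<open>g\<close>.
    Certain lines that join two nodes lie on \<open>Q\<close>, so both nodes are zeros of the same factor, and these
    lines connect all nodes. So one factor has no zero on the line through \<open>e\<^sub>0\<close> and \<open>e\<^sub>1\<close> and is constant.
  \<^item> Density of the points on a single transversal (\<open>dense_unique_transversal\<close>): \<open>F\<close> is monic in
    \<open>y\<^sub>0\<close>, so the projection of \<open>Q\<close> from \<open>e\<^sub>0\<close> is finite, and every component of its restriction to a line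
    through the image of \<open>e\<^sub>1\<close> meets the fibre over \<open>e\<^sub>1\<close>. This fibre consists of nodes, and
    these lie on a single transversal.

  The subspaces in general position form an open set because two pairs of linear forms with the same
  zero locus differ by an invertible \<open>2 \<times> 2\<close> matrix (\<open>same_zero_loci_general_position\<close>), and a dense one
  because an explicit example can be joined to any other point by a line.
\<close>

section \<open>Substitution in polynomials\<close>

abbreviation "keys \<equiv> Poly_Mapping.keys"
abbreviation "lookup \<equiv> Poly_Mapping.lookup"
abbreviation "single \<equiv> Poly_Mapping.single"

definition monom_eval :: "('v \<Rightarrow> 'b::comm_semiring_1) \<Rightarrow> ('v \<Rightarrow>\<^sub>0 nat) \<Rightarrow> 'b" where
  "monom_eval x m = (\<Prod>v\<in>keys m. x v ^ lookup m v)"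

lemma monom_eval_superset:
  assumes "finite V" "keys m \<subseteq> V"
  shows "monom_eval x m = (\<Prod>v\<in>V. x v ^ lookup m v)"
  unfolding monom_eval_def
  by (rule prod.mono_neutral_left) (use assms in \<open>auto simp: in_keys_iff\<close>)

lemma monom_eval_zero [simp]: "monom_eval x 0 = 1"
  by (simp add: monom_eval_def)

lemma monom_eval_single [simp]: "monom_eval x (single v k) = x v ^ k"
  by (simp add: monom_eval_def)

lemma monom_eval_add: "monom_eval x (m + m') = monom_eval x m * monom_eval x m'"
proof -
  let ?V = "keys m \<union> keys m'"
  have "keys (m + m') \<subseteq> ?V"
    by (rule Poly_Mapping.keys_add)
  then show ?thesis
    by (simp add: monom_eval_superset[of ?V] lookup_add power_add prod.distrib)
qed

lemma monom_degree_superset: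
  assumes "finite V" "keys m \<subseteq> V"
  shows "monom_degree m = (\<Sum>v\<in>V. lookup m v)"
  unfolding monom_degree_def
  by (rule sum.mono_neutral_left) (use assms in \<open>auto simp: in_keys_iff\<close>)

lemma monom_degree_add: "monom_degree (m + m') = monom_degree m + monom_degree m'"
proof -
  let ?V = "keys m \<union> keys m'"
  have "keys (m + m') \<subseteq> ?V"
    by (rule Poly_Mapping.keys_add)
  then show ?thesis
    by (simp add: monom_degree_superset[of ?V] lookup_add sum.distrib)
qed

lemma monom_degree_zero [simp]: "monom_degree 0 = 0"
  by (simp add: monom_degree_def)

lemma monom_degree_single [simp]: "monom_degree (single v k) = k"
  by (simp add: monom_degree_def)

lemma mpoly_sum_monomials:
  "(\<Sum>m\<in>keys p. single m (lookup p m)) = p"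
proof (rule poly_mapping_eqI)
  fix m
  have "lookup (\<Sum>m\<in>keys p. single m (lookup p m)) m
    = (\<Sum>k\<in>keys p. if k = m then lookup p k else 0)"
    by (simp add: lookup_sum lookup_single when_def)
  also have "\<dots> = lookup p m"
    by (simp add: in_keys_iff)
  finally show "lookup (\<Sum>m\<in>keys p. single m (lookup p m)) m
    = lookup p m" .
qed

text \<open>That \<open>\<phi>\<close> is a homomorphism is an assumption rather than an imported locale, because the rules that
  would be inherited are circular for the identity, the case of evaluation.\<close>

locale coeff_hom =
  fixes \<phi> :: "'a::comm_ring_1 \<Rightarrow> 'b::comm_ring_1"
  assumes coeff_hom: "comm_ring_hom \<phi>"
begin

interpretation comm_ring_hom \<phi>
  by (rule coeff_hom)

lemma mpoly_subst_superset:
  assumes "finite M" "keys p \<subseteq> M"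
  shows "mpoly_subst \<phi> x p = (\<Sum>m\<in>M. \<phi> (lookup p m) * monom_eval x m)"
  unfolding mpoly_subst_def monom_eval_def[symmetric]
  by (rule sum.mono_neutral_left) (use assms in \<open>auto simp: in_keys_iff\<close>)

lemma mpoly_subst_zero [simp]: "mpoly_subst \<phi> x 0 = 0"
  by (simp add: mpoly_subst_def)

lemma mpoly_subst_single [simp]:
  "mpoly_subst \<phi> x (single m c) = \<phi> c * monom_eval x m"
  by (subst mpoly_subst_superset[of "{m}"]) auto

lemma mpoly_subst_add [simp]: "mpoly_subst \<phi> x (p + q) = mpoly_subst \<phi> x p + mpoly_subst \<phi> x q"
proof -
  let ?M = "keys p \<union> keys q"
  have "keys (p + q) \<subseteq> ?M"
    by (rule Poly_Mapping.keys_add)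
  then show ?thesis
    by (simp add: mpoly_subst_superset[of ?M] lookup_add hom_add distrib_right sum.distrib)
qed

lemma mpoly_subst_sum: "mpoly_subst \<phi> x (sum f S) = (\<Sum>s\<in>S. mpoly_subst \<phi> x (f s))"
  by (induction S rule: infinite_finite_induct) auto

lemma mpoly_subst_mult [simp]: "mpoly_subst \<phi> x (p * q) = mpoly_subst \<phi> x p * mpoly_subst \<phi> x q"
proof -
  let ?s = "\<lambda>r m. single m (lookup r m)"
  have "p * q = (\<Sum>m\<in>keys p. \<Sum>m'\<in>keys q. ?s p m * ?s q m')"
    by (simp only: sum_product[symmetric] mpoly_sum_monomials)
  then have "mpoly_subst \<phi> x (p * q) = (\<Sum>m\<in>keys p. \<Sum>m'\<in>keys q.
      mpoly_subst \<phi> x (?s p m) * mpoly_subst \<phi> x (?s q m'))"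
    by (simp add: mpoly_subst_sum mult_single hom_mult monom_eval_add algebra_simps)
  also have "\<dots> = mpoly_subst \<phi> x p * mpoly_subst \<phi> x q"
    by (simp only: sum_product[symmetric] mpoly_subst_sum[symmetric] mpoly_sum_monomials)
  finally show ?thesis .
qed

lemma mpoly_subst_const [simp]: "mpoly_subst \<phi> x (mpoly_const c) = \<phi> c"
  by (simp add: mpoly_const_def)

lemma mpoly_subst_var [simp]: "mpoly_subst \<phi> x (mpoly_var v) = x v"
  by (simp add: mpoly_var_def)

lemma mpoly_subst_one [simp]: "mpoly_subst \<phi> x 1 = 1"
  using mpoly_subst_const[of x 1] by (simp add: mpoly_const_def)

lemma mpoly_subst_comm_ring_hom: "comm_ring_hom (mpoly_subst \<phi> x)"
  by unfold_locales auto

lemma mpoly_subst_diff [simp]: "mpoly_subst \<phi> x (p - q) = mpoly_subst \<phi> x p - mpoly_subst \<phi> x q"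
  by (metis add_diff_cancel_right' diff_add_cancel mpoly_subst_add)

lemma mpoly_subst_prod: "mpoly_subst \<phi> x (prod f S) = (\<Prod>s\<in>S. mpoly_subst \<phi> x (f s))"
  by (induction S rule: infinite_finite_induct) auto

lemma mpoly_subst_cong:
  assumes "\<And>m v. m \<in> keys p \<Longrightarrow> v \<in> keys m \<Longrightarrow> x v = y v"
  shows "mpoly_subst \<phi> x p = mpoly_subst \<phi> y p"
  unfolding mpoly_subst_def by (intro sum.cong prod.cong arg_cong2[where f = "(*)"]) (auto simp: assms)

text \<open>Every composite of substitutions below is identified by this rule.\<close>

lemma mpoly_subst_hom:
  assumes "comm_ring_hom h" and \<psi>: "\<And>c. \<psi> c = h (\<phi> c)"
  shows "h (mpoly_subst \<phi> x p) = mpoly_subst \<psi> (\<lambda>v. h (x v)) p"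
proof -
  interpret h: comm_ring_hom h by fact
  show ?thesis
    by (simp add: mpoly_subst_def h.hom_sum h.hom_mult h.hom_prod h.hom_power \<psi>)
qed

end

global_interpretation mpoly_eval: coeff_hom "\<lambda>c::'a::comm_ring_1. c"
  by (rule coeff_hom.intro) (unfold_locales, auto)

lemma mpoly_const_hom: "comm_ring_hom (mpoly_const :: 'a::comm_ring_1 \<Rightarrow> ('v, 'a) mpoly)"
  by unfold_locales (simp_all add: mpoly_const_def single_add mult_single)

global_interpretation mpoly_const: coeff_hom "mpoly_const :: 'a::comm_ring_1 \<Rightarrow> ('v, 'a) mpoly"
  by (simp add: coeff_hom_def mpoly_const_hom)

lemma monom_eval_mpoly_var: "monom_eval mpoly_var m = (single m 1 :: ('v, 'a::comm_ring_1) mpoly)"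
proof -
  have pow: "(single (single v 1) 1 :: ('v, 'a) mpoly) ^ k
      = single (single v k) 1" for v k
    by (induction k) (simp_all add: mult_single single_add[symmetric])
  have prd: "(\<Prod>v\<in>V. single (g v) 1 :: ('v, 'a) mpoly)
      = single (\<Sum>v\<in>V. g v) 1" for V and g :: "'v \<Rightarrow> 'v \<Rightarrow>\<^sub>0 nat"
    by (induction V rule: infinite_finite_induct) (simp_all add: mult_single)
  show ?thesis
    unfolding monom_eval_def mpoly_var_def pow prd mpoly_sum_monomials ..
qed

text \<open>This makes the change of coefficients a substitution, hence a ring homomorphism.\<close>

lemma mpoly_map_conv_subst:
  assumes "comm_ring_hom (h :: 'a::comm_ring_1 \<Rightarrow> 'b::comm_ring_1)"
  shows "Poly_Mapping.map h p = mpoly_subst (\<lambda>c. mpoly_const (h c)) mpoly_var p"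
proof -
  interpret h: comm_ring_hom h by fact
  have lookup_h: "lookup (Poly_Mapping.map h p) m = h (lookup p m)" for m
    by (cases "lookup p m = 0") (simp_all add: Poly_Mapping.map.rep_eq)
  have "Poly_Mapping.map h p
      = (\<Sum>m\<in>keys p. single m (h (lookup p m)))"
  proof (rule poly_mapping_eqI)
    fix m
    show "lookup (Poly_Mapping.map h p) m =
        lookup (\<Sum>m\<in>keys p. single m (h (lookup p m))) m"
      by (simp add: lookup_h lookup_sum lookup_single when_def in_keys_iff)
  qed
  then show ?thesis
    unfolding mpoly_subst_def monom_eval_def[symmetric] monom_eval_mpoly_var
    by (simp add: mpoly_const_def mult_single)
qed

lemma coeff_hom_comp_const:
  assumes "comm_ring_hom (h :: 'a::comm_ring_1 \<Rightarrow> 'b::comm_ring_1)"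
  shows "coeff_hom (\<lambda>c. mpoly_const (h c) :: ('v, 'b) mpoly)"
proof -
  interpret h: comm_ring_hom h by fact
  show ?thesis
    by (rule coeff_hom.intro, unfold_locales)
      (simp_all add: h.hom_add h.hom_mult mpoly_const_def single_add mult_single)
qed

lemma mpoly_map_hom:
  assumes "comm_ring_hom (h :: 'a::comm_ring_1 \<Rightarrow> 'b::comm_ring_1)"
  shows "comm_ring_hom (Poly_Mapping.map h :: ('v, 'a) mpoly \<Rightarrow> ('v, 'b) mpoly)"
proof -
  interpret coeff_hom "\<lambda>c. mpoly_const (h c) :: ('v, 'b) mpoly"
    by (rule coeff_hom_comp_const) fact
  have "Poly_Mapping.map h = (mpoly_subst (\<lambda>c. mpoly_const (h c)) mpoly_var :: ('v, 'a) mpoly \<Rightarrow> ('v, 'b) mpoly)"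
    by (rule ext) (rule mpoly_map_conv_subst[OF assms])
  then show ?thesis
    using mpoly_subst_comm_ring_hom[of mpoly_var] by simp
qed

lemma mpoly_map_const:
  assumes "comm_ring_hom (h :: 'a::comm_ring_1 \<Rightarrow> 'b::comm_ring_1)"
  shows "Poly_Mapping.map h (mpoly_const c) = mpoly_const (h c)"
proof -
  interpret h: comm_ring_hom h by fact
  show ?thesis
    by (simp add: mpoly_const_def)
qed

lemma mpoly_map_var:
  assumes "comm_ring_hom (h :: 'a::comm_ring_1 \<Rightarrow> 'b::comm_ring_1)"
  shows "Poly_Mapping.map h (mpoly_var v) = mpoly_var v"
proof -
  interpret h: comm_ring_hom h by fact
  show ?thesis
    by (simp add: mpoly_var_def)
qed

section \<open>Homogeneous polynomials\<close>

definition homogeneous :: "nat \<Rightarrow> ('v, 'a::zero) mpoly set" where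
  "homogeneous d = {f. \<forall>m\<in>keys f. monom_degree m = d}"

lemma forms_subset_homogeneous: "forms n d \<subseteq> homogeneous d"
  by (auto simp: forms_def homogeneous_def)

lemma forms_zero [simp]: "0 \<in> forms n d"
  by (simp add: forms_def)

lemma forms_add: "f \<in> forms n d \<Longrightarrow> g \<in> forms n d \<Longrightarrow> f + g \<in> forms n d"
  using Poly_Mapping.keys_add[of f g] unfolding forms_def by blast

lemma forms_sum: "(\<And>s. s \<in> S \<Longrightarrow> f s \<in> forms n d) \<Longrightarrow> sum f S \<in> forms n d"
  by (induction S rule: infinite_finite_induct) (auto intro: forms_add)

lemma forms_mult:
  fixes f g :: "(nat, 'a::comm_ring_1) mpoly"
  assumes "f \<in> forms n d" "g \<in> forms n e"
  shows "f * g \<in> forms n (d + e)"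
  unfolding forms_def
proof (intro CollectI ballI)
  fix m assume "m \<in> keys (f * g)"
  then obtain a b where "m = a + b" "a \<in> keys f" "b \<in> keys g"
    using Poly_Mapping.keys_mult[of f g] by blast
  then show "monom_degree m = d + e \<and> keys m \<subseteq> {..n}"
    using assms Poly_Mapping.keys_add[of a b] by (fastforce simp: forms_def monom_degree_add)
qed

lemma forms_const: "mpoly_const c \<in> forms n 0"
  by (auto simp: forms_def mpoly_const_def split: if_splits)

lemma forms_one: "(1 :: (nat, 'a::comm_ring_1) mpoly) \<in> forms n 0"
  by (auto simp: forms_def)

lemma forms_var: "v \<le> n \<Longrightarrow> mpoly_var v \<in> forms n 1"
  by (auto simp: forms_def mpoly_var_def)

lemma forms_scale:
  fixes f :: "(nat, 'a::comm_ring_1) mpoly"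
  shows "f \<in> forms n d \<Longrightarrow> mpoly_const c * f \<in> forms n d"
  using forms_mult[OF forms_const] by fastforce

lemma forms_uminus:
  fixes f :: "(nat, 'a::comm_ring_1) mpoly"
  shows "f \<in> forms n d \<Longrightarrow> - f \<in> forms n d"
  by (auto simp: forms_def in_keys_iff)

lemma forms_diff:
  fixes f :: "(nat, 'a::comm_ring_1) mpoly"
  shows "f \<in> forms n d \<Longrightarrow> g \<in> forms n d \<Longrightarrow> f - g \<in> forms n d"
  using forms_add[of f n d "- g"] by (simp add: forms_uminus)

lemma forms_prod:
  fixes f :: "'s \<Rightarrow> (nat, 'a::comm_ring_1) mpoly"
  shows "(\<And>s. s \<in> S \<Longrightarrow> f s \<in> forms n (d s)) \<Longrightarrow> prod f S \<in> forms n (sum d S)"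
  by (induction S rule: infinite_finite_induct) (auto intro: forms_mult forms_one)

lemma forms_power:
  fixes f :: "(nat, 'a::comm_ring_1) mpoly"
  shows "f \<in> forms n d \<Longrightarrow> f ^ k \<in> forms n (k * d)"
  by (induction k) (auto intro: forms_mult forms_one)

lemma forms_subst:
  fixes f :: "(nat, 'a::comm_ring_1) mpoly" and g :: "nat \<Rightarrow> (nat, 'a) mpoly"
  assumes f: "f \<in> forms n d" and g: "\<And>i. i \<le> n \<Longrightarrow> g i \<in> forms n' 1"
  shows "mpoly_subst mpoly_const g f \<in> forms n' d"
  unfolding mpoly_subst_def
proof (rule forms_sum, rule forms_scale)
  fix m assume "m \<in> keys f"
  then have m: "monom_degree m = d" "keys m \<subseteq> {..n}"
    using f by (auto simp: forms_def)
  have "(\<Prod>v\<in>keys m. g v ^ lookup m v)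
      \<in> forms n' (\<Sum>v\<in>keys m. lookup m v * 1)"
    using m(2) by (intro forms_prod forms_power g) auto
  then show "(\<Prod>v\<in>keys m. g v ^ lookup m v) \<in> forms n' d"
    using m(1) by (simp add: monom_degree_def)
qed

lemma forms_eval_cong:
  fixes f :: "(nat, 'a::comm_ring_1) mpoly"
  assumes "f \<in> forms n d" "\<And>i. i \<le> n \<Longrightarrow> x i = y i"
  shows "mpoly_eval x f = mpoly_eval y f"
  by (rule mpoly_eval.mpoly_subst_cong) (use assms in \<open>auto simp: forms_def\<close>)

lemma monom_eval_scale: "monom_eval (\<lambda>v. c * x v) m = c ^ monom_degree m * monom_eval x m"
  by (simp add: monom_eval_def monom_degree_def power_mult_distrib prod.distrib power_sum)

lemma homogeneous_eval_scale:
  fixes f :: "('v, 'a::comm_ring_1) mpoly"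
  assumes "f \<in> homogeneous d"
  shows "mpoly_eval (\<lambda>v. c * x v) f = c ^ d * mpoly_eval x f"
  using assms
  by (simp add: mpoly_subst_def monom_eval_def[symmetric] monom_eval_scale homogeneous_def
      sum_distrib_left mult_ac cong: sum.cong)

lemma coeff_mult_top:
  fixes p q :: "'a::comm_ring_1 poly"
  assumes "degree p \<le> a" "degree q \<le> b"
  shows "coeff (p * q) (a + b) = coeff p a * coeff q b"
proof -
  have "coeff p i * coeff q (a + b - i) = 0" if "i \<noteq> a" for i
    using assms that by (cases "i < a") (auto simp: coeff_eq_0)
  then have "coeff (p * q) (a + b) = (\<Sum>i\<in>{a}. coeff p i * coeff q (a + b - i))"
    unfolding coeff_mult by (intro sum.mono_neutral_right) auto
  then show ?thesis
    by simp
qed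

text \<open>The restriction of \<open>f\<close> to the line with direction \<open>x\<close> through \<open>y\<close>, as a polynomial in the parameter.
  The values of \<open>\<phi>\<close> may lie in a larger ring, so that the line can move in a family.\<close>

definition line_poly ::
  "('a::comm_ring_1 \<Rightarrow> 'b::comm_ring_1) \<Rightarrow> ('v \<Rightarrow> 'b) \<Rightarrow> ('v \<Rightarrow> 'b) \<Rightarrow> ('v, 'a) mpoly \<Rightarrow> 'b poly" where
  "line_poly \<phi> x y f = mpoly_subst (\<lambda>c. [:\<phi> c:]) (\<lambda>v. [:y v, x v:]) f"

context coeff_hom
begin

interpretation comm_ring_hom \<phi>
  by (rule coeff_hom)

lemma coeff_hom_pCons: "coeff_hom (\<lambda>c. [:\<phi> c:])"
  by (rule coeff_hom.intro, unfold_locales) (simp_all add: hom_add hom_mult one_pCons)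

lemma line_poly_mult [simp]: "line_poly \<phi> x y (f * g) = line_poly \<phi> x y f * line_poly \<phi> x y g"
  unfolding line_poly_def by (rule coeff_hom.mpoly_subst_mult[OF coeff_hom_pCons])

lemma poly_line_poly: "poly (line_poly \<phi> x y f) t = mpoly_subst \<phi> (\<lambda>v. y v + t * x v) f"
proof -
  interpret p: coeff_hom "\<lambda>c. [:\<phi> c:]" by (rule coeff_hom_pCons)
  have "comm_ring_hom (\<lambda>p :: 'b poly. poly p t)"
    by unfold_locales auto
  then have "poly (line_poly \<phi> x y f) t = mpoly_subst \<phi> (\<lambda>v. poly [:y v, x v:] t) f"
    unfolding line_poly_def by (rule p.mpoly_subst_hom) simp
  then show ?thesis
    by simp
qed

lemma line_poly_homogeneous:
  assumes "f \<in> homogeneous d"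
  shows "degree (line_poly \<phi> x y f) \<le> d" and "coeff (line_poly \<phi> x y f) d = mpoly_subst \<phi> x f"
proof -
  have pow: "degree ([:b, a:] ^ k) \<le> k \<and> coeff ([:b, a:] ^ k) k = a ^ k" for a b :: 'b and k
  proof (induction k)
    case (Suc k)
    have d: "degree [:b, a:] \<le> 1"
      by simp
    have "degree ([:b, a:] ^ Suc k) \<le> Suc k"
      using degree_mult_le[of "[:b, a:]" "[:b, a:] ^ k"] Suc d by simp
    moreover have "coeff ([:b, a:] ^ Suc k) (1 + k) = a * a ^ k"
      using coeff_mult_top[OF d, of "[:b, a:] ^ k" k] Suc by simp
    ultimately show ?case
      by simp
  qed simp
  have prd: "degree (\<Prod>v\<in>V. [:y v, x v:] ^ e v) \<le> sum e V \<and>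
      coeff (\<Prod>v\<in>V. [:y v, x v:] ^ e v) (sum e V) = (\<Prod>v\<in>V. x v ^ e v)" for V e
  proof (induction V rule: infinite_finite_induct)
    case (insert v V)
    let ?p = "[:y v, x v:] ^ e v" and ?q = "\<Prod>v\<in>V. [:y v, x v:] ^ e v"
    have "degree (?p * ?q) \<le> e v + sum e V"
      using degree_mult_le[of ?p ?q] insert.IH pow[of "y v" "x v" "e v"] by linarith
    moreover have "coeff (?p * ?q) (e v + sum e V) = x v ^ e v * (\<Prod>v\<in>V. x v ^ e v)"
      using coeff_mult_top[of ?p "e v" ?q "sum e V"] insert.IH pow[of "y v" "x v" "e v"] by simp
    ultimately show ?case
      using insert.hyps by simp
  qed auto
  have mon: "degree (monom_eval (\<lambda>v. [:y v, x v:]) m) \<le> d"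
      "coeff (monom_eval (\<lambda>v. [:y v, x v:]) m) d = monom_eval x m"
    if "m \<in> keys f" for m
    using prd[of "lookup m" "keys m"] assms that
    by (auto simp: monom_eval_def homogeneous_def monom_degree_def)
  have sub: "line_poly \<phi> x y f = (\<Sum>m\<in>keys f.
      smult (\<phi> (lookup f m)) (monom_eval (\<lambda>v. [:y v, x v:]) m))"
    by (simp add: line_poly_def mpoly_subst_def monom_eval_def)
  show "degree (line_poly \<phi> x y f) \<le> d"
    unfolding sub by (intro degree_sum_le) (auto intro: order.trans[OF degree_smult_le] mon)
  show "coeff (line_poly \<phi> x y f) d = mpoly_subst \<phi> x f"
    unfolding sub by (simp add: coeff_sum mon mpoly_subst_def monom_eval_def[symmetric])
qed

end

lemma poly_mult_eq_monom:
  fixes p q :: "'a::idom poly"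
  assumes "p * q = monom c d" "c \<noteq> 0"
  shows "p = monom (coeff p (degree p)) (degree p)" "degree p + degree q = d"
proof -
  have nz: "p * q \<noteq> 0"
    using assms by auto
  then have pq: "p \<noteq> 0" "q \<noteq> 0"
    by auto
  have "degree p + degree q = degree (monom c d)"
    using assms degree_mult_eq[OF pq] by simp
  then show deg: "degree p + degree q = d"
    using assms(2) by (simp add: degree_monom_eq)
  have "order 0 p + order 0 q = order 0 (monom c d)"
    using assms(1) order_mult[OF nz] by simp
  also have "\<dots> = d"
    using assms(2) by (rule order_0_monom)
  finally have "degree p \<le> order 0 p"
    using deg order_degree[OF pq(1), of 0] order_degree[OF pq(2), of 0] by linarith
  then have "monom 1 (degree p) dvd p"
    using pq by (simp add: monom_1_dvd_iff)
  then have "\<forall>k<degree p. coeff p k = 0"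
    by (simp add: monom_1_dvd_iff')
  then show "p = monom (coeff p (degree p)) (degree p)"
    by (intro poly_eqI) (metis coeff_eq_0 coeff_monom linorder_neqE_nat)
qed

text \<open>Replace every variable \<open>X\<^sub>v\<close> by \<open>X\<^sub>v t\<close>. This turns \<open>f g\<close> into a monomial in \<open>t\<close>, and over a domain the
  factors of a monomial are monomials.\<close>

lemma homogeneous_factors:
  fixes f g :: "(nat, 'a::idom) mpoly"
  assumes fg: "f * g \<in> homogeneous d" and nz: "f * g \<noteq> 0"
  obtains a b where "f \<in> homogeneous a" "g \<in> homogeneous b" "a + b = d"
proof -
  \<comment> \<open>The coefficient of \<open>t ^ k\<close> in \<open>\<psi> f\<close> is the homogeneous part of \<open>f\<close> of degree \<open>k\<close>.\<close>
  define \<psi> :: "(nat, 'a) mpoly \<Rightarrow> (nat, 'a) mpoly poly" where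
    "\<psi> = mpoly_subst (\<lambda>c. [:mpoly_const c:]) (\<lambda>v. [:0, mpoly_var v:])"
  interpret P: coeff_hom "\<lambda>c. [:mpoly_const c :: (nat, 'a) mpoly:]"
    by (rule mpoly_const.coeff_hom_pCons)
  have mon: "monom_eval (\<lambda>v. [:0, mpoly_var v:] :: (nat, 'a) mpoly poly) m
      = monom (single m 1) (monom_degree m)" for m
  proof -
    have pow: "[:0, a:] ^ k = monom (a ^ k) k" for a :: "(nat, 'a) mpoly" and k
      by (induction k) (simp_all add: monom_Suc monom_0 one_pCons smult_monom)
    have prd: "(\<Prod>v\<in>V. monom (h v) (e v)) = monom (prod h V) (sum e V)"
      for V :: "nat set" and h :: "nat \<Rightarrow> (nat, 'a) mpoly" and e
      by (induction V rule: infinite_finite_induct) (simp_all add: mult_monom monom_0 one_pCons)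
    show ?thesis
      unfolding monom_eval_def pow prd monom_degree_def
      by (simp add: monom_eval_def[symmetric] monom_eval_mpoly_var)
  qed
  have \<psi>: "\<psi> f = (\<Sum>m\<in>keys f. monom (single m (lookup f m)) (monom_degree m))" for f
    unfolding \<psi>_def mpoly_subst_def monom_eval_def[symmetric] mon
    by (simp add: smult_monom mpoly_const_def mult_single)
  have coeff_\<psi>: "lookup (coeff (\<psi> f) (monom_degree m)) m = lookup f m" for f m
  proof -
    have "lookup (coeff (\<psi> f) (monom_degree m)) m = (\<Sum>k\<in>keys f.
        if k = m then lookup f k else 0)"
      unfolding \<psi> coeff_sum lookup_sum
      by (intro sum.cong) (auto simp: lookup_single when_def)
    also have "\<dots> = lookup f m"
      by (simp add: in_keys_iff)
    finally show ?thesis .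
  qed
  have \<psi>_monom: "\<psi> h = monom h d" if "h \<in> homogeneous d" for h
  proof -
    have "\<psi> h = (\<Sum>m\<in>keys h. monom (single m (lookup h m)) d)"
      unfolding \<psi> using that by (intro sum.cong) (auto simp: homogeneous_def)
    also have "\<dots> = monom (\<Sum>m\<in>keys h. single m (lookup h m)) d"
      by (rule poly_eqI) (simp add: coeff_sum)
    finally show ?thesis
      by (simp only: mpoly_sum_monomials)
  qed
  have \<psi>_mult: "\<psi> f * \<psi> g = monom (f * g) d" "\<psi> g * \<psi> f = monom (f * g) d"
    using \<psi>_monom[OF fg] unfolding \<psi>_def by (simp_all add: mult.commute)
  have hom: "h \<in> homogeneous (degree (\<psi> h))"
    if "\<psi> h = monom (coeff (\<psi> h) (degree (\<psi> h))) (degree (\<psi> h))" for h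
    unfolding homogeneous_def
  proof (intro CollectI ballI)
    fix m assume "m \<in> keys h"
    then have "coeff (\<psi> h) (monom_degree m) \<noteq> 0"
      using coeff_\<psi>[of h m] by (auto simp: in_keys_iff)
    then show "monom_degree m = degree (\<psi> h)"
      by (subst (asm) that) (auto split: if_splits)
  qed
  show thesis
    using poly_mult_eq_monom[OF \<psi>_mult(1) nz] poly_mult_eq_monom[OF \<psi>_mult(2) nz]
    by (intro that[of "degree (\<psi> f)" "degree (\<psi> g)"] hom) auto
qed

definition linear_form :: "nat \<Rightarrow> (nat \<Rightarrow> 'a::comm_ring_1) \<Rightarrow> (nat, 'a) mpoly" where
  "linear_form n c = (\<Sum>k\<le>n. mpoly_const (c k) * mpoly_var k)"

lemma linear_form_forms: "linear_form n c \<in> forms n 1"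
  unfolding linear_form_def by (intro forms_sum forms_scale forms_var) simp

lemma (in coeff_hom) mpoly_subst_linear_form:
  "mpoly_subst \<phi> x (linear_form n c) = (\<Sum>k\<le>n. \<phi> (c k) * x k)"
  by (simp add: linear_form_def mpoly_subst_sum)

lemma homogeneous_0_const:
  assumes "f \<in> homogeneous 0"
  shows "f = mpoly_const (lookup f 0)"
proof (rule poly_mapping_eqI)
  fix m
  show "lookup f m = lookup (mpoly_const (lookup f 0)) m"
  proof (cases "m = 0")
    case False
    then obtain v where "v \<in> keys m"
      by (metis ex_in_conv keys_eq_empty)
    then have "monom_degree m \<noteq> 0"
      by (auto simp: monom_degree_def in_keys_iff)
    then have "m \<notin> keys f"
      using assms by (auto simp: homogeneous_def)
    then have "lookup f m = 0"
      by (simp add: in_keys_iff)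
    then show ?thesis
      using False by (simp add: mpoly_const_def lookup_single)
  qed (simp add: mpoly_const_def)
qed

lemma mpoly_const_is_unit:
  fixes c :: "'a::field"
  assumes "c \<noteq> 0"
  shows "(mpoly_const c :: ('v, 'a) mpoly) dvd 1"
proof
  show "(1 :: ('v, 'a) mpoly) = mpoly_const c * mpoly_const (inverse c)"
    using assms by (simp add: mpoly_const_def mult_single)
qed

lemma irreducible_unit_mult:
  fixes p u :: "'a::comm_ring_1"
  assumes "irreducible p" "u dvd 1"
  shows "irreducible (u * p)"
proof -
  obtain u' where u': "1 = u * u'"
    using assms(2) ..
  then have cancel: "u' * (u * q) = q" for q
    by (metis mult.assoc mult.commute mult_1)
  show ?thesis
  proof (rule irreducibleI)
    show "u * p \<noteq> 0"
      using assms(1) cancel[of p] by (auto simp: irreducible_def)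
    show "\<not> u * p dvd 1"
      using assms(1) dvd_mult_right by (auto simp: irreducible_def)
    fix a b assume "u * p = a * b"
    then have "p = (u' * a) * b"
      using cancel[of p] by (simp add: mult.assoc)
    then have "u' * a dvd 1 \<or> b dvd 1"
      by (rule irreducibleD[OF assms(1)])
    then show "a dvd 1 \<or> b dvd 1"
      using dvd_mult_right by blast
  qed
qed

section \<open>Points where a polynomial does not vanish\<close>

lemma base_expansion_unique:
  fixes f g :: "nat \<Rightarrow> nat"
  assumes "\<And>v. f v < N" "\<And>v. g v < N" "(\<Sum>v<D. f v * N ^ v) = (\<Sum>v<D. g v * N ^ v)" "v < D"
  shows "f v = g v"
  using assms
proof (induction D arbitrary: f g v)
  case (Suc D)
  have split: "(\<Sum>v<Suc D. h v * N ^ v) = h 0 + N * (\<Sum>v<D. h (Suc v) * N ^ v)" for h :: "nat \<Rightarrow> nat"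
    by (simp only: sum.lessThan_Suc_shift) (simp add: sum_distrib_left mult_ac)
  have eq: "f 0 + N * (\<Sum>v<D. f (Suc v) * N ^ v) = g 0 + N * (\<Sum>v<D. g (Suc v) * N ^ v)"
    using Suc.prems(3) by (simp only: split)
  have "f 0 = g 0"
    using arg_cong[OF eq, of "\<lambda>x. x mod N"] Suc.prems(1,2) by simp
  moreover have "N > 0"
    using Suc.prems(1)[of 0] by simp
  ultimately have "(\<Sum>v<D. f (Suc v) * N ^ v) = (\<Sum>v<D. g (Suc v) * N ^ v)"
    using eq by simp
  then have "f (Suc w) = g (Suc w)" if "w < D" for w
    using Suc.IH[of "\<lambda>v. f (Suc v)" "\<lambda>v. g (Suc v)"] Suc.prems(1,2) that by blast
  then show ?case
    using \<open>f 0 = g 0\<close> Suc.prems(4) by (cases v) auto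
qed simp

text \<open>Kronecker's substitution \<open>X\<^sub>v \<mapsto> t ^ (N ^ v)\<close> with \<open>N\<close> larger than all exponents takes distinct monomials to
  distinct powers of \<open>t\<close>, so a nonzero polynomial stays nonzero.\<close>

lemma mpoly_nonvanishing:
  fixes f :: "(nat, 'a::idom) mpoly"
  assumes "infinite (UNIV :: 'a set)" "f \<noteq> 0"
  obtains x where "mpoly_eval x f \<noteq> 0"
proof -
  define D where "D = Suc (Max (insert 0 (\<Union>(keys ` keys f))))"
  define N where "N = Suc (Max (insert 0 (\<Union>m\<in>keys f. lookup m ` keys m)))"
  have D: "keys m \<subseteq> {..<D}" if "m \<in> keys f" for m
    using that unfolding D_def by (auto simp: less_Suc_eq_le intro!: Max_ge)
  have N: "lookup m v < N" if "m \<in> keys f" for m v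
  proof (cases "v \<in> keys m")
    case True
    then show ?thesis
      using that unfolding N_def less_Suc_eq_le by (intro Max_ge) auto
  next
    case False
    then show ?thesis
      by (simp add: in_keys_iff N_def)
  qed
  define w where "w m = (\<Sum>v<D. lookup m v * N ^ v)" for m :: "nat \<Rightarrow>\<^sub>0 nat"
  have w_inj: "m = m'" if "m \<in> keys f" "m' \<in> keys f" "w m = w m'" for m m'
  proof (rule poly_mapping_eqI)
    fix v
    show "lookup m v = lookup m' v"
    proof (cases "v < D")
      case True
      then show ?thesis
        using base_expansion_unique[of "lookup m" N "lookup m'" D v] N that
        by (auto simp: w_def)
    next
      case False
      then have "v \<notin> keys m" "v \<notin> keys m'"
        using D[OF that(1)] D[OF that(2)] by auto
      then show ?thesis
        by (simp add: in_keys_iff)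
    qed
  qed
  define p where "p = (\<Sum>m\<in>keys f. monom (lookup f m) (w m))"
  obtain m0 where m0: "m0 \<in> keys f"
    using assms(2) by (metis ex_in_conv keys_eq_empty)
  have "coeff p (w m0) = (\<Sum>m\<in>keys f. if m = m0 then lookup f m else 0)"
    unfolding p_def coeff_sum using w_inj[OF _ m0] by (intro sum.cong) (auto simp: m0)
  also have "\<dots> = lookup f m0"
    using m0 by simp
  finally have "p \<noteq> 0"
    using m0 by (auto simp: in_keys_iff)
  then obtain t where t: "poly p t \<noteq> 0"
    using poly_roots_finite assms(1) by (metis (mono_tags, lifting) UNIV_eq_I mem_Collect_eq)
  have "monom_eval (\<lambda>v. t ^ N ^ v) m = t ^ w m" if "m \<in> keys f" for m
    unfolding monom_eval_superset[OF finite_lessThan D[OF that]] w_def power_sum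
    by (simp add: power_mult[symmetric] mult.commute)
  then have "mpoly_eval (\<lambda>v. t ^ N ^ v) f = poly p t"
    by (simp add: mpoly_subst_def monom_eval_def[symmetric] p_def poly_sum poly_monom)
  with t show thesis
    by (intro that[of "\<lambda>v. t ^ N ^ v"]) simp
qed

lemma poly_eq_0_if_all_roots:
  fixes p :: "'a::{idom, ring_char_0} poly"
  assumes "\<And>t. poly p t = 0"
  shows "p = 0"
  using assms poly_all_0_iff_0 by blast

text \<open>One of two factors vanishes identically on a line on which the product does; it is \<open>f\<close> if \<open>g\<close> is
  nonzero at some point of the line.\<close>

lemma factor_vanishes_on_line:
  fixes f g :: "(nat, 'a::{idom, ring_char_0}) mpoly"
  assumes "\<And>t. mpoly_eval (\<lambda>k. (1 - t) * v k + t * w k) (f * g) = 0" "mpoly_eval v g \<noteq> 0"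
  shows "mpoly_eval w f = 0"
proof -
  let ?l = "line_poly (\<lambda>c. c) (\<lambda>k. w k - v k) v"
  have l: "poly (?l h) t = mpoly_eval (\<lambda>k. (1 - t) * v k + t * w k) h" for h t
    unfolding mpoly_eval.poly_line_poly by (simp add: algebra_simps)
  have "?l f * ?l g = 0"
    by (rule poly_eq_0_if_all_roots)
      (use assms(1) in \<open>simp add: l flip: mpoly_eval.line_poly_mult\<close>)
  moreover have "?l g \<noteq> 0"
    using l[of g 0] assms(2) by auto
  ultimately have "?l f = 0"
    by simp
  then show ?thesis
    using l[of f 1] by simp
qed

lemma common_nonvanishing_on_line:
  fixes G P :: "('v, 'a::field_char_0) mpoly"
  assumes "mpoly_eval x G \<noteq> 0" "mpoly_eval (\<lambda>v. x v + d v) P \<noteq> 0"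
  obtains s where "mpoly_eval (\<lambda>v. x v + s * d v) G \<noteq> 0" "mpoly_eval (\<lambda>v. x v + s * d v) P \<noteq> 0"
proof -
  let ?l = "line_poly (\<lambda>c. c) d x"
  have "poly (?l G) 0 \<noteq> 0" "poly (?l P) 1 \<noteq> 0"
    using assms by (simp_all add: mpoly_eval.poly_line_poly)
  then have "?l G \<noteq> 0" "?l P \<noteq> 0"
    by auto
  then have "?l G * ?l P \<noteq> 0"
    by simp
  then obtain s where "poly (?l G * ?l P) s \<noteq> 0"
    using poly_all_0_iff_0 by blast
  then show thesis
    using that[of s] by (simp add: mpoly_eval.poly_line_poly)
qed

section \<open>Vanishing order at the origin\<close>

definition order_ge :: "nat \<Rightarrow> ('v, 'a::zero) mpoly set" where
  "order_ge r = {f. \<forall>m\<in>keys f. monom_degree m \<ge> r}"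

lemma order_ge_0 [simp]: "f \<in> order_ge 0"
  by (simp add: order_ge_def)

lemma order_ge_zero: "0 \<in> order_ge r"
  by (simp add: order_ge_def)

lemma order_ge_add: "f \<in> order_ge r \<Longrightarrow> g \<in> order_ge r \<Longrightarrow> f + g \<in> order_ge r"
  using Poly_Mapping.keys_add[of f g] unfolding order_ge_def by blast

lemma order_ge_sum: "(\<And>s. s \<in> S \<Longrightarrow> f s \<in> order_ge r) \<Longrightarrow> sum f S \<in> order_ge r"
  by (induction S rule: infinite_finite_induct) (auto intro: order_ge_add order_ge_zero)

lemma order_ge_mult:
  fixes f g :: "('v, 'a::comm_ring_1) mpoly"
  assumes "f \<in> order_ge r" "g \<in> order_ge s"
  shows "f * g \<in> order_ge (r + s)"
  unfolding order_ge_def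
proof (intro CollectI ballI)
  fix m assume "m \<in> keys (f * g)"
  then obtain a b where "m = a + b" "a \<in> keys f" "b \<in> keys g"
    using Poly_Mapping.keys_mult[of f g] by blast
  then show "monom_degree m \<ge> r + s"
    using assms by (fastforce simp: order_ge_def monom_degree_add)
qed

lemma order_ge_scale:
  fixes f :: "('v, 'a::comm_ring_1) mpoly"
  assumes "f \<in> order_ge r"
  shows "g * f \<in> order_ge r"
  using order_ge_mult[OF order_ge_0 assms] by simp

lemma order_ge_prod:
  fixes f :: "'s \<Rightarrow> ('v, 'a::comm_ring_1) mpoly"
  shows "(\<And>s. s \<in> S \<Longrightarrow> f s \<in> order_ge (r s)) \<Longrightarrow> prod f S \<in> order_ge (sum r S)"
  by (induction S rule: infinite_finite_induct) (auto intro: order_ge_mult)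

section \<open>Determinants\<close>

definition fdet :: "nat \<Rightarrow> (nat \<Rightarrow> nat \<Rightarrow> 'a::comm_ring_1) \<Rightarrow> 'a" where
  "fdet n M = Determinant.det (Matrix.mat n n (\<lambda>(i, j). M i j))"

lemma fdet_expand:
  "fdet n M = (\<Sum>p\<in>{p. p permutes {0..<n}}. of_int (sign p) * (\<Prod>i=0..<n. M i (p i)))"
  unfolding fdet_def Determinant.det_def
  by (auto intro!: sum.cong prod.cong arg_cong2[where f = "(*)"] simp: permutes_in_image[of _ "{0..<n}", simplified])

lemma fdet_transpose: "fdet n (\<lambda>i j. M j i) = fdet n M"
proof -
  have "Matrix.mat n n (\<lambda>(i, j). M j i) = transpose_mat (Matrix.mat n n (\<lambda>(i, j). M i j))"
    by (rule eq_matI) auto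
  then show ?thesis
    unfolding fdet_def by (metis det_transpose mat_carrier)
qed

lemma fdet_hom:
  assumes "comm_ring_hom h"
  shows "h (fdet n M) = fdet n (\<lambda>i j. h (M i j))"
proof -
  interpret h: comm_ring_hom h by fact
  have "Matrix.mat n n (\<lambda>(i, j). h (M i j)) = map_mat h (Matrix.mat n n (\<lambda>(i, j). M i j))"
    by (rule eq_matI) auto
  then show ?thesis
    by (simp add: fdet_def)
qed

lemma fdet_cong: "(\<And>i j. i < n \<Longrightarrow> j < n \<Longrightarrow> M i j = M' i j) \<Longrightarrow> fdet n M = fdet n M'"
  unfolding fdet_def by (intro arg_cong[where f = Determinant.det] eq_matI) auto

lemma fdet_eq_0_iff:
  fixes M :: "nat \<Rightarrow> nat \<Rightarrow> 'a::field"
  shows "fdet n M = 0 \<longleftrightarrow> (\<exists>x. (\<exists>j<n. x j \<noteq> 0) \<and> (\<forall>i<n. (\<Sum>j<n. M i j * x j) = 0))"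
proof -
  let ?A = "Matrix.mat n n (\<lambda>(i, j). M i j)"
  have mult: "?A *\<^sub>v Matrix.vec n x = 0\<^sub>v n \<longleftrightarrow> (\<forall>i<n. (\<Sum>j<n. M i j * x j) = 0)" for x
    by (auto simp: vec_eq_iff scalar_prod_def atLeast0LessThan)
  have nz: "Matrix.vec n x \<noteq> 0\<^sub>v n \<longleftrightarrow> (\<exists>j<n. x j \<noteq> 0)" for x :: "nat \<Rightarrow> 'a"
    by (auto simp: vec_eq_iff)
  have "fdet n M = 0 \<longleftrightarrow> (\<exists>v. v \<in> carrier_vec n \<and> v \<noteq> 0\<^sub>v n \<and> ?A *\<^sub>v v = 0\<^sub>v n)"
    unfolding fdet_def by (rule det_0_iff_vec_prod_zero_field) simp
  also have "\<dots> \<longleftrightarrow> (\<exists>x. Matrix.vec n x \<noteq> 0\<^sub>v n \<and> ?A *\<^sub>v Matrix.vec n x = 0\<^sub>v n)"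
  proof (intro iffI)
    assume "\<exists>v. v \<in> carrier_vec n \<and> v \<noteq> 0\<^sub>v n \<and> ?A *\<^sub>v v = 0\<^sub>v n"
    then obtain v where v: "v \<in> carrier_vec n" "v \<noteq> 0\<^sub>v n" "?A *\<^sub>v v = 0\<^sub>v n"
      by blast
    have "Matrix.vec n (\<lambda>i. v $ i) = v"
      using v(1) by (intro eq_vecI) auto
    with v(2,3) show "\<exists>x. Matrix.vec n x \<noteq> 0\<^sub>v n \<and> ?A *\<^sub>v Matrix.vec n x = 0\<^sub>v n"
      by (intro exI[of _ "\<lambda>i. v $ i"]) simp
  next
    assume "\<exists>x. Matrix.vec n x \<noteq> 0\<^sub>v n \<and> ?A *\<^sub>v Matrix.vec n x = 0\<^sub>v n"
    then show "\<exists>v. v \<in> carrier_vec n \<and> v \<noteq> 0\<^sub>v n \<and> ?A *\<^sub>v v = 0\<^sub>v n"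
      using vec_carrier by blast
  qed
  finally show ?thesis
    unfolding mult nz .
qed

lemma fdet_eq_0_iff_left:
  fixes M :: "nat \<Rightarrow> nat \<Rightarrow> 'a::field"
  shows "fdet n M = 0 \<longleftrightarrow> (\<exists>x. (\<exists>i<n. x i \<noteq> 0) \<and> (\<forall>j<n. (\<Sum>i<n. x i * M i j) = 0))"
  using fdet_eq_0_iff[of n "\<lambda>i j. M j i"] unfolding fdet_transpose[of n M] by (simp only: mult.commute)

lemma fdet_scale_column:
  assumes "k < n"
  shows "fdet n (\<lambda>i j. if j = k then s * M i j else M i j) = s * fdet n M"
proof -
  have "(\<Prod>i=0..<n. if i = k then s * g i else g i) = s * (\<Prod>i=0..<n. g i)" for g :: "nat \<Rightarrow> 'a"
  proof -
    have "(\<Prod>i=0..<n. if i = k then s * g i else g i) = (\<Prod>i=0..<n. (if i = k then s else 1) * g i)"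
      by (intro prod.cong) auto
    also have "\<dots> = s * (\<Prod>i=0..<n. g i)"
      using assms by (simp add: prod.distrib)
    finally show ?thesis .
  qed
  then have "fdet n (\<lambda>i j. if i = k then s * M j i else M j i) = s * fdet n (\<lambda>i j. M j i)"
    unfolding fdet_expand sum_distrib_left
    by (simp add: mult_ac)
  then show ?thesis
    using fdet_transpose[of n "\<lambda>i j. if j = k then s * M i j else M i j"] fdet_transpose[of n M] by simp
qed

text \<open>If all row sums are \<open>s\<close>, the matrix maps the vector of ones to \<open>s\<close> times itself, and Cramer's rule applies.
  This is how a factor \<open>s\<close> is split off without a division.\<close>

lemma fdet_ones_column:
  assumes k: "k < n" and rows: "\<And>i. i < n \<Longrightarrow> (\<Sum>j<n. M i j) = s"
  shows "s * fdet n (\<lambda>i j. if j = k then 1 else M i j) = fdet n M"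
proof -
  let ?A = "Matrix.mat n n (\<lambda>(i, j). M i j)" and ?x = "Matrix.vec n (\<lambda>_. 1)"
  have Ax: "?A *\<^sub>v ?x = Matrix.vec n (\<lambda>_. s)"
    by (rule eq_vecI) (auto simp: scalar_prod_def atLeast0LessThan rows)
  have "s * fdet n (\<lambda>i j. if j = k then 1 else M i j) = fdet n (\<lambda>i j. if j = k then s else M i j)"
    using fdet_scale_column[OF k, of s "\<lambda>i j. if j = k then 1 else M i j"] 
    by (simp cong: if_cong)
  also have "\<dots> = Determinant.det (replace_col ?A (?A *\<^sub>v ?x) k)"
    unfolding Ax fdet_def replace_col_def by (intro arg_cong[where f = Determinant.det] eq_matI) auto
  also have "\<dots> = fdet n M"
    by (subst cramer_lemma_mat[of _ n]) (use k in \<open>auto simp: fdet_def\<close>)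
  finally show ?thesis .
qed

text \<open>A square system with one equation discarded: overwrite the discarded row by zeros.\<close>

lemma underdetermined_system:
  fixes M :: "nat \<Rightarrow> nat \<Rightarrow> 'a::field"
  assumes "i0 < n"
  obtains x where "\<exists>j<n. x j \<noteq> 0" "\<And>i. i < n \<Longrightarrow> i \<noteq> i0 \<Longrightarrow> (\<Sum>j<n. M i j * x j) = 0"
proof -
  have "fdet n (\<lambda>i j. if i = i0 then 0 else M i j) = 0"
    unfolding fdet_eq_0_iff_left
    by (rule exI[of _ "\<lambda>i. if i = i0 then 1 else 0"])
      (use assms in \<open>auto intro!: sum.neutral\<close>)
  then obtain x where x: "\<exists>j<n. x j \<noteq> 0" "\<And>i. i < n \<Longrightarrow> (\<Sum>j<n. (if i = i0 then 0 else M i j) * x j) = 0"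
    unfolding fdet_eq_0_iff by blast
  show thesis
  proof (rule that[of x])
    fix i assume "i < n" "i \<noteq> i0"
    with x(2)[of i] show "(\<Sum>j<n. M i j * x j) = 0"
      by simp
  qed (rule x(1))
qed

lemma fdet_inverse:
  fixes M :: "nat \<Rightarrow> nat \<Rightarrow> 'a::field"
  assumes "fdet N M \<noteq> 0"
  obtains M' where "\<And>i j. i < N \<Longrightarrow> j < N \<Longrightarrow> (\<Sum>k<N. M i k * M' k j) = (if i = j then 1 else 0)"
    "\<And>i j. i < N \<Longrightarrow> j < N \<Longrightarrow> (\<Sum>k<N. M' i k * M k j) = (if i = j then 1 else 0)"
proof -
  let ?A = "Matrix.mat N N (\<lambda>(i, j). M i j)"
  have A: "?A \<in> carrier_mat N N"
    by simp
  note adj = adj_mat[OF A]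
  have d: "Determinant.det ?A \<noteq> 0"
    using assms by (simp add: fdet_def)
  have "(?A * adj_mat ?A) $$ (i, j) = (if i = j then Determinant.det ?A else 0)"
    "(adj_mat ?A * ?A) $$ (i, j) = (if i = j then Determinant.det ?A else 0)" if "i < N" "j < N" for i j
    unfolding adj(2,3) using that by simp_all
  then have "(\<Sum>k<N. M i k * adj_mat ?A $$ (k, j)) = (if i = j then Determinant.det ?A else 0)"
    "(\<Sum>k<N. adj_mat ?A $$ (i, k) * M k j) = (if i = j then Determinant.det ?A else 0)" if "i < N" "j < N" for i j
    using that adj(1) by (simp_all add: scalar_prod_def atLeast0LessThan)
  then show thesis
    using d by (intro that[of "\<lambda>k j. adj_mat ?A $$ (k, j) / Determinant.det ?A"])
      (simp_all add: sum_divide_distrib[symmetric])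
qed

lemma permutes_less: "p permutes {..<N} \<Longrightarrow> i < N \<Longrightarrow> p i < (N::nat)"
  using permutes_in_image[of p "{..<N}" i] by simp

lemma fdet_forms:
  fixes M :: "nat \<Rightarrow> nat \<Rightarrow> (nat, 'a::comm_ring_1) mpoly"
  assumes "\<And>i j. i < N \<Longrightarrow> j < N \<Longrightarrow> M i j \<in> forms n (d i)"
  shows "fdet N M \<in> forms n (\<Sum>i<N. d i)"
proof -
  have "(of_int z :: (nat, 'a) mpoly) = mpoly_const (of_int z)" for z
    by (simp add: mpoly_const_def)
  then show ?thesis
    unfolding fdet_expand atLeast0LessThan
    by (auto intro!: forms_sum forms_scale forms_prod assms simp: permutes_less)
qed

lemma fdet_order_ge:
  fixes M :: "nat \<Rightarrow> nat \<Rightarrow> ('v, 'a::comm_ring_1) mpoly"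
  assumes "\<And>i j. i < N \<Longrightarrow> j < N \<Longrightarrow> M i j \<in> order_ge (d i)"
  shows "fdet N M \<in> order_ge (\<Sum>i<N. d i)"
  unfolding fdet_expand atLeast0LessThan
  by (auto intro!: order_ge_sum order_ge_scale order_ge_prod assms simp: permutes_less)

section \<open>Plane curves\<close>

text \<open>A nonzero element \<open>D\<close> of least degree in the ideal \<open>(P, U)\<close> divides constant multiples of \<open>P\<close> and of \<open>U\<close>,
  by pseudo-division. As \<open>P\<close> is prime and does not divide \<open>U\<close>, this forces \<open>D\<close> to be constant. The
  constant plays the role of the resultant: over a base point where \<open>r\<close> does not vanish, \<open>P\<close> and \<open>U\<close> have no common zero.\<close>

lemma prime_elem_bezout:
  fixes P U :: "'a::idom poly"
  assumes P: "prime_elem P" "degree P > 0" and U: "\<not> P dvd U"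
  obtains A B r where "r \<noteq> 0" "A * P + B * U = [:r:]"
proof -
  define I where "I = {D. D \<noteq> 0 \<and> (\<exists>A B. D = A * P + B * U)}"
  have "P \<in> I"
  proof -
    have "P \<noteq> 0" "P = 1 * P + 0 * U"
      using P(2) by auto
    then show ?thesis
      unfolding I_def by blast
  qed
  then obtain D where D: "D \<in> I" "\<And>E. E \<in> I \<Longrightarrow> degree D \<le> degree E"
    using ex_has_least_nat[of "\<lambda>D. D \<in> I" P degree] by blast
  then obtain A B where AB: "D = A * P + B * U" and D0: "D \<noteq> 0"
    by (auto simp: I_def)
  have div: "\<exists>a q. a \<noteq> 0 \<and> smult a T = D * q" if "T = A' * P + B' * U" for T A' B'
  proof -
    obtain a q where a: "a \<noteq> 0" "smult a T = D * q + pseudo_mod T D"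
      using pseudo_mod(1)[OF D0] by blast
    have "pseudo_mod T D = smult a T - D * q"
      using a(2) by simp
    also have "\<dots> = (smult a A' - A * q) * P + (smult a B' - B * q) * U"
      by (simp add: that AB smult_add_right algebra_simps)
    finally have "pseudo_mod T D = (smult a A' - A * q) * P + (smult a B' - B * q) * U" .
    then have "pseudo_mod T D \<noteq> 0 \<Longrightarrow> pseudo_mod T D \<in> I"
      unfolding I_def by blast
    then have "pseudo_mod T D = 0"
      using D(2)[of "pseudo_mod T D"] pseudo_mod(2)[OF D0, of T] by (metis not_le)
    then show ?thesis
      using a by auto
  qed
  obtain a q where a: "a \<noteq> 0" "smult a P = D * q"
    using div[of P 1 0] by auto
  obtain b q' where b: "b \<noteq> 0" "smult b U = D * q'"
    using div[of U 0 1] by auto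
  have "P dvd D * q"
    unfolding a(2)[symmetric] by (rule dvd_smult) simp
  then have "P dvd q"
  proof (rule prime_elem_dvd_multD[OF P(1), THEN disjE])
    assume "P dvd D"
    then have "P dvd [:b:] * U"
      using b(2) by simp
    moreover have "\<not> P dvd [:b:]"
      using P(2) b(1) dvd_imp_degree_le[of P "[:b:]"] by auto
    ultimately show ?thesis
      using prime_elem_dvd_multD[OF P(1)] U by blast
  qed
  then obtain q1 where "q = P * q1" ..
  then have "P * [:a:] = P * (D * q1)"
    using a(2) by (simp add: mult_ac)
  then have "[:a:] = D * q1"
    using P(2) by (metis degree_0 less_irrefl mult_left_cancel)
  then have "degree D = 0"
    using a(1) degree_mult_eq[of D q1] by (metis D0 add_is_0 degree_pCons_0 mult_zero_right pCons_eq_0_iff)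
  then obtain r where "D = [:r:]"
    by (rule degree_eq_zeroE)
  with AB D0 show thesis
    by (intro that[of r A B]) auto
qed

text \<open>A polynomial in \<open>z\<close> with coefficients in \<open>K[s]\<close>, evaluated at the point \<open>(s, z)\<close> of the plane.\<close>

abbreviation poly2 :: "'a::comm_ring_1 poly poly \<Rightarrow> 'a \<Rightarrow> 'a \<Rightarrow> 'a" where
  "poly2 P s z \<equiv> poly (poly P [:z:]) s"

lemma poly2_conv_map_poly: "poly2 P s z = poly (map_poly (\<lambda>p. poly p s) P) z"
  by (induction P) (simp_all add: map_poly_pCons)

lemma poly2_root:
  fixes P :: "'a::alg_closed_field poly poly"
  assumes "lead_coeff P dvd 1" "degree P > 0"
  obtains z where "poly2 P s z = 0"
proof -
  have "poly (lead_coeff P) s \<noteq> 0"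
    using assms(1) by (metis dvdE mult_zero_left poly_1 poly_mult zero_neq_one)
  then have "coeff (map_poly (\<lambda>p. poly p s) P) (degree P) \<noteq> 0"
    by (simp add: coeff_map_poly)
  then have "degree (map_poly (\<lambda>p. poly p s) P) > 0"
    using assms(2) le_degree by fastforce
  then show thesis
    using alg_closed_imp_poly_has_root that by (metis poly2_conv_map_poly)
qed

text \<open>The irreducible component of the curve through \<open>(s\<^sub>0, z\<^sub>0)\<close> is again monic in \<open>z\<close> up to a constant, so it
  has a point \<open>(s\<^sub>1, z\<^sub>1)\<close> over \<open>s\<^sub>1\<close>, and on it two polynomials that do not vanish identically are nonzero
  at a common point. In this way the points of one fibre control all components of the curve.\<close>

lemma plane_curve_component:
  fixes F :: "'a::{alg_closed_field, field_char_0, factorial_ring_gcd, semiring_gcd_mult_normalize} poly poly"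
  assumes lc: "lead_coeff F dvd 1" and root: "poly2 F s0 z0 = 0"
  obtains z1 where "poly2 F s1 z1 = 0"
    "\<And>U U'. poly2 U s0 z0 \<noteq> 0 \<Longrightarrow> poly2 U' s1 z1 \<noteq> 0 \<Longrightarrow>
      \<exists>s z. poly2 F s z = 0 \<and> poly2 U s z \<noteq> 0 \<and> poly2 U' s z \<noteq> 0"
proof -
  have F0: "F \<noteq> 0"
    using lc by auto
  have "G \<noteq> 0 \<longrightarrow> poly2 G s0 z0 = 0 \<longrightarrow> (\<exists>P. prime_elem P \<and> P dvd G \<and> poly2 P s0 z0 = 0)" for G
  proof (induction G rule: prime_divisors_induct)
    case (unit G)
    then show ?case
      by (metis dvdE mult_zero_left poly_1 poly_mult zero_neq_one)
  next
    case (factor p G)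
    then show ?case
      by (auto simp: dvd_mult intro: dvd_mult2 dest: prime_imp_prime_elem)
  qed simp
  with F0 root obtain P where P: "prime_elem P" "P dvd F" "poly2 P s0 z0 = 0"
    by blast
  obtain R where R: "F = P * R"
    using P(2) ..
  have "lead_coeff P dvd lead_coeff F"
    unfolding R by (simp add: lead_coeff_mult)
  with lc have lcP: "lead_coeff P dvd 1"
    using dvd_trans by blast
  have degP: "degree P > 0"
  proof (rule ccontr)
    assume "\<not> degree P > 0"
    then have "P dvd 1"
      using lcP by (auto simp: is_unit_poly_iff elim!: degree_eq_zeroE)
    with P(1) show False
      by (simp add: prime_elem_def)
  qed
  obtain z1 where z1: "poly2 P s1 z1 = 0"
    using poly2_root[OF lcP degP] .
  show thesis
  proof (rule that[of z1])
    show "poly2 F s1 z1 = 0"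
      by (simp add: R z1)
  next
    fix U U' assume "poly2 U s0 z0 \<noteq> 0" "poly2 U' s1 z1 \<noteq> 0"
    then have "\<not> P dvd U" "\<not> P dvd U'"
      using P(3) z1 by auto
    then have "\<not> P dvd U * U'"
      using P(1) prime_elem_dvd_multD by blast
    then obtain A B r where r: "r \<noteq> 0" "A * P + B * (U * U') = [:r:]"
      using prime_elem_bezout[OF P(1) degP] by blast
    obtain s where s: "poly r s \<noteq> 0"
      using poly_roots_finite[OF r(1)] infinite_UNIV_char_0
      by (metis (mono_tags, lifting) UNIV_eq_I mem_Collect_eq)
    obtain z where z: "poly2 P s z = 0"
      using poly2_root[OF lcP degP] .
    have "poly2 B s z * (poly2 U s z * poly2 U' s z) = poly r s"
      using arg_cong[OF r(2), of "\<lambda>Q. poly2 Q s z"] z by simp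
    with s z show "\<exists>s z. poly2 F s z = 0 \<and> poly2 U s z \<noteq> 0 \<and> poly2 U' s z \<noteq> 0"
      by (intro exI[of _ s] exI[of _ z]) (auto simp: R)
  qed
qed

section \<open>The determinantal hypersurface of the transversals\<close>

text \<open>Linear forms \<open>y\<^sub>i\<close> with coefficients \<open>Y i\<close> and the basis \<open>e\<^sub>j\<close> dual to them. The subspaces under
  consideration are \<open>y\<^sub>j = m\<^sub>j = 0\<close> with \<open>m\<^sub>j = y\<^sub>0 + \<Sum>\<^sub>i b\<^sub>j\<^sub>i y\<^sub>i\<close>. As \<open>y\<^sub>j\<close> vanishes there,
  \<open>b\<^sub>j\<^sub>j\<close> can be normalized to zero. The condition \<open>b_distinct\<close> says that, for \<open>i\<close> and \<open>i'\<close> different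
  from \<open>j\<close>, the line through \<open>e\<^sub>0\<close> and \<open>e\<^sub>j\<close> meets the \<open>i\<close>-th and the \<open>i'\<close>-th subspace in different points.\<close>

locale pencil_frame =
  fixes n :: nat and e Y b :: "nat \<Rightarrow> nat \<Rightarrow> 'a::field"
  assumes n_ge_2: "n \<ge> 2"
    and e_space: "j \<le> n \<Longrightarrow> e j \<in> coord_space n"
    and dual: "i \<le> n \<Longrightarrow> j \<le> n \<Longrightarrow> (\<Sum>k\<le>n. Y i k * e j k) = (if i = j then 1 else 0)"
    and expand: "v \<in> coord_space n \<Longrightarrow> (\<Sum>j\<le>n. (\<Sum>k\<le>n. Y j k * v k) * e j i) = v i"
    and b_diag: "i \<in> {1..n} \<Longrightarrow> b i i = 0"
    and b_distinct: "i \<in> {1..n} \<Longrightarrow> i' \<in> {1..n} \<Longrightarrow> j \<in> {1..n} \<Longrightarrow>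
      i \<noteq> i' \<Longrightarrow> i \<noteq> j \<Longrightarrow> i' \<noteq> j \<Longrightarrow> b i j \<noteq> b i' j"
begin

definition y :: "nat \<Rightarrow> (nat \<Rightarrow> 'a) \<Rightarrow> 'a" where
  "y i v = (\<Sum>k\<le>n. Y i k * v k)"

definition m :: "nat \<Rightarrow> (nat \<Rightarrow> 'a) \<Rightarrow> 'a" where
  "m i v = y 0 v + (\<Sum>j=1..n. b i j * y j v)"

definition point :: "(nat \<Rightarrow> 'a) \<Rightarrow> nat \<Rightarrow> 'a" where
  "point c = (\<lambda>k. \<Sum>j\<le>n. c j * e j k)"

definition center :: "nat \<Rightarrow> (nat \<Rightarrow> 'a) set" where
  "center j = {v \<in> coord_space n. y j v = 0 \<and> m j v = 0}"

lemma y_add: "y i (\<lambda>k. u k + v k) = y i u + y i v"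
  by (simp add: y_def distrib_left sum.distrib)

lemma y_diff: "y i (\<lambda>k. u k - v k) = y i u - y i v"
  by (simp add: y_def right_diff_distrib sum_subtractf)

lemma y_scale: "y i (\<lambda>k. c * v k) = c * y i v"
  by (simp add: y_def sum_distrib_left mult_ac)

lemma y_zero: "y i (\<lambda>k. 0) = 0"
  by (simp add: y_def)

lemma m_add: "m i (\<lambda>k. u k + v k) = m i u + m i v"
  by (simp add: m_def y_add distrib_left sum.distrib)

lemma m_diff: "m i (\<lambda>k. u k - v k) = m i u - m i v"
  by (simp add: m_def y_diff right_diff_distrib sum_subtractf)

lemma m_scale: "m i (\<lambda>k. c * v k) = c * m i v"
  by (simp add: m_def y_scale sum_distrib_left distrib_left mult_ac)

lemma point_space [simp]: "point c \<in> coord_space n"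
  using e_space by (auto simp: point_def coord_space_def)

lemma y_point_sum: "y i (point c) = (\<Sum>j\<le>n. y i (e j) * c j)"
proof -
  have "y i (point c) = (\<Sum>k\<le>n. \<Sum>j\<le>n. Y i k * e j k * c j)"
    by (simp add: y_def point_def sum_distrib_left mult_ac)
  also have "\<dots> = (\<Sum>j\<le>n. y i (e j) * c j)"
    by (subst sum.swap) (simp add: y_def sum_distrib_right)
  finally show ?thesis .
qed

lemma y_e: "i \<le> n \<Longrightarrow> j \<le> n \<Longrightarrow> y i (e j) = (if i = j then 1 else 0)"
  by (simp add: y_def dual)

lemma y_point [simp]: "i \<le> n \<Longrightarrow> y i (point c) = c i"
  by (simp add: y_point_sum y_e if_distrib[of "\<lambda>x. x * _"] cong: if_cong)

lemma m_point: "m i (point c) = c 0 + (\<Sum>j=1..n. b i j * c j)"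
  by (simp add: m_def)

lemma m_e:
  assumes "k \<le> n"
  shows "m i (e k) = (if k = 0 then 1 else b i k)"
proof -
  have "(\<Sum>j=1..n. b i j * y j (e k)) = (\<Sum>j=1..n. if k = j then b i k else 0)"
    using assms by (intro sum.cong) (auto simp: y_e)
  then show ?thesis
    using assms by (auto simp: m_def y_e)
qed

lemma m_point_sum: "m i (point c) = (\<Sum>k\<le>n. m i (e k) * c k)"
proof -
  have "(\<Sum>k\<le>n. m i (e k) * c k) = (\<Sum>k\<le>n. (if k = 0 then 1 else b i k) * c k)"
    by (intro sum.cong) (auto simp: m_e)
  also have "\<dots> = c 0 + (\<Sum>k=1..n. b i k * c k)"
    by (simp add: atMost_atLeast0 sum.atLeast_Suc_atMost)
  finally show ?thesis
    by (simp add: m_point)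
qed

lemma point_y:
  assumes "v \<in> coord_space n"
  shows "point (\<lambda>i. y i v) = v"
  using expand[OF assms] by (simp add: point_def y_def fun_eq_iff)

lemma y_eqI:
  assumes "v \<in> coord_space n" "w \<in> coord_space n" "\<And>i. i \<le> n \<Longrightarrow> y i v = y i w"
  shows "v = w"
proof -
  have "point (\<lambda>i. y i v) = point (\<lambda>i. y i w)"
    unfolding point_def by (intro ext sum.cong) (auto simp: assms(3))
  then show ?thesis
    by (simp add: point_y assms(1,2))
qed

lemma y_nonzero:
  assumes "v \<in> coord_space n" "v \<noteq> (\<lambda>_. 0)"
  obtains l where "l \<le> n" "y l v \<noteq> 0"
proof -
  have "(\<lambda>_. 0) \<in> coord_space n"
    by (simp add: coord_space_def)
  with assms y_eqI[of v "\<lambda>_. 0"] that show thesis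
    by (auto simp: y_zero)
qed

definition y_form :: "nat \<Rightarrow> (nat, 'a) mpoly" where
  "y_form i = linear_form n (Y i)"

definition m_form :: "nat \<Rightarrow> (nat, 'a) mpoly" where
  "m_form i = y_form 0 + (\<Sum>j=1..n. mpoly_const (b i j) * y_form j)"

lemma eval_y_form: "mpoly_eval v (y_form i) = y i v"
  by (simp add: y_form_def y_def mpoly_eval.mpoly_subst_linear_form)

lemma eval_m_form: "mpoly_eval v (m_form i) = m i v"
  by (simp add: m_form_def m_def mpoly_eval.mpoly_subst_sum eval_y_form)

lemma y_form_in_forms: "y_form i \<in> forms n 1"
  unfolding y_form_def by (rule linear_form_forms)

lemma m_form_in_forms: "m_form i \<in> forms n 1"
  unfolding m_form_def by (intro forms_add forms_sum forms_scale y_form_in_forms)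

text \<open>At a point \<open>v\<close>, the row vector \<open>\<beta>\<close> times column \<open>j\<close> of this matrix is
  \<open>\<beta>\<^sub>j m\<^sub>j(v) - (\<Sum>\<^sub>i \<beta>\<^sub>i b\<^sub>i\<^sub>j) y\<^sub>j(v)\<close>, with indices shifted by one. If \<open>\<Sum>\<^sub>j \<beta>\<^sub>j = 0\<close>, these are the values at \<open>v\<close>
  of the summands of a linear relation between the forms \<open>y\<^sub>j\<close> and \<open>m\<^sub>j\<close>. The matrix
  is \<open>y\<^sub>0\<close> plus the Laplacian of the complete directed graph with weight \<open>b\<^sub>i\<^sub>j y\<^sub>j\<close> on the edge from \<open>i\<close> to \<open>j\<close>.\<close>

definition relation_mat :: "nat \<Rightarrow> nat \<Rightarrow> (nat, 'a) mpoly" where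
  "relation_mat i j = (if i = j then m_form (Suc i) else 0) - mpoly_const (b (Suc i) (Suc j)) * y_form (Suc j)"

lemma relation_mat_forms: "relation_mat i j \<in> forms n 1"
  unfolding relation_mat_def by (intro forms_diff forms_scale y_form_in_forms) (simp add: m_form_in_forms[simplified])

lemma eval_relation_mat: "mpoly_eval v (relation_mat i j)
    = (if i = j then m (Suc i) v else 0) - b (Suc i) (Suc j) * y (Suc j) v"
  by (simp add: relation_mat_def eval_m_form eval_y_form)

lemma relation_mat_row_sum:
  assumes "i < n"
  shows "(\<Sum>j<n. relation_mat i j) = y_form 0"
proof -
  have "(\<Sum>j<n. relation_mat i j) = m_form (Suc i) - (\<Sum>j<n. mpoly_const (b (Suc i) (Suc j)) * y_form (Suc j))"
    using assms by (simp add: relation_mat_def sum_subtractf)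
  then show ?thesis
    by (simp add: m_form_def sum.atLeast1_atMost_eq)
qed

text \<open>The column of ones imposes \<open>\<Sum>\<^sub>j \<beta>\<^sub>j = 0\<close>. It replaces an equation that follows from the others on such
  \<open>\<beta>\<close>, so all \<open>k\<close> give the same form. For the multiplicity at \<open>q\<close> the index must avoid the subspaces through \<open>q\<close>.\<close>

definition relation_minor :: "nat \<Rightarrow> (nat, 'a) mpoly" where
  "relation_minor k = fdet n (\<lambda>i j. if j = k then 1 else relation_mat i j)"

lemma y_form_times_minor:
  assumes "k < n"
  shows "y_form 0 * relation_minor k = fdet n relation_mat"
  unfolding relation_minor_def by (rule fdet_ones_column) (use assms relation_mat_row_sum in auto)

lemma y_form_nonzero: "y_form 0 \<noteq> 0"
  using eval_y_form[of "e 0" 0] y_e[of 0 0] by auto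

lemma relation_minor_eq: "k < n \<Longrightarrow> k' < n \<Longrightarrow> relation_minor k = relation_minor k'"
  using y_form_times_minor[of k] y_form_times_minor[of k'] y_form_nonzero by (metis mult_left_cancel)

definition F :: "(nat, 'a) mpoly" where
  "F = relation_minor 0"

lemma F_eq_relation_minor: "k < n \<Longrightarrow> F = relation_minor k"
  using relation_minor_eq[of 0 k] by (simp add: F_def)

lemma eval_relation_minor: "mpoly_eval v (relation_minor k) = fdet n (\<lambda>i j. if j = k then 1 else mpoly_eval v (relation_mat i j))"
  unfolding relation_minor_def fdet_hom[OF mpoly_eval.mpoly_subst_comm_ring_hom]
  by (rule fdet_cong) simp

lemma F_forms: "F \<in> forms n (n - 1)"
proof -
  have "fdet n (\<lambda>j i. if j = 0 then 1 else relation_mat i j) \<in> forms n (\<Sum>j<n. if j = 0 then 0 else 1)"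
    by (intro fdet_forms) (auto simp: relation_mat_forms[simplified] forms_one)
  moreover have "(\<Sum>j<n. if j = 0 then 0 else 1 :: nat) = n - 1"
    using n_ge_2 by (simp add: sum.If_cases Collect_neg_eq Diff_eq[symmetric] card_Diff_singleton)
  ultimately show ?thesis
    unfolding F_def relation_minor_def by (subst fdet_transpose[symmetric]) simp
qed

text \<open>At \<open>e\<^sub>0\<close> the matrix is the identity. So \<open>F\<close> is monic as a polynomial in \<open>y\<^sub>0\<close>.\<close>

lemma F_e0: "mpoly_eval (e 0) F = 1"
proof -
  have "mpoly_eval (e 0) (y_form 0) * mpoly_eval (e 0) F = mpoly_eval (e 0) (fdet n relation_mat)"
    using y_form_times_minor[of 0] n_ge_2 by (simp add: F_def flip: mpoly_eval.mpoly_subst_mult)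
  also have "\<dots> = fdet n (\<lambda>i j. if i = j then 1 else 0)"
    unfolding fdet_hom[OF mpoly_eval.mpoly_subst_comm_ring_hom]
    by (rule fdet_cong) (simp add: eval_relation_mat m_e y_e)
  also have "\<dots> = Determinant.det (1\<^sub>m n)"
    unfolding fdet_def one_mat_def by simp
  finally show ?thesis
    by (simp add: eval_y_form y_e)
qed

text \<open>The kernel of the transposed matrix. The condition for the column that was replaced follows since all
  conditions add up to \<open>y\<^sub>0(v) \<Sum>\<^sub>j \<beta>\<^sub>j\<close>.\<close>

lemma F_zero_iff_relation:
  "mpoly_eval v F = 0 \<longleftrightarrow> (\<exists>\<beta>. (\<exists>i\<in>{1..n}. \<beta> i \<noteq> 0) \<and> (\<Sum>i=1..n. \<beta> i) = 0 \<and>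
     (\<forall>j\<in>{1..n}. \<beta> j * m j v = y j v * (\<Sum>i=1..n. \<beta> i * b i j)))"
  (is "_ \<longleftrightarrow> (\<exists>\<beta>. ?R \<beta>)")
proof -
  let ?A = "\<lambda>i j. mpoly_eval v (relation_mat i j)"
  have col: "(\<Sum>i<n. \<beta> (Suc i) * ?A i j)
      = \<beta> (Suc j) * m (Suc j) v - y (Suc j) v * (\<Sum>i=1..n. \<beta> i * b i (Suc j))" if "j < n" for \<beta> j
  proof -
    have "(\<Sum>i<n. \<beta> (Suc i) * ?A i j) = (\<Sum>i<n. if i = j then \<beta> (Suc i) * m (Suc i) v else 0)
        - (\<Sum>i<n. y (Suc j) v * (\<beta> (Suc i) * b (Suc i) (Suc j)))"
      by (simp add: eval_relation_mat right_diff_distrib sum_subtractf mult_ac if_distrib[of "(*) _"] cong: if_cong)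
    then show ?thesis
      using that by (simp add: sum_distrib_left[symmetric] sum.atLeast1_atMost_eq)
  qed
  have total: "(\<Sum>j<n. \<Sum>i<n. \<beta> (Suc i) * ?A i j) = y 0 v * (\<Sum>i=1..n. \<beta> i)" for \<beta>
  proof -
    have "(\<Sum>j<n. ?A i j) = y 0 v" if "i < n" for i
      using relation_mat_row_sum[OF that] by (simp add: eval_y_form flip: mpoly_eval.mpoly_subst_sum)
    then show ?thesis
      by (subst sum.swap)
        (simp add: sum_distrib_left[symmetric] sum_distrib_right[symmetric] sum.atLeast1_atMost_eq mult.commute)
  qed
  have "mpoly_eval v F = 0 \<longleftrightarrow> (\<exists>x. (\<exists>i<n. x i \<noteq> 0) \<and>
      (\<forall>j<n. (\<Sum>i<n. x i * (if j = 0 then 1 else ?A i j)) = 0))"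
    unfolding F_def eval_relation_minor fdet_eq_0_iff_left ..
  also have "\<dots> \<longleftrightarrow> (\<exists>\<beta>. ?R \<beta>)"
  proof
    assume "\<exists>x. (\<exists>i<n. x i \<noteq> 0) \<and> (\<forall>j<n. (\<Sum>i<n. x i * (if j = 0 then 1 else ?A i j)) = 0)"
    then obtain x where x: "\<exists>i<n. x i \<noteq> 0"
        "\<And>j. j < n \<Longrightarrow> (\<Sum>i<n. x i * (if j = 0 then 1 else ?A i j)) = 0"
      by blast
    define \<beta> where "\<beta> i = x (i - 1)" for i
    have nz: "\<exists>i\<in>{1..n}. \<beta> i \<noteq> 0"
      using x(1) by (force simp: \<beta>_def)
    have sum0: "(\<Sum>i=1..n. \<beta> i) = 0"
      using x(2)[of 0] n_ge_2 by (simp add: sum.atLeast1_atMost_eq \<beta>_def)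
    have cols: "(\<Sum>i<n. \<beta> (Suc i) * ?A i j) = 0" if "j < n" "j \<noteq> 0" for j
      using x(2)[OF that(1)] that(2) by (simp add: \<beta>_def)
    have "(\<Sum>i<n. \<beta> (Suc i) * ?A i 0) = (\<Sum>j<n. \<Sum>i<n. \<beta> (Suc i) * ?A i j)"
      using n_ge_2 cols by (subst sum.remove[of _ 0]) auto
    with total[of \<beta>] sum0 have "(\<Sum>i<n. \<beta> (Suc i) * ?A i 0) = 0"
      by simp
    with cols have "(\<Sum>i<n. \<beta> (Suc i) * ?A i j) = 0" if "j < n" for j
      using that by (cases "j = 0") auto
    then have "\<beta> j * m j v = y j v * (\<Sum>i=1..n. \<beta> i * b i j)" if "j \<in> {1..n}" for j
      using col[of "j - 1" \<beta>] that by (cases j) auto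
    with nz sum0 show "\<exists>\<beta>. ?R \<beta>"
      by blast
  next
    assume "\<exists>\<beta>. ?R \<beta>"
    then obtain \<beta> where \<beta>: "?R \<beta>" ..
    show "\<exists>x. (\<exists>i<n. x i \<noteq> 0) \<and> (\<forall>j<n. (\<Sum>i<n. x i * (if j = 0 then 1 else ?A i j)) = 0)"
    proof (intro exI[of _ "\<lambda>i. \<beta> (Suc i)"] conjI allI impI)
      obtain i where "i \<in> {1..n}" "\<beta> i \<noteq> 0"
        using \<beta> by blast
      then show "\<exists>i<n. \<beta> (Suc i) \<noteq> 0"
        by (intro exI[of _ "i - 1"]) auto
    next
      fix j assume "j < n"
      then show "(\<Sum>i<n. \<beta> (Suc i) * (if j = 0 then 1 else ?A i j)) = 0"
        using col[of j \<beta>] \<beta> by (cases "j = 0") (simp_all add: sum.atLeast1_atMost_eq)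
    qed
  qed
  finally show ?thesis .
qed

text \<open>Column \<open>j\<close> of the matrix vanishes on the \<open>j\<close>-th subspace, so any minor that keeps this column will do.\<close>

lemma F_zero_center:
  assumes j: "j \<in> {1..n}" and v: "v \<in> center j"
  shows "mpoly_eval v F = 0"
proof -
  obtain k where k: "k < n" "k \<noteq> j - 1"
    using n_ge_2 by (metis One_nat_def less_2_cases_iff less_le_trans zero_neq_one)
  have "mpoly_eval v (relation_mat i (j - 1)) = 0" for i
    using j v by (auto simp: eval_relation_mat center_def)
  then have "fdet n (\<lambda>i j. if j = k then 1 else mpoly_eval v (relation_mat i j)) = 0"
    unfolding fdet_eq_0_iff
    by (intro exI[of _ "\<lambda>i. if i = j - 1 then 1 else 0"] conjI allI impI)
      (use j k in \<open>auto intro!: sum.neutral\<close>)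
  then show ?thesis
    using F_eq_relation_minor[OF k(1)] by (simp add: eval_relation_minor)
qed

text \<open>The point where the line through \<open>e\<^sub>0\<close> and \<open>e\<^sub>j\<close> meets the \<open>i\<close>-th subspace.\<close>

definition node :: "nat \<Rightarrow> nat \<Rightarrow> nat \<Rightarrow> 'a" where
  "node i j = point (\<lambda>k. if k = 0 then - b i j else if k = j then 1 else 0)"

lemma node_line: "j \<in> {1..n} \<Longrightarrow> node i j = (\<lambda>k. e j k + (- b i j) * e 0 k)"
  unfolding node_def point_def
proof
  fix k assume j: "j \<in> {1..n}"
  have "(\<Sum>l\<le>n. (if l = 0 then - b i j else if l = j then 1 else 0) * e l k)
      = (\<Sum>l\<in>{0, j}. (if l = 0 then - b i j else if l = j then 1 else 0) * e l k)"
    using j by (intro sum.mono_neutral_right) auto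
  then show "(\<Sum>l\<le>n. (if l = 0 then - b i j else if l = j then 1 else 0) * e l k) = e j k + (- b i j) * e 0 k"
    using j by simp
qed

lemma y_node: "k \<le> n \<Longrightarrow> y k (node i j) = (if k = 0 then - b i j else if k = j then 1 else 0)"
  by (simp add: node_def)

lemma m_node: "j \<in> {1..n} \<Longrightarrow> m k (node i j) = b k j - b i j"
proof -
  assume j: "j \<in> {1..n}"
  have "(\<Sum>l=1..n. b k l * (if l = 0 then - b i j else if l = j then 1 else 0)) = (\<Sum>l=1..n. if l = j then b k j else 0)"
    by (intro sum.cong) auto
  also have "\<dots> = b k j"
    using j by simp
  finally show ?thesis
    by (simp add: node_def m_point)
qed

lemma node_center: "i \<in> {1..n} \<Longrightarrow> j \<in> {1..n} \<Longrightarrow> i \<noteq> j \<Longrightarrow> node i j \<in> center i"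
  by (simp add: center_def y_node m_node) (simp add: node_def)

text \<open>On this line a relation \<open>\<beta>\<close> has to satisfy \<open>\<beta>\<^sub>k (z + b\<^sub>k\<^sub>j) = 0\<close> for all \<open>k \<noteq> j\<close>, and \<open>\<beta>\<close> cannot be supported
  at \<open>j\<close> alone because its entries have sum zero.\<close>

lemma F_zero_on_axis_iff:
  assumes j: "j \<in> {1..n}"
  shows "mpoly_eval (\<lambda>k. e j k + z * e 0 k) F = 0 \<longleftrightarrow> (\<exists>i\<in>{1..n} - {j}. z = - b i j)"
proof
  assume "\<exists>i\<in>{1..n} - {j}. z = - b i j"
  then obtain i where "i \<in> {1..n}" "i \<noteq> j" "z = - b i j"
    by blast
  with j node_center[of i j] show "mpoly_eval (\<lambda>k. e j k + z * e 0 k) F = 0"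
    using F_zero_center[of i] node_line[OF j, of i] by simp
next
  let ?v = "\<lambda>k. e j k + z * e 0 k"
  assume "mpoly_eval ?v F = 0"
  then obtain \<beta> where \<beta>: "\<exists>i\<in>{1..n}. \<beta> i \<noteq> 0" "(\<Sum>i=1..n. \<beta> i) = 0"
      "\<And>k. k \<in> {1..n} \<Longrightarrow> \<beta> k * m k ?v = y k ?v * (\<Sum>i=1..n. \<beta> i * b i k)"
    unfolding F_zero_iff_relation by blast
  have mk: "m k ?v = z + b k j" for k
    using j m_e[of 0 k] m_e[of j k] by (simp add: m_add m_scale)
  have yk: "y k ?v = 0" if "k \<in> {1..n}" "k \<noteq> j" for k
    using that j by (simp add: y_add y_scale y_e)
  show "\<exists>i\<in>{1..n} - {j}. z = - b i j"
  proof (rule ccontr)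
    assume *: "\<not> ?thesis"
    have zero: "\<beta> k = 0" if "k \<in> {1..n}" "k \<noteq> j" for k
      using \<beta>(3)[OF that(1)] yk[OF that] mk[of k] * that by (auto simp: eq_neg_iff_add_eq_0)
    have "(\<Sum>i=1..n. \<beta> i) = \<beta> j"
      using j zero by (subst sum.remove[of _ j]) (auto intro!: sum.neutral)
    with \<beta>(1,2) zero show False
      by metis
  qed
qed

text \<open>The value of \<open>y\<^sub>j \<and> m\<^sub>j\<close> on the pair \<open>v\<close>, \<open>p\<close>, which vanishes if and only if the line through \<open>v\<close> and \<open>p\<close>
  meets the \<open>j\<close>-th subspace.\<close>

definition wedge :: "nat \<Rightarrow> (nat \<Rightarrow> 'a) \<Rightarrow> (nat \<Rightarrow> 'a) \<Rightarrow> 'a" where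
  "wedge j v p = y j v * m j p - m j v * y j p"

text \<open>Together with \<open>y l p = 0\<close> these are \<open>n\<close> linear equations in \<open>n + 1\<close> unknowns.\<close>

lemma constrained_point:
  assumes l: "l \<le> n" and i0: "i0 \<in> {1..n}"
  obtains p where "p \<in> coord_space n" "p \<noteq> (\<lambda>_. 0)" "y l p = 0"
    "\<And>j. j \<in> {1..n} \<Longrightarrow> j \<noteq> i0 \<Longrightarrow> \<alpha> j * m j p = \<gamma> j * y j p"
proof -
  define M where "M i k = (if i = 0 then y l (e k) else \<alpha> i * m i (e k) - \<gamma> i * y i (e k))" for i k
  have M: "(\<Sum>k<Suc n. M i k * x k) = (if i = 0 then y l (point x) else \<alpha> i * m i (point x) - \<gamma> i * y i (point x))"
    for i x
    by (simp add: M_def lessThan_Suc_atMost y_point_sum m_point_sum sum_distrib_left left_diff_distrib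
        sum_subtractf mult.assoc)
  obtain x where x: "\<exists>j<Suc n. x j \<noteq> 0"
      "\<And>i. i < Suc n \<Longrightarrow> i \<noteq> i0 \<Longrightarrow> (\<Sum>k<Suc n. M i k * x k) = 0"
    using underdetermined_system[of i0 "Suc n" M] i0 by auto
  show thesis
  proof (rule that[of "point x"])
    show "point x \<noteq> (\<lambda>_. 0)"
      using x(1) y_point[of _ x] y_zero by (metis less_Suc_eq_le)
    show "y l (point x) = 0"
      using x(2)[of 0] i0 M[of 0 x] by auto
    show "\<alpha> j * m j (point x) = \<gamma> j * y j (point x)" if "j \<in> {1..n}" "j \<noteq> i0" for j
      using x(2)[of j] that M[of j x] by auto
  qed simp
qed

text \<open>The common zeros of the summands of a relation \<open>\<beta>\<close> at \<open>v\<close> contain a second point \<open>p\<close>, since the summands are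
  dependent. If the \<open>j\<close>-th summand is not the zero form, it is the equation of a hyperplane that contains \<open>v\<close>,
  \<open>p\<close> and the \<open>j\<close>-th subspace, so the line through \<open>v\<close> and \<open>p\<close> meets this subspace. For the summands that
  are zero forms, meeting the subspace is imposed as an equation on \<open>p\<close> instead, so that the number of equations
  does not change.\<close>

lemma F_zero_imp_transversal_direction:
  assumes v: "v \<in> coord_space n" "v \<noteq> (\<lambda>_. 0)" and F0: "mpoly_eval v F = 0"
  obtains p where "p \<in> coord_space n" "\<And>c. p \<noteq> (\<lambda>i. c * v i)" "\<And>j. j \<in> {1..n} \<Longrightarrow> wedge j v p = 0"
proof -
  obtain \<beta> where \<beta>: "\<exists>i\<in>{1..n}. \<beta> i \<noteq> 0" "(\<Sum>i=1..n. \<beta> i) = 0"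
      "\<And>j. j \<in> {1..n} \<Longrightarrow> \<beta> j * m j v = y j v * (\<Sum>i=1..n. \<beta> i * b i j)"
    using F0 unfolding F_zero_iff_relation by blast
  define \<delta> where "\<delta> j = (\<Sum>i=1..n. \<beta> i * b i j)" for j
  define S where "S = {j. \<beta> j \<noteq> 0 \<or> \<delta> j \<noteq> 0}"
  obtain i0 where i0: "i0 \<in> {1..n}" "i0 \<in> S"
    using \<beta>(1) by (auto simp: S_def)
  \<comment> \<open>The condition \<open>y l p = 0\<close> keeps \<open>p\<close> from being a multiple of \<open>v\<close>.\<close>
  obtain l where l: "l \<le> n" "y l v \<noteq> 0"
    using y_nonzero[OF v] .
  obtain p where p: "p \<in> coord_space n" "p \<noteq> (\<lambda>_. 0)" "y l p = 0"
    "\<And>j. j \<in> {1..n} \<Longrightarrow> j \<noteq> i0 \<Longrightarrow>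
      (if j \<in> S then \<beta> j else y j v) * m j p = (if j \<in> S then \<delta> j else m j v) * y j p"
    using constrained_point[OF l(1) i0(1), of "\<lambda>j. if j \<in> S then \<beta> j else y j v" "\<lambda>j. if j \<in> S then \<delta> j else m j v"]
    by blast
  have "(\<Sum>j=1..n. \<beta> j * m j p) = (\<Sum>j=1..n. \<beta> j * y 0 p) + (\<Sum>j=1..n. \<Sum>i=1..n. \<beta> j * b j i * y i p)"
    by (simp add: m_def distrib_left sum.distrib sum_distrib_left mult.assoc)
  also have "\<dots> = (\<Sum>i=1..n. \<delta> i * y i p)"
    by (subst sum.swap) (simp add: \<beta>(2)[simplified] \<delta>_def sum_distrib_right[symmetric])
  finally have rel: "(\<Sum>j=1..n. \<beta> j * m j p - \<delta> j * y j p) = 0"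
    by (simp add: sum_subtractf)
  have others: "\<beta> j * m j p - \<delta> j * y j p = 0" if "j \<in> {1..n}" "j \<noteq> i0" for j
    using p(4)[OF that] by (cases "j \<in> S") (auto simp: S_def)
  have "(\<Sum>j=1..n. \<beta> j * m j p - \<delta> j * y j p) = \<beta> i0 * m i0 p - \<delta> i0 * y i0 p"
    using others i0(1) by (subst sum.remove[of _ i0]) (auto intro!: sum.neutral)
  with rel others have all: "\<beta> j * m j p = \<delta> j * y j p" if "j \<in> {1..n}" for j
    using that by (cases "j = i0") auto
  show thesis
  proof (rule that[of p])
    show "p \<noteq> (\<lambda>i. c * v i)" for c
      using p(2,3) l(2) y_scale[of l c v] by (cases "c = 0") auto
    fix j assume j: "j \<in> {1..n}"
    show "wedge j v p = 0"
    proof (cases "j \<in> S")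
      case True
      have v': "\<beta> j * m j v = \<delta> j * y j v"
        using \<beta>(3)[OF j] by (simp add: \<delta>_def mult.commute)
      have "\<beta> j * wedge j v p = y j v * (\<beta> j * m j p) - (\<beta> j * m j v) * y j p"
        by (simp add: wedge_def algebra_simps)
      also have "\<dots> = 0"
        unfolding all[OF j] v' by simp
      finally have "\<beta> j * wedge j v p = 0" .
      moreover have "\<delta> j * wedge j v p = (\<delta> j * y j v) * m j p - m j v * (\<delta> j * y j p)"
        by (simp add: wedge_def algebra_simps)
      then have "\<delta> j * wedge j v p = 0"
        unfolding v'[symmetric] all[OF j, symmetric] by simp
      ultimately have "\<beta> j * wedge j v p = 0" "\<delta> j * wedge j v p = 0" .
      with True show ?thesis
        by (auto simp: S_def)
    next
      case False
      then have "j \<noteq> i0"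
        using i0(2) by auto
      with False show ?thesis
        using p(4)[OF j] by (simp add: wedge_def)
    qed
  qed (rule p(1))
qed

text \<open>The linear equations \<open>wedge j v p = 0\<close> for \<open>p\<close> have two independent solutions, namely \<open>v\<close> and \<open>p\<close>, so their
  rows are dependent, with coefficients \<open>\<mu>\<^sub>j\<close>. Then \<open>\<beta>\<^sub>j = \<mu>\<^sub>j y\<^sub>j(v)\<close> is a relation whose summands vanish at \<open>v\<close>; it is nonzero unless
  \<open>v\<close> lies on one of the subspaces.\<close>

lemma transversal_direction_imp_F_zero:
  assumes v: "v \<in> coord_space n" "v \<noteq> (\<lambda>_. 0)"
    and p: "p \<in> coord_space n" "\<And>c. p \<noteq> (\<lambda>i. c * v i)" "\<And>j. j \<in> {1..n} \<Longrightarrow> wedge j v p = 0"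
  shows "mpoly_eval v F = 0"
proof (cases "\<exists>j\<in>{1..n}. v \<in> center j")
  case True
  then show ?thesis
    using F_zero_center by blast
next
  case False
  obtain l where l: "l \<le> n" "y l v \<noteq> 0"
    using y_nonzero[OF v] .
  \<comment> \<open>The extra row \<open>y l\<close> makes the matrix square. Some combination \<open>w\<close> of \<open>v\<close> and \<open>p\<close> is in
    its kernel, and the extra row has coefficient zero in every left kernel vector because it does not vanish at \<open>v\<close>.\<close>
  define M where "M i k = (if i = 0 then y l (e k) else y i v * m i (e k) - m i v * y i (e k))" for i k
  have M: "(\<Sum>k<Suc n. M i k * y k u) = (if i = 0 then y l u else wedge i v u)" if "u \<in> coord_space n" for i u
  proof -
    have "(\<Sum>k<Suc n. M i k * y k u) = (if i = 0 then y l (point (\<lambda>k. y k u)) else wedge i v (point (\<lambda>k. y k u)))"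
      by (simp add: M_def wedge_def lessThan_Suc_atMost y_point_sum m_point_sum sum_distrib_left left_diff_distrib
          sum_subtractf mult.assoc)
    then show ?thesis
      using that by (simp add: point_y)
  qed
  define w where "w = (\<lambda>i. y l p * v i - y l v * p i)"
  have w: "w \<in> coord_space n" "w \<noteq> (\<lambda>_. 0)"
  proof -
    show "w \<in> coord_space n"
      using v p by (simp add: w_def coord_space_def)
    show "w \<noteq> (\<lambda>_. 0)"
    proof
      assume "w = (\<lambda>_. 0)"
      then have "y l v * p i = y l p * v i" for i
        by (simp add: w_def fun_eq_iff)
      then have "p = (\<lambda>i. (y l p / y l v) * v i)"
        using l(2) by (simp add: fun_eq_iff field_simps)
      with p(2) show False
        by blast
    qed
  qed
  have yw: "y i w = y l p * y i v - y l v * y i p" for i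
    by (simp add: w_def y_diff y_scale)
  have mw: "m i w = y l p * m i v - y l v * m i p" for i
    by (simp add: w_def m_diff m_scale)
  have kernel: "(\<Sum>k<Suc n. M i k * y k w) = 0" if "i < Suc n" for i
  proof -
    have "wedge i v w = - y l v * wedge i v p"
      unfolding wedge_def yw mw by (simp add: algebra_simps)
    with p(3) have "wedge i v w = 0" if "i \<in> {1..n}"
      using that by simp
    then show ?thesis
      using that unfolding M[OF w(1)] by (auto simp: yw mult.commute)
  qed
  obtain l' where "l' \<le> n" "y l' w \<noteq> 0"
    using y_nonzero[OF w] .
  then have "\<exists>j<Suc n. y j w \<noteq> 0"
    by (auto simp: less_Suc_eq_le)
  then have "fdet (Suc n) M = 0"
    unfolding fdet_eq_0_iff by (intro exI[of _ "\<lambda>k. y k w"] conjI allI impI kernel)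
  then obtain \<mu> where \<mu>: "\<exists>i<Suc n. \<mu> i \<noteq> 0" "\<And>k. k < Suc n \<Longrightarrow> (\<Sum>i<Suc n. \<mu> i * M i k) = 0"
    unfolding fdet_eq_0_iff_left by blast
  have "0 = (\<Sum>k<Suc n. (\<Sum>i<Suc n. \<mu> i * M i k) * y k v)"
    using \<mu>(2) by simp
  also have "\<dots> = (\<Sum>i<Suc n. \<mu> i * (\<Sum>k<Suc n. M i k * y k v))"
    unfolding sum_distrib_left sum_distrib_right by (subst sum.swap) (simp only: mult.assoc)
  also have "\<dots> = (\<Sum>i<Suc n. if i = 0 then \<mu> 0 * y l v else 0)"
    unfolding M[OF v(1)] by (intro sum.cong) (auto simp: wedge_def)
  also have "\<dots> = \<mu> 0 * y l v"
    by simp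
  finally have \<mu>0: "\<mu> 0 = 0"
    using l(2) by simp
  \<comment> \<open>The rows of the linear system \<open>wedge i v p = 0\<close> in \<open>p\<close> are dependent, with coefficients \<open>\<mu>\<close>.\<close>
  have rel: "(\<Sum>i=1..n. \<mu> i * (y i v * m i (e k) - m i v * y i (e k))) = 0" if "k \<le> n" for k
    using \<mu>(2)[of k] that
    by (simp only: sum.lessThan_Suc_shift) (simp add: \<mu>0 M_def sum.atLeast1_atMost_eq)
  define \<beta> where "\<beta> i = \<mu> i * y i v" for i
  have sum0: "(\<Sum>i=1..n. \<beta> i) = 0"
  proof -
    have "(\<Sum>i=1..n. \<mu> i * (y i v * m i (e 0) - m i v * y i (e 0))) = (\<Sum>i=1..n. \<beta> i)"
      by (intro sum.cong) (auto simp: \<beta>_def m_e y_e)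
    with rel[of 0] show ?thesis
      by simp
  qed
  have col: "(\<Sum>i=1..n. \<beta> i * b i k) = \<mu> k * m k v" if "k \<in> {1..n}" for k
  proof -
    have "(\<Sum>i=1..n. \<mu> i * (y i v * m i (e k) - m i v * y i (e k)))
        = (\<Sum>i=1..n. \<beta> i * b i k - (if i = k then \<mu> k * m k v else 0))"
      using that by (intro sum.cong) (auto simp: \<beta>_def m_e y_e algebra_simps)
    also have "\<dots> = (\<Sum>i=1..n. \<beta> i * b i k) - \<mu> k * m k v"
      using that by (simp add: sum_subtractf)
    finally show ?thesis
      using rel[of k] that by simp
  qed
  have "\<exists>i\<in>{1..n}. \<beta> i \<noteq> 0"
  proof (rule ccontr)
    assume *: "\<not> ?thesis"
    obtain i where i: "i < Suc n" "\<mu> i \<noteq> 0"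
      using \<mu>(1) by blast
    then have i1: "i \<in> {1..n}"
      using \<mu>0 by (cases i) auto
    have "y i v = 0"
      using * i i1 by (auto simp: \<beta>_def)
    moreover have "\<mu> i * m i v = 0"
      using * col[OF i1] by (auto intro!: sum.neutral simp flip: col)
    ultimately show False
      using False i(2) i1 v(1) by (auto simp: center_def)
  qed
  moreover have "\<beta> j * m j v = y j v * (\<Sum>i=1..n. \<beta> i * b i j)" if "j \<in> {1..n}" for j
    unfolding col[OF that] by (simp add: \<beta>_def)
  ultimately show ?thesis
    unfolding F_zero_iff_relation using sum0 by blast
qed

end

section \<open>Points and lines\<close>

lemma coord_subspace_coord_space: "coord.subspace (coord_space n)"
  by (auto simp: coord.subspace_def coord_space_def coord_scale_def)

lemma coord_scale_apply: "coord_scale c v i = c * v i"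
  by (simp add: coord_scale_def)

lemma in_span_singleton: "w \<in> coord.span {v} \<longleftrightarrow> (\<exists>c. w = (\<lambda>i. c * v i))"
  by (auto simp: coord.span_singleton coord_scale_def)

lemma in_span_pair: "w \<in> coord.span {v, p} \<longleftrightarrow> (\<exists>s t. w = (\<lambda>i. s * v i + t * p i))"
proof -
  have "w \<in> coord.span {v, p} \<longleftrightarrow> (\<exists>s t. w - coord_scale s v = coord_scale t p)"
    by (auto simp: coord.span_insert[of v "{p}"] coord.span_singleton)
  also have "\<dots> \<longleftrightarrow> (\<exists>s t. w = (\<lambda>i. s * v i + t * p i))"
    by (simp add: fun_eq_iff coord_scale_apply algebra_simps)
  finally show ?thesis .
qed

lemma span_subset_coord_space: "S \<subseteq> coord_space n \<Longrightarrow> coord.span S \<subseteq> coord_space n"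
  by (rule coord.span_minimal[OF _ coord_subspace_coord_space])

lemma proj_points_span:
  assumes "v \<in> coord_space n" "v \<noteq> 0"
  shows "coord.span {v} \<in> proj_points n"
  using assms span_subset_coord_space[of "{v}" n]
  by (simp add: proj_subspaces_def coord.dim_eq_card_independent)

lemma proj_points_cases:
  assumes "P \<in> proj_points n"
  obtains v where "v \<in> coord_space n" "v \<noteq> 0" "P = coord.span {v}"
proof -
  have P: "coord.subspace P" "P \<subseteq> coord_space n" "coord.dim P = 1"
    using assms by (auto simp: proj_subspaces_def)
  obtain B where B: "B \<subseteq> P" "coord.independent B" "P \<subseteq> coord.span B" "card B = coord.dim P"
    using coord.basis_exists .
  then obtain v where v: "B = {v}"
    using P(3) by (auto simp: card_1_singleton_iff)
  with B P show thesis
    by (intro that[of v]) (auto simp: coord.span_subspace[symmetric])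
qed

lemma proj_lines_span:
  assumes "v \<in> coord_space n" "p \<in> coord_space n" "v \<noteq> 0" "p \<notin> coord.span {v}"
  shows "coord.span {v, p} \<in> proj_lines n"
proof -
  have "p \<noteq> v"
    using assms(4) coord.span_base[of v "{v}"] by auto
  moreover have "coord.independent {p, v}"
    using assms(3,4) by (simp add: coord.independent_insert)
  ultimately have "coord.dim (coord.span {v, p}) = 2"
    by (simp add: coord.dim_eq_card_independent insert_commute)
  then show ?thesis
    using assms(1,2) span_subset_coord_space[of "{v, p}" n] by (simp add: proj_subspaces_def)
qed

lemma proj_lines_cases:
  assumes L: "L \<in> proj_lines n" and v: "v \<in> L" "v \<noteq> 0"
  obtains p where "p \<in> coord_space n" "p \<notin> coord.span {v}" "L = coord.span {v, p}"
proof -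
  have L': "coord.subspace L" "L \<subseteq> coord_space n" "coord.dim L = 2"
    using L by (auto simp: proj_subspaces_def)
  have "coord.independent {v}"
    using v(2) by simp
  then obtain B where B: "{v} \<subseteq> B" "B \<subseteq> L" "coord.independent B" "L \<subseteq> coord.span B"
    using coord.maximal_independent_subset_extend[of "{v}" L] v(1) by auto
  have "card B = 2"
    using coord.basis_card_eq_dim[OF B(2,4,3)] L'(3) by simp
  then obtain p where p: "B = {v, p}" "p \<noteq> v"
    using B(1) by (auto simp: card_2_iff)
  have "coord.independent (insert p {v})"
    using B(3) p(1) by (simp add: insert_commute)
  then have "p \<notin> coord.span {v}"
    using p(2) by (simp add: coord.independent_insert)
  then show thesis
    using that[of p] p B L' coord.span_subspace[OF B(2,4) L'(1)] by auto
qed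

lemma sum_fun_apply: "(\<Sum>s\<in>S. f s) k = (\<Sum>s\<in>S. f s k)" for f :: "'s \<Rightarrow> 'i \<Rightarrow> 'a::comm_monoid_add"
  by (induction S rule: infinite_finite_induct) (simp_all add: zero_fun_def plus_fun_def)

text \<open>Pairing a linear combination with \<open>Y i\<close> extracts its \<open>i\<close>-th coefficient.\<close>

lemma independent_if_dual:
  fixes v :: "'i \<Rightarrow> nat \<Rightarrow> 'a::field"
  assumes fin: "finite I"
    and dual: "\<And>i j. i \<in> I \<Longrightarrow> j \<in> I \<Longrightarrow> (\<Sum>k\<le>n. Y i k * v j k) = (if i = j then 1 else 0)"
  shows "coord.independent (v ` I)" "card (v ` I) = card I"
proof -
  have inj: "inj_on v I"
    using dual by (intro inj_onI) (metis zero_neq_one)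
  show "card (v ` I) = card I"
    by (rule card_image) (rule inj)
  show "coord.independent (v ` I)"
  proof (rule coord.independent_if_scalars_zero)
    fix f x assume sum: "(\<Sum>x\<in>v ` I. coord_scale (f x) x) = 0" and "x \<in> v ` I"
    then obtain i where i: "i \<in> I" "x = v i"
      by blast
    have "(\<Sum>j\<in>I. f (v j) * v j k) = 0" for k
      using fun_cong[OF sum, of k] by (simp add: sum.reindex[OF inj] sum_fun_apply coord_scale_apply zero_fun_def)
    then have "0 = (\<Sum>k\<le>n. Y i k * (\<Sum>j\<in>I. f (v j) * v j k))"
      by simp
    also have "\<dots> = (\<Sum>j\<in>I. f (v j) * (\<Sum>k\<le>n. Y i k * v j k))"
      unfolding sum_distrib_left by (subst sum.swap) (simp add: mult_ac)
    also have "\<dots> = (\<Sum>j\<in>I. if j = i then f (v i) else 0)"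
      using dual i(1) by (intro sum.cong) auto
    also have "\<dots> = f x"
      using i fin by simp
    finally show "f x = 0" ..
  qed (use fin in simp)
qed

definition coord_unit :: "nat \<Rightarrow> nat \<Rightarrow> 'a::field" where
  "coord_unit t = (\<lambda>k. if k = t then 1 else 0)"

lemma coord_unit_space: "t \<le> n \<Longrightarrow> coord_unit t \<in> coord_space n"
  by (simp add: coord_unit_def coord_space_def)

lemma sum_coord_unit: "t \<le> n \<Longrightarrow> (\<Sum>k\<le>n. c k * coord_unit t k) = c t"
  by (simp add: coord_unit_def if_distrib[of "(*) _"] cong: if_cong)

lemma coord_expand:
  assumes "v \<in> coord_space n"
  shows "v = (\<Sum>t\<le>n. coord_scale (v t) (coord_unit t))"
proof
  fix k
  have "(\<Sum>t\<le>n. v t * coord_unit t k) = (\<Sum>t\<le>n. if t = k then v t else 0)"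
    by (intro sum.cong) (auto simp: coord_unit_def)
  also have "\<dots> = v k"
    using assms by (auto simp: coord_space_def)
  finally show "v k = (\<Sum>t\<le>n. coord_scale (v t) (coord_unit t)) k"
    by (simp add: sum_fun_apply coord_scale_apply)
qed

lemma dim_coord_space: "coord.dim (coord_space n :: (nat \<Rightarrow> 'a::field) set) = Suc n"
proof (rule coord.dim_unique[of "coord_unit ` {..n}"])
  have "(\<Sum>k\<le>n. coord_unit i k * coord_unit j k) = (if i = j then 1 else 0 :: 'a)" if "j \<in> {..n}" for i j
    using that sum_coord_unit[of j n "coord_unit i :: nat \<Rightarrow> 'a"] by (auto simp: coord_unit_def)
  then show "coord.independent (coord_unit ` {..n} :: (nat \<Rightarrow> 'a) set)"
    "card (coord_unit ` {..n} :: (nat \<Rightarrow> 'a) set) = Suc n"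
    using independent_if_dual[where v = "coord_unit :: nat \<Rightarrow> nat \<Rightarrow> 'a" and I = "{..n}" and n = n and Y = coord_unit] by auto
  show "coord_space n \<subseteq> coord.span (coord_unit ` {..n} :: (nat \<Rightarrow> 'a) set)"
  proof
    fix v :: "nat \<Rightarrow> 'a" assume v: "v \<in> coord_space n"
    show "v \<in> coord.span (coord_unit ` {..n})"
      by (subst coord_expand[OF v]) (intro coord.span_sum coord.span_scale coord.span_base imageI)
  qed
qed (auto intro: coord_unit_space)

lemma point_nonvanishing_iff:
  fixes G :: "(nat, 'a::field) mpoly"
  assumes "G \<in> forms n d"
  shows "(\<exists>w\<in>coord.span {v}. mpoly_eval w G \<noteq> 0) \<longleftrightarrow> mpoly_eval v G \<noteq> 0"
proof -
  have "G \<in> homogeneous d"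
    using assms forms_subset_homogeneous by blast
  note scale = homogeneous_eval_scale[OF this]
  have "v \<in> coord.span {v}"
    by (rule coord.span_base) simp
  moreover have "mpoly_eval v G \<noteq> 0" if "w \<in> coord.span {v}" "mpoly_eval w G \<noteq> 0" for w
    using that by (auto simp: in_span_singleton scale)
  ultimately show ?thesis
    by blast
qed

lemma divisor_points_span_iff:
  fixes f :: "(nat, 'a::field) mpoly"
  assumes f: "f \<in> forms n d" and v: "v \<in> coord_space n" "v \<noteq> 0"
  shows "coord.span {v} \<in> divisor_points n (divisor_of f) \<longleftrightarrow> mpoly_eval v f = 0"
proof -
  have "f \<in> divisor_of f"
    by (auto simp: divisor_of_def mpoly_const_def intro!: exI[of _ 1])
  then have "(\<forall>g\<in>divisor_of f. \<forall>w\<in>coord.span {v}. mpoly_eval w g = 0)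
      \<longleftrightarrow> (\<forall>w\<in>coord.span {v}. mpoly_eval w f = 0)"
    by (auto simp: divisor_of_def)
  then show ?thesis
    using point_nonvanishing_iff[OF f, of v] proj_points_span[OF v] by (auto simp: divisor_points_def)
qed

lemma divisor_of_scale:
  fixes f :: "(nat, 'a::field) mpoly"
  assumes "c \<noteq> 0"
  shows "divisor_of (mpoly_const c * f) = divisor_of f"
proof -
  have c: "mpoly_const a * (mpoly_const c * f) = mpoly_const (a * c) * f" for a
    by (simp add: mpoly_const_def mult_single flip: mult.assoc)
  show ?thesis
    unfolding divisor_of_def
  proof (intro equalityI subsetI; clarify)
    fix a :: 'a assume "a \<noteq> 0"
    then show "\<exists>a'. mpoly_const a * (mpoly_const c * f) = mpoly_const a' * f \<and> a' \<noteq> 0"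
      using assms c by (intro exI[of _ "a * c"]) simp
    show "\<exists>a'. mpoly_const a * f = mpoly_const a' * (mpoly_const c * f) \<and> a' \<noteq> 0"
      using assms \<open>a \<noteq> 0\<close> unfolding c by (intro exI[of _ "a / c"]) simp
  qed
qed

section \<open>Bases of the Zariski topologies\<close>

text \<open>A subbasis that is closed under binary intersections is a basis, up to the whole space. Principal open sets are
  closed under intersection because the product of two polynomials is nonzero exactly where both factors are.\<close>

lemma topology_generated_by_basic:
  assumes "openin (topology_generated_by S) T" "x \<in> T"
    and Int_closed: "\<And>A B. A \<in> S \<Longrightarrow> B \<in> S \<Longrightarrow> A \<inter> B \<in> S"
  obtains B where "B \<in> S" "x \<in> B" "B \<subseteq> T"
proof -
  have "generate_topology_on S T"
    using assms(1) by (simp add: openin_topology_generated_by_iff)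
  then have "x \<in> T \<longrightarrow> (\<exists>B\<in>S. x \<in> B \<and> B \<subseteq> T)"
  proof (induction rule: generate_topology_on.induct)
    case (Int A B)
    show ?case
    proof
      assume "x \<in> A \<inter> B"
      with Int.IH obtain A' B' where "A' \<in> S" "x \<in> A'" "A' \<subseteq> A" "B' \<in> S" "x \<in> B'" "B' \<subseteq> B"
        by blast
      then show "\<exists>C\<in>S. x \<in> C \<and> C \<subseteq> A \<inter> B"
        using Int_closed[of A' B'] by (intro bexI[of _ "A' \<inter> B'"]) auto
    qed
  next
    case (UN K)
    then show ?case
      by (meson Union_iff Union_upper subset_trans)
  qed auto
  with assms(2) that show thesis
    by blast
qed

lemma affine_zariski_basic:
  fixes T :: "('v \<Rightarrow> 'a::field) set"
  assumes "openin (affine_zariski I) T" "x \<in> T"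
  obtains G where "mpoly_eval x G \<noteq> 0" "\<And>z. z \<in> I \<rightarrow>\<^sub>E UNIV \<Longrightarrow> mpoly_eval z G \<noteq> 0 \<Longrightarrow> z \<in> T"
proof -
  define D where "D F = {x \<in> I \<rightarrow>\<^sub>E UNIV. mpoly_eval x F \<noteq> 0}" for F :: "('v, 'a) mpoly"
  have "openin (topology_generated_by (range D)) T"
    using assms(1) by (simp add: affine_zariski_def D_def full_SetCompr_eq)
  moreover have "A \<inter> B \<in> range D" if "A \<in> range D" "B \<in> range D" for A B
  proof -
    obtain F G where "A = D F" "B = D G"
      using \<open>A \<in> range D\<close> \<open>B \<in> range D\<close> by blast
    then have "A \<inter> B = D (F * G)"
      by (auto simp: D_def)
    then show ?thesis
      by simp
  qed
  ultimately obtain B where "B \<in> range D" "x \<in> B" "B \<subseteq> T"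
    using topology_generated_by_basic[of "range D" T x] assms(2) by blast
  with that show thesis
    by (auto simp: D_def)
qed

lemma proj_zariski_basic:
  fixes T :: "(nat \<Rightarrow> 'a::field) set set"
  assumes "openin (proj_zariski n) T" "coord.span {v} \<in> T"
  obtains G d where "G \<in> forms n d" "mpoly_eval v G \<noteq> 0"
    "\<And>w. w \<in> coord_space n \<Longrightarrow> w \<noteq> 0 \<Longrightarrow> mpoly_eval w G \<noteq> 0 \<Longrightarrow> coord.span {w} \<in> T"
proof -
  define D where "D G = {P \<in> proj_points n. \<exists>v\<in>P. mpoly_eval v G \<noteq> 0}" for G :: "(nat, 'a) mpoly"
  define S where "S = D ` (\<Union>d. forms n d)"
  have "S = {{P \<in> proj_points n. \<exists>v\<in>P. mpoly_eval v G \<noteq> 0} | G :: (nat, 'a) mpoly. \<exists>d. G \<in> forms n d}"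
    by (auto simp: S_def D_def)
  then have "openin (topology_generated_by S) T"
    using assms(1) by (simp add: proj_zariski_def)
  moreover have D_span: "coord.span {w} \<in> D G \<longleftrightarrow> coord.span {w} \<in> proj_points n \<and> mpoly_eval w G \<noteq> 0"
    if "G \<in> forms n d" for w G d
    using point_nonvanishing_iff[OF that, of w] by (auto simp: D_def)
  have "A \<inter> B \<in> S" if "A \<in> S" "B \<in> S" for A B
  proof -
    obtain F d G d' where FG: "A = D F" "F \<in> forms n d" "B = D G" "G \<in> forms n d'"
      using \<open>A \<in> S\<close> \<open>B \<in> S\<close> by (auto simp: S_def)
    have prod: "F * G \<in> forms n (d + d')"
      using FG by (intro forms_mult)
    have "P \<in> A \<inter> B \<longleftrightarrow> P \<in> D (F * G)" for P
    proof (cases "P \<in> proj_points n")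
      case True
      then obtain w where "P = coord.span {w}"
        by (rule proj_points_cases)
      then show ?thesis
        using D_span[OF FG(2)] D_span[OF FG(4)] D_span[OF prod] by (auto simp: FG(1,3))
    qed (simp add: FG D_def)
    then have "A \<inter> B = D (F * G)"
      by blast
    with prod show ?thesis
      by (auto simp: S_def)
  qed
  ultimately obtain B where "B \<in> S" "coord.span {v} \<in> B" "B \<subseteq> T"
    using topology_generated_by_basic[of S T "coord.span {v}"] assms(2) by blast
  then obtain G d where G: "G \<in> forms n d" "coord.span {v} \<in> D G" "D G \<subseteq> T"
    by (auto simp: S_def)
  show thesis
    by (rule that[OF G(1)]) (use G(2,3) D_span[OF G(1)] proj_points_span in blast)+
qed

lemma openin_proj_zariski_nonvanishing:
  fixes G :: "(nat, 'a::field) mpoly"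
  assumes "G \<in> forms n d"
  shows "openin (proj_zariski n) {P \<in> proj_points n. \<exists>v\<in>P. mpoly_eval v G \<noteq> 0}"
  unfolding proj_zariski_def by (rule topology_generated_by_Basis) (use assms in auto)

section \<open>Transversals\<close>

context pencil_frame
begin

lemma zero_fun_iff: "(0 :: nat \<Rightarrow> 'a) = (\<lambda>_. 0)"
  by (simp add: zero_fun_def)

lemma center_subspace: "coord.subspace (center j)"
  unfolding coord.subspace_def center_def
  by (auto simp: coord_space_def plus_fun_def zero_fun_def coord_scale_def y_add y_scale m_add m_scale
      y_zero m_def[of _ "\<lambda>_. 0"])

text \<open>The two linear equations \<open>y\<^sub>j = m\<^sub>j = 0\<close> on the plane spanned by \<open>v\<close> and \<open>p\<close> have a nonzero solution if and
  only if their \<open>2 \<times> 2\<close> determinant, which is \<open>wedge j v p\<close>, vanishes.\<close>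

lemma transversal_span_iff:
  assumes v: "v \<in> coord_space n" "v \<noteq> 0" and p: "p \<in> coord_space n" "p \<notin> coord.span {v}"
  shows "transversal n {1..n} center (coord.span {v, p}) \<longleftrightarrow> (\<forall>j\<in>{1..n}. wedge j v p = 0)"
proof -
  have "(\<exists>P\<in>proj_points n. P \<subseteq> coord.span {v, p} \<and> P \<subseteq> center j) \<longleftrightarrow> wedge j v p = 0" for j
  proof
    assume "\<exists>P\<in>proj_points n. P \<subseteq> coord.span {v, p} \<and> P \<subseteq> center j"
    then obtain P where P: "P \<in> proj_points n" "P \<subseteq> coord.span {v, p}" "P \<subseteq> center j"
      by blast
    obtain w where w: "w \<noteq> 0" "w \<in> coord.span {v, p}" "w \<in> center j"
      using proj_points_cases[OF P(1)] P(2,3) coord.span_base by (metis singletonI subsetD)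
    obtain s t where st: "w = (\<lambda>i. s * v i + t * p i)"
      using w(2) by (auto simp: in_span_pair)
    have zero: "s * y j v + t * y j p = 0" "s * m j v + t * m j p = 0"
      using w(3) by (simp_all add: st center_def y_add y_scale m_add m_scale)
    have "s * wedge j v p = (s * y j v + t * y j p) * m j p - (s * m j v + t * m j p) * y j p"
      "t * wedge j v p = y j v * (s * m j v + t * m j p) - m j v * (s * y j v + t * y j p)"
      by (simp_all add: wedge_def algebra_simps)
    then have "s * wedge j v p = 0" "t * wedge j v p = 0"
      unfolding zero by simp_all
    moreover have "s \<noteq> 0 \<or> t \<noteq> 0"
      using w(1) by (auto simp: st zero_fun_def)
    ultimately show "wedge j v p = 0"
      by auto
  next
    assume wedge: "wedge j v p = 0"
    have point: "\<exists>P\<in>proj_points n. P \<subseteq> coord.span {v, p} \<and> P \<subseteq> center j"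
      if st: "s \<noteq> 0 \<or> t \<noteq> 0" "s * y j v + t * y j p = 0" "s * m j v + t * m j p = 0" for s t
    proof -
      define w where "w = (\<lambda>i. s * v i + t * p i)"
      have w: "w \<in> coord_space n"
        using v p by (simp add: w_def coord_space_def)
      have "w \<noteq> 0"
      proof
        assume "w = 0"
        then have eq: "s * v i + t * p i = 0" for i
          by (simp add: w_def zero_fun_def fun_eq_iff)
        show False
        proof (cases "t = 0")
          case True
          with eq st(1) v(2) show False
            by (auto simp: zero_fun_def fun_eq_iff)
        next
          case False
          have "p i = (- s / t) * v i" for i
            using eq[of i] False by (simp add: field_simps eq_neg_iff_add_eq_0)
          with p(2) show False
            unfolding in_span_singleton by blast
        qed
      qed
      moreover have "w \<in> center j"
        using st w by (simp add: center_def w_def y_add y_scale m_add m_scale)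
      then have "coord.span {w} \<subseteq> center j"
        using coord.span_minimal[OF _ center_subspace] by simp
      moreover have "w \<in> coord.span {v, p}"
        by (auto simp: in_span_pair w_def)
      then have "coord.span {w} \<subseteq> coord.span {v, p}"
        using coord.span_minimal[of "{w}" "coord.span {v, p}"] by simp
      ultimately show ?thesis
        using proj_points_span[OF w] by blast
    qed
    show "\<exists>P\<in>proj_points n. P \<subseteq> coord.span {v, p} \<and> P \<subseteq> center j"
    proof (cases "y j p = 0 \<and> y j v = 0")
      case False
      then show ?thesis
        using wedge by (intro point[of "y j p" "- y j v"]) (auto simp: wedge_def algebra_simps)
    next
      case y0: True
      show ?thesis
      proof (cases "m j p = 0 \<and> m j v = 0")
        case False
        then show ?thesis
          using y0 by (intro point[of "m j p" "- m j v"]) (auto simp: algebra_simps)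
      next
        case True
        then show ?thesis
          using y0 by (intro point[of 1 0]) auto
      qed
    qed
  qed
  then show ?thesis
    using proj_lines_span[OF v(1) p(1) v(2) p(2)] by (simp add: transversal_def)
qed

lemma transversal_through_cases:
  assumes v: "v \<in> coord_space n" "v \<noteq> 0"
    and L: "transversal n {1..n} center L" "coord.span {v} \<subseteq> L"
  obtains p where "p \<in> coord_space n" "p \<notin> coord.span {v}" "L = coord.span {v, p}"
    "\<And>j. j \<in> {1..n} \<Longrightarrow> wedge j v p = 0"
proof -
  have "v \<in> L"
    using L(2) coord.span_base[of v "{v}"] by auto
  then obtain p where p: "p \<in> coord_space n" "p \<notin> coord.span {v}" "L = coord.span {v, p}"
    using proj_lines_cases[of L n v] L(1) v(2) by (auto simp: transversal_def)
  with transversal_span_iff[OF v p(1,2)] L(1) that show thesis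
    by blast
qed

lemma F_zero_iff_transversal:
  assumes v: "v \<in> coord_space n" "v \<noteq> 0"
  shows "mpoly_eval v F = 0 \<longleftrightarrow> (\<exists>L. transversal n {1..n} center L \<and> coord.span {v} \<subseteq> L)"
proof
  assume "mpoly_eval v F = 0"
  then obtain p where p: "p \<in> coord_space n" "\<And>c. p \<noteq> (\<lambda>i. c * v i)" "\<And>j. j \<in> {1..n} \<Longrightarrow> wedge j v p = 0"
    using F_zero_imp_transversal_direction v unfolding zero_fun_iff by blast
  have "p \<notin> coord.span {v}"
    using p(2) by (auto simp: in_span_singleton)
  moreover have "coord.span {v} \<subseteq> coord.span {v, p}"
    by (rule coord.span_mono) simp
  ultimately show "\<exists>L. transversal n {1..n} center L \<and> coord.span {v} \<subseteq> L"
    using transversal_span_iff[OF v p(1)] p(3) by blast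
next
  assume "\<exists>L. transversal n {1..n} center L \<and> coord.span {v} \<subseteq> L"
  then obtain L where L: "transversal n {1..n} center L" "coord.span {v} \<subseteq> L"
    by blast
  obtain p where p: "p \<in> coord_space n" "p \<notin> coord.span {v}" "\<And>j. j \<in> {1..n} \<Longrightarrow> wedge j v p = 0"
    using transversal_through_cases[OF v L] by blast
  have "p \<noteq> (\<lambda>i. c * v i)" for c
    using p(2) by (auto simp: in_span_singleton)
  then show "mpoly_eval v F = 0"
    using transversal_direction_imp_F_zero[of v p] v p unfolding zero_fun_iff by blast
qed

lemma divisor_points_F:
  "divisor_points n (divisor_of F) =
    {q \<in> proj_points n. \<exists>L. transversal n {1..n} center L \<and> q \<subseteq> L}"
proof -
  have "P \<in> divisor_points n (divisor_of F) \<longleftrightarrow> (\<exists>L. transversal n {1..n} center L \<and> P \<subseteq> L)"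
    if "P \<in> proj_points n" for P
    using that
  proof (rule proj_points_cases)
    fix v assume v: "v \<in> coord_space n" "v \<noteq> 0" "P = coord.span {v}"
    show ?thesis
      unfolding v(3) divisor_points_span_iff[OF F_forms v(1,2)] F_zero_iff_transversal[OF v(1,2)] ..
  qed
  then show ?thesis
    by (auto simp: divisor_points_def)
qed

lemma F_contains_center:
  assumes "j \<in> {1..n}"
  shows "divisor_contains n (divisor_of F) (center j)"
  unfolding divisor_contains_def
proof safe
  fix P assume P: "P \<in> proj_points n" "P \<subseteq> center j"
  from P(1) show "P \<in> divisor_points n (divisor_of F)"
  proof (rule proj_points_cases)
    fix v assume v: "v \<in> coord_space n" "v \<noteq> 0" "P = coord.span {v}"
    then have "v \<in> center j"
      using P(2) coord.span_base[of v "{v}"] by auto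
    then show ?thesis
      unfolding v(3) divisor_points_span_iff[OF F_forms v(1,2)] using assms by (rule F_zero_center[rotated])
  qed
qed

section \<open>Points on a unique transversal\<close>

text \<open>The linear equations \<open>wedge r v p = 0\<close> in \<open>p\<close> with \<open>r \<noteq> i\<close>, together with \<open>y\<^sub>1\<close> and \<open>y\<^sub>i\<close>. If this determinant is
  nonzero, the \<open>n - 1\<close> equations are independent, so their solutions form a space of dimension two. The choice of
  \<open>y\<^sub>1\<close> and \<open>y\<^sub>i\<close> suits the node \<open>node i 1\<close>.\<close>

definition rank_minor :: "nat \<Rightarrow> (nat, 'a) mpoly" where
  "rank_minor i = fdet (Suc n) (\<lambda>r c.
     if r = 0 then mpoly_const (if c = 1 then 1 else 0)
     else if r = i then mpoly_const (if c = i then 1 else 0)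
     else mpoly_const (m r (e c)) * y_form r - mpoly_const (y r (e c)) * m_form r)"

lemma rank_minor_forms:
  assumes i: "i \<in> {1..n}"
  shows "rank_minor i \<in> forms n (n - 1)"
proof -
  have "rank_minor i \<in> forms n (\<Sum>r<Suc n. if r = 0 \<or> r = i then 0 else 1)"
    unfolding rank_minor_def
    by (intro fdet_forms) (auto intro!: forms_diff forms_scale forms_const y_form_in_forms[simplified] m_form_in_forms[simplified])
  moreover have "(\<Sum>r<Suc n. if r = 0 \<or> r = i then 0 else 1 :: nat) = card ({..<Suc n} - {0, i})"
    by (subst card_eq_sum, rule sum.mono_neutral_cong_right) auto
  moreover have "card ({..<Suc n} - {0, i}) = n - 1"
    using i by (subst card_Diff_subset) auto
  ultimately show ?thesis
    by simp
qed

lemma rank_minor_zero_iff: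
  assumes i: "i \<in> {1..n}"
  shows "mpoly_eval v (rank_minor i) = 0 \<longleftrightarrow> (\<exists>u\<in>coord_space n. u \<noteq> 0 \<and> y 1 u = 0 \<and> y i u = 0 \<and>
    (\<forall>j\<in>{1..n}. j \<noteq> i \<longrightarrow> wedge j v u = 0))"
proof -
  define M where "M r c = (if r = 0 then (if c = 1 then 1 else 0) else if r = i then (if c = i then 1 else 0)
    else y r v * m r (e c) - m r v * y r (e c))" for r c
  have eval: "mpoly_eval v (rank_minor i) = fdet (Suc n) M"
    unfolding rank_minor_def fdet_hom[OF mpoly_eval.mpoly_subst_comm_ring_hom] M_def
    by (rule fdet_cong) (simp add: eval_y_form eval_m_form mult.commute)
  have M: "(\<Sum>c<Suc n. M r c * x c) =
      (if r = 0 then y 1 (point x) else if r = i then y i (point x) else wedge r v (point x))" if "r < Suc n" for r x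
  proof -
    have "(\<Sum>c<Suc n. (y r v * m r (e c) - m r v * y r (e c)) * x c) = wedge r v (point x)"
      by (simp add: wedge_def lessThan_Suc_atMost y_point_sum m_point_sum sum_distrib_left left_diff_distrib
          sum_subtractf mult.assoc)
    moreover have "(\<Sum>c<Suc n. (if c = l then 1 else 0) * x c) = x l" if "l \<le> n" for l
      using that by (simp add: if_distrib[of "\<lambda>x. x * _"] cong: if_cong)
    ultimately show ?thesis
      using i n_ge_2 by (simp add: M_def del: sum.lessThan_Suc)
  qed
  have "fdet (Suc n) M = 0 \<longleftrightarrow> (\<exists>x. (\<exists>j<Suc n. x j \<noteq> 0) \<and> (\<forall>r<Suc n. (\<Sum>c<Suc n. M r c * x c) = 0))"
    by (rule fdet_eq_0_iff)
  also have "\<dots> \<longleftrightarrow> (\<exists>x. point x \<noteq> 0 \<and> y 1 (point x) = 0 \<and> y i (point x) = 0 \<and>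
      (\<forall>j\<in>{1..n}. j \<noteq> i \<longrightarrow> wedge j v (point x) = 0))"
  proof (intro arg_cong[of _ _ Ex] ext)
    fix x
    have "(\<exists>j<Suc n. x j \<noteq> 0) \<longleftrightarrow> point x \<noteq> 0"
    proof
      assume "\<exists>j<Suc n. x j \<noteq> 0"
      then obtain j where "j \<le> n" "y j (point x) \<noteq> 0"
        by (auto simp: less_Suc_eq_le)
      then show "point x \<noteq> 0"
        unfolding zero_fun_iff using y_zero[of j] by metis
    next
      assume "point x \<noteq> 0"
      then obtain l where "l \<le> n" "y l (point x) \<noteq> 0"
        using y_nonzero[of "point x"] by (auto simp: zero_fun_iff)
      then show "\<exists>j<Suc n. x j \<noteq> 0"
        by (intro exI[of _ l]) auto
    qed
    moreover have "(\<forall>r<Suc n. (\<Sum>c<Suc n. M r c * x c) = 0) \<longleftrightarrow>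
        y 1 (point x) = 0 \<and> y i (point x) = 0 \<and> (\<forall>j\<in>{1..n}. j \<noteq> i \<longrightarrow> wedge j v (point x) = 0)"
    proof -
      have "(\<forall>r<Suc n. (\<Sum>c<Suc n. M r c * x c) = 0) \<longleftrightarrow> (\<forall>r<Suc n.
          (if r = 0 then y 1 (point x) else if r = i then y i (point x) else wedge r v (point x)) = 0)"
        by (intro iff_allI imp_cong refl) (simp only: M)
      also have "\<dots> \<longleftrightarrow> y 1 (point x) = 0 \<and> y i (point x) = 0 \<and> (\<forall>j\<in>{1..n}. j \<noteq> i \<longrightarrow> wedge j v (point x) = 0)"
      proof safe
        assume *: "\<forall>r<Suc n. (if r = 0 then y 1 (point x) else if r = i then y i (point x) else wedge r v (point x)) = 0"
        show "y 1 (point x) = 0" using *[rule_format, of 0] by simp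
        show "y i (point x) = 0" using *[rule_format, of i] i by (simp split: if_splits)
        show "wedge j v (point x) = 0" if "j \<in> {1..n}" "j \<noteq> i" for j
          using *[rule_format, of j] that by simp
      next
        fix r assume *: "y 1 (point x) = 0" "y i (point x) = 0" "\<forall>j\<in>{1..n}. j \<noteq> i \<longrightarrow> wedge j v (point x) = 0" "r < Suc n"
        show "(if r = 0 then y 1 (point x) else if r = i then y i (point x) else wedge r v (point x)) = 0"
          using * by (cases "r = 0") (simp_all add: less_Suc_eq_le)
      qed
      finally show ?thesis .
    qed
    ultimately show "((\<exists>j<Suc n. x j \<noteq> 0) \<and> (\<forall>r<Suc n. (\<Sum>c<Suc n. M r c * x c) = 0)) =
        (point x \<noteq> 0 \<and> y 1 (point x) = 0 \<and> y i (point x) = 0 \<and> (\<forall>j\<in>{1..n}. j \<noteq> i \<longrightarrow> wedge j v (point x) = 0))"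
      by simp
  qed
  also have "\<dots> \<longleftrightarrow> (\<exists>u\<in>coord_space n. u \<noteq> 0 \<and> y 1 u = 0 \<and> y i u = 0 \<and> (\<forall>j\<in>{1..n}. j \<noteq> i \<longrightarrow> wedge j v u = 0))"
  proof
    assume "\<exists>u\<in>coord_space n. u \<noteq> 0 \<and> y 1 u = 0 \<and> y i u = 0 \<and> (\<forall>j\<in>{1..n}. j \<noteq> i \<longrightarrow> wedge j v u = 0)"
    then obtain u where u: "u \<in> coord_space n" "u \<noteq> 0 \<and> y 1 u = 0 \<and> y i u = 0 \<and>
      (\<forall>j\<in>{1..n}. j \<noteq> i \<longrightarrow> wedge j v u = 0)"
      by blast
    show "\<exists>x. point x \<noteq> 0 \<and> y 1 (point x) = 0 \<and> y i (point x) = 0 \<and> (\<forall>j\<in>{1..n}. j \<noteq> i \<longrightarrow> wedge j v (point x) = 0)"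
      by (rule exI[of _ "\<lambda>k. y k u"]) (use u(2) in \<open>simp add: point_y[OF u(1)]\<close>)
  qed (use point_space in blast)
  finally show ?thesis
    unfolding eval .
qed

lemma y_linear: "y j (\<lambda>k. r * u k + s * u' k) = r * y j u + s * y j u'"
  by (simp add: y_add y_scale)

lemma wedge_linear: "wedge j v (\<lambda>k. r * u k + s * u' k) = r * wedge j v u + s * wedge j v u'"
  by (simp add: wedge_def y_add y_scale m_add m_scale algebra_simps)

lemma wedge_self: "wedge j v v = 0"
  by (simp add: wedge_def)

text \<open>If \<open>p\<close> and \<open>p'\<close> span two transversals with \<open>v\<close>, some combination of \<open>v\<close>, \<open>p\<close> and \<open>p'\<close> with coefficients given by
  a cross product satisfies \<open>y\<^sub>1 = y\<^sub>i = 0\<close> and is therefore zero, which puts \<open>p'\<close> on the line through \<open>v\<close> and \<open>p\<close>.\<close>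

lemma unique_transversal:
  assumes v: "v \<in> coord_space n" "v \<noteq> 0" and i: "i \<in> {1..n}"
    and rank: "mpoly_eval v (rank_minor i) \<noteq> 0"
    and L: "transversal n {1..n} center L" "coord.span {v} \<subseteq> L"
    and L': "transversal n {1..n} center L'" "coord.span {v} \<subseteq> L'"
  shows "L = L'"
proof -
  have kernel: "u = 0" if "u \<in> coord_space n" "y 1 u = 0" "y i u = 0" "\<And>j. j \<in> {1..n} \<Longrightarrow> wedge j v u = 0" for u
    using rank that unfolding rank_minor_zero_iff[OF i] by blast
  obtain p where p: "p \<in> coord_space n" "p \<notin> coord.span {v}" "L = coord.span {v, p}"
    "\<And>j. j \<in> {1..n} \<Longrightarrow> wedge j v p = 0"
    using transversal_through_cases[OF v L] by blast
  obtain p' where p': "p' \<in> coord_space n" "p' \<notin> coord.span {v}" "L' = coord.span {v, p'}"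
    "\<And>j. j \<in> {1..n} \<Longrightarrow> wedge j v p' = 0"
    using transversal_through_cases[OF v L'] by blast
  have comb: "r = 0 \<and> s = 0" if "r * y 1 v + s * y 1 p = 0" "r * y i v + s * y i p = 0" for r s
  proof -
    have "(\<lambda>k. r * v k + s * p k) = 0"
    proof (rule kernel)
      show "(\<lambda>k. r * v k + s * p k) \<in> coord_space n"
        using v p by (simp add: coord_space_def)
      show "wedge j v (\<lambda>k. r * v k + s * p k) = 0" if "j \<in> {1..n}" for j
        using p(4)[OF that] by (simp add: wedge_linear wedge_self)
    qed (use that in \<open>simp_all add: y_add y_scale\<close>)
    then have eq: "r * v k + s * p k = 0" for k
      by (simp add: zero_fun_def fun_eq_iff)
    have "s = 0"
    proof (rule ccontr)
      assume "s \<noteq> 0"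
      then have "p k = (- r / s) * v k" for k
        using eq[of k] by (simp add: field_simps eq_neg_iff_add_eq_0)
      with p(2) show False
        unfolding in_span_singleton by blast
    qed
    with eq v(2) show ?thesis
      by (auto simp: zero_fun_def fun_eq_iff)
  qed
  define D where "D = y 1 v * y i p - y i v * y 1 p"
  have "D \<noteq> 0"
  proof
    assume "D = 0"
    then have "y 1 p = 0 \<and> - y 1 v = 0" "y i p = 0 \<and> - y i v = 0"
      using comb[of "y 1 p" "- y 1 v"] comb[of "y i p" "- y i v"] by (auto simp: D_def algebra_simps)
    then show False
      using comb[of 1 0] by simp
  qed
  define r where "r = y 1 p * y i p' - y i p * y 1 p'"
  define s where "s = y i v * y 1 p' - y 1 v * y i p'"
  have "(\<lambda>k. 1 * (\<lambda>k. r * v k + s * p k) k + D * p' k) = 0"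
  proof (rule kernel)
    show "(\<lambda>k. 1 * (\<lambda>k. r * v k + s * p k) k + D * p' k) \<in> coord_space n"
      using v p p' by (simp add: coord_space_def)
    show "wedge j v (\<lambda>k. 1 * (\<lambda>k. r * v k + s * p k) k + D * p' k) = 0" if "j \<in> {1..n}" for j
      unfolding wedge_linear using p(4)[OF that] p'(4)[OF that] by (simp add: wedge_self)
  qed (unfold y_linear, simp_all add: r_def s_def D_def algebra_simps)
  then have "r * v k + s * p k + D * p' k = 0" for k
    by (simp add: zero_fun_def fun_eq_iff)
  then have "D * p' k = - (r * v k + s * p k)" for k
    by (simp only: add_eq_0_iff)
  then have "p' k = (- r / D) * v k + (- s / D) * p k" for k
    using \<open>D \<noteq> 0\<close> by (simp add: field_simps)
  then have "p' \<in> coord.span {v, p}"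
    unfolding in_span_pair by blast
  moreover have "v \<in> L"
    by (simp add: p(3) coord.span_base)
  ultimately have "L' \<subseteq> L"
    unfolding p'(3) p(3) by (intro coord.span_minimal) (auto simp: coord.span_base)
  moreover have "p \<in> L'"
  proof -
    obtain a c where ac: "p' = (\<lambda>k. a * v k + c * p k)"
      using \<open>p' \<in> coord.span {v, p}\<close> by (auto simp: in_span_pair)
    have "c \<noteq> 0"
      using p'(2) by (auto simp: ac in_span_singleton)
    then have "p = (\<lambda>k. (- a / c) * v k + (1 / c) * p' k)"
      by (simp add: ac fun_eq_iff field_simps)
    then show ?thesis
      unfolding p'(3) in_span_pair by blast
  qed
  then have "L \<subseteq> L'"
    unfolding p(3) p'(3) by (intro coord.span_minimal) (auto simp: coord.span_base)
  ultimately show ?thesis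
    by blast
qed

lemma rank_minor_node:
  assumes i: "i \<in> {2..n}"
  shows "mpoly_eval (node i 1) (rank_minor i) \<noteq> 0"
proof
  assume "mpoly_eval (node i 1) (rank_minor i) = 0"
  moreover have i1: "i \<in> {1..n}"
    using i by auto
  ultimately obtain u where u: "u \<in> coord_space n" "u \<noteq> 0" "y 1 u = 0" "y i u = 0"
    "\<And>j. j \<in> {1..n} \<Longrightarrow> j \<noteq> i \<Longrightarrow> wedge j (node i 1) u = 0"
    unfolding rank_minor_zero_iff[OF i1] by blast
  have one: "1 \<in> {1..n}"
    using n_ge_2 by simp
  have pos: "y j u = 0" if "j \<in> {1..n}" for j
  proof (cases "j = 1 \<or> j = i")
    case False
    then have "wedge j (node i 1) u = - (b j 1 - b i 1) * y j u"
      using that one by (simp add: wedge_def y_node m_node algebra_simps)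
    moreover have "b j 1 \<noteq> b i 1"
      using b_distinct[of j i 1] that i1 one False i by auto
    ultimately show ?thesis
      using u(5)[OF that] False by auto
  qed (use u in auto)
  have "wedge 1 (node i 1) u = m 1 u"
    using n_ge_2 pos[OF one] by (simp add: wedge_def y_node)
  also have "\<dots> = y 0 u"
    using pos by (simp add: m_def)
  finally have "y 0 u = 0"
    using u(5)[of 1] n_ge_2 i by auto
  with pos have "y k u = 0" if "k \<le> n" for k
    using that by (cases "k = 0") auto
  with u(1,2) y_nonzero[of u] show False
    by (auto simp: zero_fun_iff)
qed

end

section \<open>Density of the points on a unique transversal\<close>

text \<open>Besides being algebraically closed, the field carries the gcd structure that makes the polynomials in two
  variables over it a factorial ring; every algebraic closure has it.\<close>

locale pencil_frame_ac = pencil_frame n e Y b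
  for n and e Y b :: "nat \<Rightarrow> nat \<Rightarrow> 'a::{alg_closed_field, field_char_0, factorial_ring_gcd, semiring_gcd_mult_normalize}"
begin

text \<open>Let the point \<open>x = v - y\<^sub>0(v) e\<^sub>0\<close> move to \<open>e\<^sub>1\<close> along a line, and let \<open>y\<^sub>0\<close> vary as second parameter. On this plane \<open>F\<close> is a
  curve that is monic in \<open>y\<^sub>0\<close>, and over \<open>e\<^sub>1\<close> it only has nodes, at which some \<open>rank_minor i\<close> is nonzero.\<close>

lemma F_generic_point:
  assumes v: "v \<in> coord_space n" "mpoly_eval v F = 0" and G: "mpoly_eval v G \<noteq> 0"
  obtains w i where "w \<in> coord_space n" "w \<noteq> 0" "mpoly_eval w F = 0" "mpoly_eval w G \<noteq> 0"
    "i \<in> {1..n}" "mpoly_eval w (rank_minor i) \<noteq> 0"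
proof -
  define x where "x k = v k - y 0 v * e 0 k" for k
  define d where "d k = e 1 k - x k" for k
  define h where "h = line_poly (\<lambda>c::'a. [:c:]) (\<lambda>k. [:e 0 k:]) (\<lambda>k. [:x k, d k:])"
  interpret C: coeff_hom "\<lambda>c::'a. [:c:]"
    by (rule mpoly_eval.coeff_hom_pCons)
  have h: "poly2 (h f) s z = mpoly_eval (\<lambda>k. x k + s * d k + z * e 0 k) f" for f s z
  proof -
    have "poly (h f) [:z:] = mpoly_subst (\<lambda>c. [:c:]) (\<lambda>k. [:x k, d k:] + [:z:] * [:e 0 k:]) f"
      unfolding h_def by (rule C.poly_line_poly)
    also have "poly \<dots> s = mpoly_eval (\<lambda>k. poly ([:x k, d k:] + [:z:] * [:e 0 k:]) s) f"
    proof (rule C.mpoly_subst_hom)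
      show "comm_ring_hom (\<lambda>p :: 'a poly. poly p s)"
        by unfold_locales auto
    qed simp
    finally have "poly2 (h f) s z = mpoly_eval (\<lambda>k. poly ([:x k, d k:] + [:z:] * [:e 0 k:]) s) f" .
    then show ?thesis
      by (simp add: algebra_simps)
  qed
  have F_hom: "F \<in> homogeneous (n - 1)"
    using F_forms forms_subset_homogeneous by blast
  have "comm_ring_hom (\<lambda>c::'a. [:c:])"
    by (rule C.coeff_hom)
  then have "mpoly_subst (\<lambda>c. [:c:]) (\<lambda>k. [:e 0 k:]) F = [:mpoly_eval (e 0) F:]"
    by (rule mpoly_eval.mpoly_subst_hom[symmetric]) simp
  then have "coeff (h F) (n - 1) = 1"
    unfolding h_def C.line_poly_homogeneous(2)[OF F_hom] by (simp add: F_e0 one_pCons)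
  moreover have "degree (h F) \<le> n - 1"
    unfolding h_def by (rule C.line_poly_homogeneous(1)[OF F_hom])
  ultimately have "lead_coeff (h F) = 1"
    by (metis le_antisym le_degree zero_neq_one)
  then have lc: "lead_coeff (h F) dvd 1"
    by simp
  have start: "(\<lambda>k. x k + 0 * d k + y 0 v * e 0 k) = v"
    by (simp add: x_def)
  have "poly2 (h F) 0 (y 0 v) = 0"
    unfolding h start by (rule v(2))
  then obtain z1 where z1: "poly2 (h F) 1 z1 = 0"
    "\<And>U U'. poly2 U 0 (y 0 v) \<noteq> 0 \<Longrightarrow> poly2 U' 1 z1 \<noteq> 0 \<Longrightarrow>
      \<exists>s z. poly2 (h F) s z = 0 \<and> poly2 U s z \<noteq> 0 \<and> poly2 U' s z \<noteq> 0"
    using plane_curve_component[OF lc, of "y 0 v" 0 1] by blast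
  have finish: "(\<lambda>k. x k + 1 * d k + z * e 0 k) = (\<lambda>k. e 1 k + z * e 0 k)" for z
    by (simp add: d_def)
  have one: "1 \<in> {1..n}"
    using n_ge_2 by simp
  obtain i where i: "i \<in> {1..n} - {1}" "z1 = - b i 1"
    using z1(1) F_zero_on_axis_iff[OF one, of z1] unfolding h finish by blast
  have "poly2 (h (rank_minor i)) 1 z1 \<noteq> 0"
    unfolding h finish i(2) node_line[OF one, symmetric] by (rule rank_minor_node) (use i in auto)
  moreover have "poly2 (h G) 0 (y 0 v) \<noteq> 0"
    unfolding h start by (rule G)
  ultimately obtain s z where sz: "poly2 (h F) s z = 0" "poly2 (h G) s z \<noteq> 0" "poly2 (h (rank_minor i)) s z \<noteq> 0"
    using z1(2) by blast
  define w where "w = (\<lambda>k. x k + s * d k + z * e 0 k)"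
  have w: "w \<in> coord_space n"
    using v(1) e_space[of 0] e_space[of 1] n_ge_2 by (simp add: w_def x_def d_def coord_space_def)
  have "w \<noteq> 0"
  proof
    assume w0: "w = 0"
    have "wedge j w u = 0" for j u
      by (simp add: w0 wedge_def zero_fun_def y_zero m_def)
    moreover obtain p where "p \<in> coord_space n" "p \<noteq> (\<lambda>_. 0)" "y 1 p = 0" "y i p = 0"
    proof -
      have "e 0 \<noteq> (\<lambda>_. 0)"
        using y_e[of 0 0] y_zero[of 0] by auto
      then show thesis
        using that[of "e 0"] i e_space[of 0] n_ge_2 by (simp add: y_e)
    qed
    ultimately have "mpoly_eval w (rank_minor i) = 0"
      using rank_minor_zero_iff[of i w] i by (auto simp: zero_fun_iff)
    with sz(3) show False
      by (simp add: h w_def)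
  qed
  with w sz i show thesis
    by (intro that[of w i]) (auto simp: h w_def)
qed

lemma dense_unique_transversal:
  fixes Q defines "Q \<equiv> divisor_points n (divisor_of F)"
  shows "\<exists>V. dense_open (subtopology (proj_zariski n) Q) V \<and>
    (\<forall>q\<in>V. \<exists>!L. transversal n {1..n} center L \<and> q \<subseteq> L)"
proof -
  define N where "N = (\<Union>i\<in>{1..n}. {P \<in> proj_points n. \<exists>v\<in>P. mpoly_eval v (rank_minor i) \<noteq> 0})"
  have open_N: "openin (proj_zariski n) N"
    unfolding N_def by (intro openin_Union) (auto intro!: openin_proj_zariski_nonvanishing rank_minor_forms)
  have N_iff: "coord.span {v} \<in> N \<longleftrightarrow> (\<exists>i\<in>{1..n}. mpoly_eval v (rank_minor i) \<noteq> 0)"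
    if "v \<in> coord_space n" "v \<noteq> 0" for v
    using proj_points_span[OF that] point_nonvanishing_iff[OF rank_minor_forms]
    by (auto simp: N_def)
  have Q_iff: "coord.span {v} \<in> Q \<longleftrightarrow> mpoly_eval v F = 0" if "v \<in> coord_space n" "v \<noteq> 0" for v
    unfolding Q_def by (rule divisor_points_span_iff[OF F_forms that])
  have Q_points: "Q \<subseteq> proj_points n"
    by (auto simp: Q_def divisor_points_def)
  have "proj_points n \<subseteq> topspace (proj_zariski n :: (nat \<Rightarrow> 'a) set topology)"
  proof -
    have one: "(1 :: (nat, 'a) mpoly) \<in> forms n 0"
      by (rule forms_one)
    have "\<exists>v\<in>P. mpoly_eval v (1 :: (nat, 'a) mpoly) \<noteq> 0" if "P \<in> proj_points n" for P
      using that by (rule proj_points_cases) (auto intro!: coord.span_base)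
    then have "{P \<in> proj_points n. \<exists>v\<in>P. mpoly_eval v (1 :: (nat, 'a) mpoly) \<noteq> 0} = proj_points n"
      by blast
    with openin_proj_zariski_nonvanishing[OF one] show ?thesis
      using openin_subset by metis
  qed
  with Q_points have top: "topspace (subtopology (proj_zariski n) Q) = Q"
    by auto
  show ?thesis
  proof (intro exI conjI ballI)
    show "dense_open (subtopology (proj_zariski n) Q) (Q \<inter> N)"
      unfolding dense_open_def top
    proof
      show "openin (subtopology (proj_zariski n) Q) (Q \<inter> N)"
        using open_N by (auto simp: openin_subtopology)
      show "subtopology (proj_zariski n) Q closure_of (Q \<inter> N) = Q"
      proof (intro equalityI subsetI)
        fix q assume "q \<in> subtopology (proj_zariski n) Q closure_of (Q \<inter> N)"
        then show "q \<in> Q"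
          by (metis closure_of_subset_topspace subsetD top)
      next
        fix q assume q: "q \<in> Q"
        show "q \<in> subtopology (proj_zariski n) Q closure_of (Q \<inter> N)"
          unfolding in_closure_of top
        proof (intro conjI allI impI q)
          fix T assume T: "q \<in> T \<and> openin (subtopology (proj_zariski n) Q) T"
          then obtain T' where T': "openin (proj_zariski n) T'" "T = T' \<inter> Q"
            by (auto simp: openin_subtopology)
          from q Q_points have "q \<in> proj_points n"
            by blast
          then obtain v where v: "v \<in> coord_space n" "v \<noteq> 0" "q = coord.span {v}"
            by (rule proj_points_cases)
          obtain G d where G: "G \<in> forms n d" "mpoly_eval v G \<noteq> 0"
            "\<And>w. w \<in> coord_space n \<Longrightarrow> w \<noteq> 0 \<Longrightarrow> mpoly_eval w G \<noteq> 0 \<Longrightarrow> coord.span {w} \<in> T'"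
            using proj_zariski_basic[OF T'(1), of v] T T'(2) v(3) by blast
          have Fv: "mpoly_eval v F = 0"
            using q Q_iff[OF v(1,2)] v(3) by simp
          obtain w i where w: "w \<in> coord_space n" "w \<noteq> 0" "mpoly_eval w F = 0" "mpoly_eval w G \<noteq> 0"
            "i \<in> {1..n}" "mpoly_eval w (rank_minor i) \<noteq> 0"
            using F_generic_point[OF v(1) Fv G(2)] .
          then have "coord.span {w} \<in> (Q \<inter> N) \<inter> T"
            using G(3) Q_iff N_iff T'(2) by auto
          then show "\<exists>r. r \<in> Q \<inter> N \<and> r \<in> T"
            by blast
        qed
      qed
    qed
  next
    fix q assume q: "q \<in> Q \<inter> N"
    with Q_points have "q \<in> proj_points n"
      by blast
    then obtain v where v: "v \<in> coord_space n" "v \<noteq> 0" "q = coord.span {v}"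
      by (rule proj_points_cases)
    obtain i where i: "i \<in> {1..n}" "mpoly_eval v (rank_minor i) \<noteq> 0"
      using q N_iff[OF v(1,2)] v(3) by auto
    have "mpoly_eval v F = 0"
      using q Q_iff[OF v(1,2)] v(3) by auto
    then obtain L where L: "transversal n {1..n} center L" "q \<subseteq> L"
      using F_zero_iff_transversal[OF v(1,2)] v(3) by blast
    show "\<exists>!L. transversal n {1..n} center L \<and> q \<subseteq> L"
    proof (rule ex1I[of _ L])
      show "transversal n {1..n} center L \<and> q \<subseteq> L"
        using L by simp
      show "L' = L" if "transversal n {1..n} center L' \<and> q \<subseteq> L'" for L'
        using unique_transversal[OF v(1,2) i, of L' L] that L by (simp add: v(3))
    qed
  qed
qed

end

section \<open>Irreducibility\<close>

context pencil_frame_ac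
begin

text \<open>This line lies in the \<open>i\<close>-th subspace.\<close>

lemma F_zero_on_node_lines:
  assumes "i \<in> {1..n}" "j \<in> {1..n}" "k \<in> {1..n}" "i \<noteq> j" "i \<noteq> k"
  shows "mpoly_eval (\<lambda>l. (1 - t) * node i j l + t * node i k l) F = 0"
proof (rule F_zero_center[OF assms(1)])
  have "node i j \<in> center i" "node i k \<in> center i"
    using node_center assms by auto
  then show "(\<lambda>l. (1 - t) * node i j l + t * node i k l) \<in> center i"
    using center_subspace[of i] by (auto simp: center_def coord_space_def y_add y_scale m_add m_scale)
qed

text \<open>This line is a common zero of the summands of the relation \<open>\<beta> = e\<^sub>j - e\<^sub>k\<close>.\<close>

lemma F_zero_on_transposed_node_line:
  assumes j: "j \<in> {1..n}" and k: "k \<in> {1..n}" and jk: "j \<noteq> k"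
  shows "mpoly_eval (\<lambda>l. (1 - t) * node k j l + t * node j k l) F = 0" (is "mpoly_eval ?v F = 0")
proof -
  define \<beta> :: "nat \<Rightarrow> 'a" where "\<beta> l = (if l = j then 1 else if l = k then - 1 else 0)" for l
  have sum_\<beta>: "(\<Sum>l=1..n. \<beta> l * h l) = h j - h k" for h
  proof -
    have "(\<Sum>l=1..n. \<beta> l * h l) = (\<Sum>l\<in>{j, k}. \<beta> l * h l)"
      using j k by (intro sum.mono_neutral_right) (auto simp: \<beta>_def)
    then show ?thesis
      using jk by (simp add: \<beta>_def)
  qed
  have mv: "m l ?v = (1 - t) * (b l j - b k j) + t * (b l k - b j k)" for l
    using j k by (simp add: m_add m_scale m_node)
  have yv: "y l ?v = (if l = j then 1 - t else if l = k then t else 0)" if "l \<in> {1..n}" for l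
    using that jk by (auto simp: y_add y_scale y_node)
  show ?thesis
    unfolding F_zero_iff_relation
  proof (intro exI[of _ \<beta>] conjI ballI)
    show "\<exists>i\<in>{1..n}. \<beta> i \<noteq> 0"
      using j by (intro bexI[of _ j]) (auto simp: \<beta>_def)
    show "(\<Sum>i=1..n. \<beta> i) = 0"
      using sum_\<beta>[of "\<lambda>_. 1"] by simp
    fix l assume l: "l \<in> {1..n}"
    show "\<beta> l * m l ?v = y l ?v * (\<Sum>i=1..n. \<beta> i * b i l)"
      unfolding sum_\<beta> mv yv[OF l] using jk b_diag[OF j] b_diag[OF k]
      by (auto simp: \<beta>_def algebra_simps)
  qed
qed

text \<open>The nodes on the line through \<open>e\<^sub>0\<close> and \<open>e\<^sub>j\<close> exhaust the degrees of \<open>f\<close> and \<open>g\<close> together, so none is a zero of both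
  factors (\<open>exclusive\<close>). Two lines on \<open>Q\<close> carry a zero of \<open>f\<close> from one node to another: from \<open>node i j\<close> to
  \<open>node i k\<close> and from \<open>node i j\<close> to \<open>node j i\<close>. So \<open>f\<close> vanishes at all zeros of \<open>F\<close> on the line
  through \<open>e\<^sub>0\<close> and \<open>e\<^sub>1\<close>, and \<open>g\<close> at none; but \<open>g\<close> restricts to a polynomial of degree \<open>d\<close> there.\<close>

lemma factor_degree_zero:
  assumes fg: "f * g = F" and f: "f \<in> homogeneous a" and g: "g \<in> homogeneous d" and ad: "a + d = n - 1"
    and start: "mpoly_eval (node 2 1) f = 0"
  shows "d = 0"
proof -
  have eval_fg: "mpoly_eval x f * mpoly_eval x g = mpoly_eval x F" for x
    by (simp flip: fg)
  have fe0: "mpoly_eval (e 0) f \<noteq> 0" and ge0: "mpoly_eval (e 0) g \<noteq> 0"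
    using eval_fg[of "e 0"] F_e0 by auto
  define l where "l j = line_poly (\<lambda>c. c) (e 0) (e j)" for j
  have l: "poly (l j h) z = mpoly_eval (\<lambda>k. e j k + z * e 0 k) h" for h j z
    unfolding l_def by (rule mpoly_eval.poly_line_poly)
  have deg: "degree (l j f) \<le> a" "coeff (l j f) a \<noteq> 0" "degree (l j g) \<le> d" "coeff (l j g) d \<noteq> 0" for j
    unfolding l_def using mpoly_eval.line_poly_homogeneous[OF f] mpoly_eval.line_poly_homogeneous[OF g] fe0 ge0
    by auto
  then have nz: "l j f \<noteq> 0" "l j g \<noteq> 0" for j
    by (metis coeff_0)+
  have exclusive: False if j: "j \<in> {1..n}" and z: "poly (l j f) z = 0" "poly (l j g) z = 0" for j z
  proof -
    let ?R = "\<lambda>h. {z. poly (l j h) z = 0}"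
    have fin: "finite (?R f)" "finite (?R g)"
      using nz poly_roots_finite by blast+
    have "(\<lambda>i. - b i j) ` ({1..n} - {j}) \<subseteq> ?R f \<union> ?R g"
    proof
      fix x assume "x \<in> (\<lambda>i. - b i j) ` ({1..n} - {j})"
      then have "mpoly_eval (\<lambda>k. e j k + x * e 0 k) F = 0"
        using F_zero_on_axis_iff[OF j, of x] by auto
      then show "x \<in> ?R f \<union> ?R g"
        by (simp add: l flip: eval_fg)
    qed
    then have "card ((\<lambda>i. - b i j) ` ({1..n} - {j})) \<le> card (?R f \<union> ?R g)"
      using fin by (intro card_mono) auto
    moreover have "inj_on (\<lambda>i. - b i j) ({1..n} - {j})"
      using b_distinct j by (intro inj_onI) (metis DiffD1 DiffD2 neg_equal_iff_equal singletonI)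
    then have "card ((\<lambda>i. - b i j) ` ({1..n} - {j})) = n - 1"
      using j by (simp add: card_image)
    moreover have "card (?R f \<union> ?R g) + card (?R f \<inter> ?R g) = card (?R f) + card (?R g)"
      using card_Un_Int[OF fin] by simp
    moreover have "card (?R f) \<le> a" "card (?R g) \<le> d"
      using card_poly_roots_bound[of "l j f"] card_poly_roots_bound[of "l j g"] nz deg
      by (meson order_trans)+
    moreover have "card (?R f \<inter> ?R g) > 0"
      using z fin by (subst card_gt_0_iff) auto
    ultimately show False
      using ad by linarith
  qed
  have ex: "mpoly_eval (node i j) g \<noteq> 0" if "j \<in> {1..n}" "mpoly_eval (node i j) f = 0" for i j
    using exclusive[OF that(1), of "- b i j"] that(2) by (auto simp: l node_line[OF that(1)])
  have step1: "mpoly_eval (node i k) f = 0"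
    if "i \<in> {1..n}" "j \<in> {1..n}" "k \<in> {1..n}" "i \<noteq> j" "i \<noteq> k" "mpoly_eval (node i j) f = 0" for i j k
    by (rule factor_vanishes_on_line[of "node i j" _ f g])
      (unfold fg, rule F_zero_on_node_lines, use that ex in auto)
  have step2: "mpoly_eval (node j i) f = 0"
    if "i \<in> {1..n}" "j \<in> {1..n}" "i \<noteq> j" "mpoly_eval (node i j) f = 0" for i j
    by (rule factor_vanishes_on_line[of "node i j" _ f g])
      (unfold fg, rule F_zero_on_transposed_node_line, use that ex in auto)
  have one: "1 \<in> {1..n}" "2 \<in> {1..n}"
    using n_ge_2 by auto
  have all: "mpoly_eval (node k 1) f = 0" if k: "k \<in> {1..n}" "k \<noteq> 1" for k
  proof (cases "k = 2")
    case False
    have "mpoly_eval (node 2 k) f = 0"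
      using step1[of 2 1 k] one k False start by simp
    then have "mpoly_eval (node k 2) f = 0"
      using step2[of 2 k] one k False by simp
    then show ?thesis
      using step1[of k 2 1] one k False by simp
  qed (use start in simp)
  show "d = 0"
  proof (rule ccontr)
    assume "d \<noteq> 0"
    then have "degree (l 1 g) > 0"
      using deg(4)[of 1] le_degree by fastforce
    then obtain z where z: "poly (l 1 g) z = 0"
      using alg_closed_imp_poly_has_root by blast
    then have "mpoly_eval (\<lambda>k. e 1 k + z * e 0 k) F = 0"
      by (simp add: l flip: eval_fg)
    then obtain i where i: "i \<in> {1..n} - {1}" "z = - b i 1"
      using F_zero_on_axis_iff[OF one(1), of z] by blast
    then have "poly (l 1 f) z = 0"
      using all[of i] by (simp add: l node_line[OF one(1), simplified])
    with z exclusive[OF one(1)] show False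
      by blast
  qed
qed

lemma F_irreducible: "irreducible F"
proof (rule irreducibleI)
  show "F \<noteq> 0"
    using F_e0 by auto
  have no_unit: "d = 0 \<Longrightarrow> h \<in> homogeneous d \<Longrightarrow> h \<noteq> 0 \<Longrightarrow> h dvd 1" for h :: "(nat, 'a) mpoly" and d
    using homogeneous_0_const[of h] mpoly_const_is_unit[of "lookup h 0"]
    by (metis mpoly_const_def single_zero)
  show "\<not> F dvd 1"
  proof
    assume "F dvd 1"
    then obtain g where "1 = F * g" ..
    then have "mpoly_eval (node 2 1) F * mpoly_eval (node 2 1) g = 1"
      by (metis mpoly_eval.mpoly_subst_mult mpoly_eval.mpoly_subst_one)
    moreover have "mpoly_eval (node 2 1) F = 0"
      using F_zero_center[of 2 "node 2 1"] node_center[of 2 1] n_ge_2 by simp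
    ultimately show False
      by simp
  qed
  fix f g assume fg: "F = f * g"
  have "f * g \<in> homogeneous (n - 1)" "f * g \<noteq> 0"
    using F_forms forms_subset_homogeneous \<open>F \<noteq> 0\<close> by (auto simp flip: fg)
  then obtain a d where ad: "f \<in> homogeneous a" "g \<in> homogeneous d" "a + d = n - 1"
    using homogeneous_factors by blast
  have "mpoly_eval (node 2 1) f * mpoly_eval (node 2 1) g = 0"
    using F_zero_center[of 2 "node 2 1"] node_center[of 2 1] n_ge_2 by (simp add: fg)
  then consider "mpoly_eval (node 2 1) f = 0" | "mpoly_eval (node 2 1) g = 0"
    by auto
  then show "f dvd 1 \<or> g dvd 1"
  proof cases
    case 1
    then have "d = 0"
      using factor_degree_zero[of f g a d] fg ad by simp
    then show ?thesis
      using no_unit[of d g] ad \<open>f * g \<noteq> 0\<close> by auto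
  next
    case 2
    then have "a = 0"
      using factor_degree_zero[of g f d a] fg ad by (simp add: mult.commute add.commute)
    then show ?thesis
      using no_unit[of a f] ad \<open>f * g \<noteq> 0\<close> by auto
  qed
qed

lemma divisor_F_reduced_irreducible: "reduced_irreducible (divisor_of F)"
  unfolding reduced_irreducible_def divisor_of_def
  using F_irreducible mpoly_const_is_unit by (auto intro!: irreducible_unit_mult)

section \<open>Uniqueness\<close>

lemma infinite_field: "infinite (UNIV :: 'a set)"
  by (rule infinite_UNIV_char_0)

text \<open>In the coordinates \<open>y\<^sub>i\<close> the form becomes \<open>H\<close>. The support of a monomial means the set of its variables other
  than \<open>y\<^sub>0\<close>, and \<open>S\<close> is a support of minimal cardinality. For a general choice of the \<open>y\<^sub>j\<close> with
  \<open>j \<in> S\<close>, all other \<open>y\<^sub>j\<close> being zero, \<open>H\<close> is a polynomial in \<open>y\<^sub>0\<close> of degree at most \<open>n - 1 - |S|\<close> that has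
  the \<open>n - |S|\<close> roots \<open>- \<Sum>\<^sub>j b\<^sub>i\<^sub>j y\<^sub>j\<close> with \<open>i \<notin> S\<close>, since these points lie on the \<open>i\<close>-th subspace. For
  \<open>S = \<emptyset>\<close> there is only the monomial \<open>y\<^sub>0 ^ (n - 1)\<close>, whose coefficient is the value at \<open>e\<^sub>0\<close>.\<close>

lemma form_vanishing_on_centers_zero:
  assumes G: "G \<in> forms n (n - 1)"
    and centers: "\<And>j v. j \<in> {1..n} \<Longrightarrow> v \<in> center j \<Longrightarrow> mpoly_eval v G = 0"
    and G0: "mpoly_eval (e 0) G = 0"
  shows "G = 0"
proof -
  define H where "H = mpoly_subst mpoly_const (\<lambda>k. linear_form n (\<lambda>j. e j k)) G"
  have eval_H: "mpoly_eval x H = mpoly_eval (point x) G" for x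
  proof -
    have "mpoly_eval x H = mpoly_eval (\<lambda>k. mpoly_eval x (linear_form n (\<lambda>j. e j k))) G"
      unfolding H_def
      by (rule mpoly_const.mpoly_subst_hom[OF mpoly_eval.mpoly_subst_comm_ring_hom]) simp
    then show ?thesis
      by (simp add: mpoly_eval.mpoly_subst_linear_form point_def mult.commute)
  qed
  have H_forms: "H \<in> forms n (n - 1)"
    unfolding H_def by (intro forms_subst[OF G] linear_form_forms)
  define supp where "supp m = keys m - {0}" for m :: "nat \<Rightarrow>\<^sub>0 nat"
  have "keys H = {}"
  proof (rule ccontr)
    assume "keys H \<noteq> {}"
    then obtain m0 where m0: "m0 \<in> keys H"
        "\<And>m. m \<in> keys H \<Longrightarrow> card (supp m0) \<le> card (supp m)"
      using ex_has_least_nat[of "\<lambda>m. m \<in> keys H" _ "\<lambda>m. card (supp m)"] by blast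
    define S where "S = supp m0"
    have H_keys: "keys m \<subseteq> {..n}" "monom_degree m = n - 1" if "m \<in> keys H" for m
      using H_forms that by (auto simp: forms_def)
    have S: "S \<subseteq> {1..n}" "finite S"
      using H_keys(1)[OF m0(1)] by (auto simp: S_def supp_def)
    define K where "K = {m \<in> keys H. supp m = S}"
    have K: "finite K" "m0 \<in> K"
      using m0(1) by (auto simp: K_def S_def)
    define c where "c = lookup H"
    have degree_K: "lookup m 0 + card S \<le> n - 1" if "m \<in> K" for m
    proof -
      have m: "m \<in> keys H" "supp m = S"
        using that by (auto simp: K_def)
      have "n - 1 = (\<Sum>v\<in>insert 0 S. lookup m v)"
        unfolding H_keys(2)[OF m(1), symmetric] using m(2) S(2)
        by (intro monom_degree_superset) (auto simp: supp_def)
      also have "\<dots> = lookup m 0 + (\<Sum>v\<in>S. lookup m v)"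
        using S by (subst sum.insert) auto
      finally have "n - 1 = lookup m 0 + (\<Sum>v\<in>S. lookup m v)" .
      moreover have "(\<Sum>v\<in>S. 1) \<le> (\<Sum>v\<in>S. lookup m v)"
        by (rule sum_mono) (auto simp: m(2)[symmetric] supp_def in_keys_iff)
      ultimately show ?thesis
        by simp
    qed
    have eval_K: "mpoly_eval x H = (\<Sum>m\<in>K. c m * monom_eval x m)" if x: "\<And>k. k \<noteq> 0 \<Longrightarrow> k \<notin> S \<Longrightarrow> x k = 0" for x
    proof -
      have "monom_eval x m = 0" if m: "m \<in> keys H" "supp m \<noteq> S" for m
      proof -
        have "\<not> supp m \<subseteq> S"
        proof
          assume "supp m \<subseteq> S"
          with m(2) S(2) have "card (supp m) < card S"
            by (intro psubset_card_mono) auto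
          with m0(2)[OF m(1)] show False
            by (simp add: S_def)
        qed
        then obtain k where k: "k \<in> keys m" "k \<noteq> 0" "k \<notin> S"
          by (auto simp: supp_def)
        then have "x k ^ lookup m k = 0"
          using x[of k] by (simp add: in_keys_iff)
        with k(1) show ?thesis
          unfolding monom_eval_def by (intro prod_zero) auto
      qed
      then show ?thesis
        unfolding mpoly_subst_def monom_eval_def[symmetric] c_def
        by (intro sum.mono_neutral_right) (auto simp: K_def)
    qed
    define R where "R = (\<Sum>m\<in>K. single m (c m))"
    have eval_R: "mpoly_eval x R = (\<Sum>m\<in>K. c m * monom_eval x m)" for x
      by (simp add: R_def mpoly_eval.mpoly_subst_sum)
    have "lookup R m0 = (\<Sum>m\<in>K. if m = m0 then c m else 0)"
      unfolding R_def lookup_sum by (intro sum.cong) (auto simp: lookup_single)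
    also have "\<dots> = c m0"
      using K by simp
    also have "\<dots> \<noteq> 0"
      using m0(1) by (simp add: c_def in_keys_iff)
    finally have "R \<noteq> 0"
      by auto
    then obtain x0 where x0: "mpoly_eval x0 R \<noteq> 0"
      using mpoly_nonvanishing[OF infinite_field] by blast
    define trunc where "trunc x = (\<lambda>k. if k = 0 \<or> k \<in> S then x k else 0)" for x :: "nat \<Rightarrow> 'a"
    have eval_R_trunc: "mpoly_eval (trunc x) H = mpoly_eval x R" for x
    proof -
      have "mpoly_eval (trunc x) H = (\<Sum>m\<in>K. c m * monom_eval (trunc x) m)"
        by (rule eval_K) (simp add: trunc_def)
      also have "\<dots> = (\<Sum>m\<in>K. c m * monom_eval x m)"
      proof (intro sum.cong refl arg_cong2[where f = "(*)"])
        fix m assume "m \<in> K"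
        then have "supp m = S"
          by (simp add: K_def)
        then show "monom_eval (trunc x) m = monom_eval x m"
          unfolding monom_eval_def trunc_def by (intro prod.cong) (auto simp: supp_def)
      qed
      finally show ?thesis
        by (simp add: eval_R)
    qed
    show False
    proof (cases "S = {}")
      case True
      have "mpoly_eval x0 R = (\<Sum>m\<in>K. c m * x0 0 ^ (n - 1))"
      proof -
        have "monom_eval x0 m = x0 0 ^ (n - 1)" if "m \<in> K" for m
        proof -
          have m: "keys m \<subseteq> {0}" "m \<in> keys H"
            using that True by (auto simp: K_def supp_def)
          have "monom_degree m = lookup m 0"
            using monom_degree_superset[OF _ m(1)] by simp
          then show ?thesis
            using monom_eval_superset[OF _ m(1), of x0] H_keys(2)[OF m(2)] by simp
        qed
        then show ?thesis
          by (simp add: eval_R)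
      qed
      moreover have "(\<Sum>m\<in>K. c m) = mpoly_eval (\<lambda>k. if k = 0 then 1 else 0) H"
      proof -
        have "monom_eval (\<lambda>k. if k = 0 then 1 else 0) m = (1::'a)" if "m \<in> K" for m
          using that True by (auto simp: K_def supp_def monom_eval_def intro!: prod.neutral)
        then show ?thesis
          by (subst eval_K) auto
      qed
      moreover have "point (\<lambda>k. if k = 0 then 1 else 0) = e 0"
        by (simp add: point_def fun_eq_iff if_distrib[of "\<lambda>x. x * _"] cong: if_cong)
      ultimately have "mpoly_eval x0 R = 0"
        using G0 by (simp add: eval_H sum_distrib_right[symmetric])
      with x0 show False ..
    next
      case False
      then obtain j0 where j0: "j0 \<in> S"
        by blast
      \<comment> \<open>The line from \<open>x0\<close>, where \<open>R\<close> is nonzero, to \<open>e j0\<close>, where the roots are distinct. The coordinate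
        \<open>y\<^sub>0\<close> stays fixed, and some \<open>s\<close> has both properties.\<close>
      define x where "x s k = x0 k + s * ((if k = 0 then x0 0 else if k = j0 then 1 else 0) - x0 k)" for s k
      define T where "T = {1..n} - S"
      define r where "r = line_poly (\<lambda>c. c) (\<lambda>k. (if k = 0 then x0 0 else if k = j0 then 1 else 0) - x0 k) x0 R"
      have r: "poly r s = mpoly_eval (x s) R" for s
        unfolding r_def mpoly_eval.poly_line_poly x_def ..
      \<comment> \<open>The difference of the \<open>i'\<close>-th and the \<open>i\<close>-th root as a polynomial in \<open>s\<close>.\<close>
      define q where "q i i' = (\<Sum>j\<in>S. smult (b i j - b i' j) [:x0 j, (if j = j0 then 1 else 0) - x0 j:])" for i i'
      have S0: "0 \<notin> S"
        using S by auto
      have q: "poly (q i i') s = (\<Sum>j\<in>S. b i j * x s j) - (\<Sum>j\<in>S. b i' j * x s j)" for i i' s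
      proof -
        have "poly (q i i') s = (\<Sum>j\<in>S. (b i j - b i' j) * x s j)"
          unfolding q_def poly_sum by (intro sum.cong) (use S0 in \<open>auto simp: x_def algebra_simps\<close>)
        then show ?thesis
          by (simp add: left_diff_distrib sum_subtractf)
      qed
      have "q i i' \<noteq> 0" if i: "i \<in> T" "i' \<in> T" "i \<noteq> i'" for i i'
      proof -
        have "(\<Sum>j\<in>S. b k j * x 1 j) = b k j0" for k
        proof -
          have "(\<Sum>j\<in>S. b k j * x 1 j) = (\<Sum>j\<in>S. if j = j0 then b k j0 else 0)"
            by (intro sum.cong) (use S0 in \<open>auto simp: x_def\<close>)
          then show ?thesis
            using S(2) j0 by simp
        qed
        then have "poly (q i i') 1 = b i j0 - b i' j0"
          by (simp only: q)
        moreover have "b i j0 \<noteq> b i' j0"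
          using i j0 S by (intro b_distinct) (auto simp: T_def)
        ultimately show ?thesis
          by auto
      qed
      moreover have "r \<noteq> 0"
      proof -
        have "x 0 = x0"
          by (simp add: x_def fun_eq_iff)
        with r[of 0] x0 show ?thesis
          by auto
      qed
      moreover define Bad where "Bad = {s. poly r s = 0} \<union> (\<Union>i\<in>T. \<Union>i'\<in>T - {i}. {s. poly (q i i') s = 0})"
      ultimately have "finite Bad"
        unfolding Bad_def using S by (intro finite_UnI finite_UN_I poly_roots_finite) (auto simp: T_def)
      with infinite_field obtain s where "s \<notin> Bad"
        using ex_new_if_finite by blast
      then have s': "s \<notin> {s. poly r s = 0} \<union> (\<Union>i\<in>T. \<Union>i'\<in>T - {i}. {s. poly (q i i') s = 0})"
        unfolding Bad_def .
      have s: "poly r s \<noteq> 0"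
        using s' by simp
      have s_distinct: "poly (q i i') s \<noteq> 0" if "i \<in> T" "i' \<in> T" "i \<noteq> i'" for i i'
        using s' that by simp
      define root where "root i = - (\<Sum>j\<in>S. b i j * x s j)" for i
      define p where "p = (\<Sum>m\<in>K. smult (c m * (\<Prod>v\<in>S. x s v ^ lookup m v)) (monom 1 (lookup m 0)))"
      have p: "poly p z = mpoly_eval ((x s)(0 := z)) R" for z
      proof -
        have "monom_eval ((x s)(0 := z)) m = z ^ lookup m 0 * (\<Prod>v\<in>S. x s v ^ lookup m v)"
          if "m \<in> K" for m
        proof -
          have "monom_eval ((x s)(0 := z)) m = (\<Prod>v\<in>insert 0 S. ((x s)(0 := z)) v ^ lookup m v)"
            using that S(2) by (intro monom_eval_superset) (auto simp: K_def supp_def)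
          also have "\<dots> = z ^ lookup m 0 * (\<Prod>v\<in>S. ((x s)(0 := z)) v ^ lookup m v)"
            using S(2) S0 by simp
          also have "(\<Prod>v\<in>S. ((x s)(0 := z)) v ^ lookup m v) = (\<Prod>v\<in>S. x s v ^ lookup m v)"
            using S0 by (intro prod.cong) auto
          finally show ?thesis .
        qed
        then show ?thesis
          by (simp add: eval_R p_def poly_sum poly_monom mult_ac)
      qed
      have "degree p \<le> n - 1 - card S"
        unfolding p_def
      proof (intro degree_sum_le K(1))
        fix m assume "m \<in> K"
        then show "degree (smult (c m * (\<Prod>v\<in>S. x s v ^ lookup m v)) (monom 1 (lookup m 0)))
            \<le> n - 1 - card S"
          using degree_K[of m] degree_smult_le degree_monom_le
          by (metis (no_types, lifting) add_le_imp_le_diff order_trans)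
      qed
      moreover have "p \<noteq> 0"
      proof -
        have "(x s)(0 := x0 0) = x s"
          by (simp add: x_def fun_eq_iff)
        then have "poly p (x0 0) \<noteq> 0"
          using s by (simp add: p r)
        then show ?thesis
          by auto
      qed
      moreover have "root ` T \<subseteq> {z. poly p z = 0}"
      proof
        fix z assume "z \<in> root ` T"
        then obtain i where i: "i \<in> T" "z = root i"
          by blast
        let ?v = "point (trunc ((x s)(0 := z)))"
        have i1: "i \<in> {1..n}" "i \<notin> S"
          using i(1) by (auto simp: T_def)
        have "(\<Sum>j=1..n. b i j * trunc ((x s)(0 := z)) j) = (\<Sum>j\<in>S. b i j * x s j)"
          using S S0 by (intro sum.mono_neutral_cong_right) (auto simp: trunc_def)
        then have "m i ?v = 0"
          by (simp add: m_point i(2) root_def) (simp add: trunc_def)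
        moreover have "y i ?v = 0"
          using i1 by (simp add: trunc_def)
        ultimately have "?v \<in> center i"
          by (simp add: center_def)
        then have "mpoly_eval ?v G = 0"
          using centers i1(1) by blast
        then show "z \<in> {z. poly p z = 0}"
          by (simp add: p eval_H flip: eval_R_trunc)
      qed
      ultimately have "card (root ` T) \<le> n - 1 - card S"
        using card_poly_roots_bound[of p] poly_roots_finite[of p] card_mono by (meson order_trans)
      moreover have "card (root ` T) = n - card S"
      proof -
        have "root i \<noteq> root i'" if "i \<in> T" "i' \<in> T" "i \<noteq> i'" for i i'
          using s_distinct[OF that] unfolding root_def q by auto
        then have "inj_on root T"
          by (meson inj_onI)
        then show ?thesis
          using S by (simp add: card_image T_def card_Diff_subset)
      qed
      moreover have "card S \<le> n - 1"
        using degree_K[OF K(2)] by simp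
      ultimately show False
        using n_ge_2 by simp
    qed
  qed
  then have H0: "H = 0"
    by simp
  show "G = 0"
  proof (rule ccontr)
    assume "G \<noteq> 0"
    then obtain v where v: "mpoly_eval v G \<noteq> 0"
      using mpoly_nonvanishing[OF infinite_field] by blast
    define v' where "v' k = (if k \<le> n then v k else 0)" for k
    have "mpoly_eval v G = mpoly_eval v' G"
      by (rule forms_eval_cong[OF G]) (simp add: v'_def)
    moreover have "point (\<lambda>i. y i v') = v'"
      by (rule point_y) (simp add: v'_def coord_space_def)
    ultimately show False
      using v eval_H[of "\<lambda>i. y i v'"] by (simp add: H0)
  qed
qed

lemma F_unique:
  assumes G: "G \<in> forms n (n - 1)"
    and centers: "\<And>j v. j \<in> {1..n} \<Longrightarrow> v \<in> center j \<Longrightarrow> mpoly_eval v G = 0"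
  shows "G = mpoly_const (mpoly_eval (e 0) G) * F"
proof -
  have "G - mpoly_const (mpoly_eval (e 0) G) * F = 0"
  proof (rule form_vanishing_on_centers_zero)
    show "G - mpoly_const (mpoly_eval (e 0) G) * F \<in> forms n (n - 1)"
      by (intro forms_diff forms_scale G F_forms)
  qed (use centers F_zero_center F_e0 in auto)
  then show ?thesis
    by simp
qed

section \<open>Multiplicities\<close>

text \<open>In local coordinates at \<open>q\<close>, a linear form that vanishes at \<open>q\<close> has no constant term. So each column of the matrix
  whose subspace contains \<open>q\<close> raises the order of the determinant by one. The column of ones is put at an
  index \<open>k\<close> whose subspace does not contain \<open>q\<close>; the subspaces have no point in common.\<close>

lemma multiplicity_bound:
  assumes q: "q \<in> proj_points n"
  shows "divisor_mult (divisor_of F) q \<ge> card {i \<in> {1..n}. q \<subseteq> center i}"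
proof -
  obtain v where v: "v \<in> coord_space n" "v \<noteq> 0" "q = coord.span {v}"
    using q by (rule proj_points_cases)
  define i0 where "i0 = (LEAST i. \<exists>v\<in>q. v i \<noteq> 0)"
  have "v \<in> q"
    by (simp add: v(3) coord.span_base)
  moreover have "\<exists>i. v i \<noteq> 0"
    using v(2) by (auto simp: zero_fun_def fun_eq_iff)
  ultimately have "\<exists>i. \<exists>v\<in>q. v i \<noteq> 0"
    by blast
  then have "\<exists>u\<in>q. u i0 \<noteq> 0"
    unfolding i0_def by (rule LeastI_ex)
  then have vi0: "v i0 \<noteq> 0"
    unfolding v(3) by (auto simp: in_span_singleton)
  define w where "w = (\<lambda>k. inverse (v i0) * v k)"
  have w: "w \<in> q" "w i0 = 1"
    using vi0 by (auto simp: w_def v(3) in_span_singleton)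
  have the_w: "(THE w. w \<in> q \<and> w i0 = 1) = w"
  proof (rule the_equality)
    fix u assume u: "u \<in> q \<and> u i0 = 1"
    then obtain c where c: "u = (\<lambda>k. c * v k)"
      by (auto simp: v(3) in_span_singleton)
    with u have "c = inverse (v i0)"
      using vi0 by (simp add: field_simps)
    with c show "u = w"
      by (simp add: w_def)
  qed (use w in auto)
  have w_space: "w \<in> coord_space n"
    using w(1) q by (auto simp: proj_subspaces_def)
  have q_center: "q \<subseteq> center i \<longleftrightarrow> w \<in> center i" for i
  proof
    assume "w \<in> center i"
    then have "v \<in> center i"
      using vi0 by (auto simp: center_def w_def y_scale m_scale v(1))
    then show "q \<subseteq> center i"
      unfolding v(3) using coord.span_minimal[OF _ center_subspace] by simp
  qed (use w(1) in auto)
  have i0: "i0 \<le> n"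
    using v(1) vi0 by (force simp: coord_space_def not_le[symmetric])
  define g where "g j = (if j = i0 then 1 else mpoly_const (w j) + mpoly_var j :: (nat, 'a) mpoly)" for j
  define loc where "loc = mpoly_subst mpoly_const g"
  have loc: "local_equation q f = loc f" for f
    unfolding local_equation_def Let_def i0_def[symmetric] the_w loc_def g_def ..
  obtain f where f: "f = (SOME f. f \<in> divisor_of F)" "f \<in> divisor_of F"
  proof -
    have "F \<in> divisor_of F"
      by (auto simp: divisor_of_def mpoly_const_def intro!: exI[of _ 1])
    then show thesis
      using that someI[of "\<lambda>f. f \<in> divisor_of F" F] by auto
  qed
  obtain c where c: "c \<noteq> 0" "f = mpoly_const c * F"
    using f(2) by (auto simp: divisor_of_def)
  have loc_const: "loc (mpoly_const a) = mpoly_const a" for a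
    by (simp add: loc_def)
  have loc_mult: "loc (a * a') = loc a * loc a'" and loc_add: "loc (a + a') = loc a + loc a'"
    and loc_diff: "loc (a - a') = loc a - loc a'" and loc_sum: "loc (sum h B) = (\<Sum>x\<in>B. loc (h x))"
    for a a' :: "(nat, 'a) mpoly" and h and B :: "nat set"
    by (simp_all add: loc_def mpoly_const.mpoly_subst_sum)
  have const_hom: "comm_ring_hom (mpoly_const :: 'a \<Rightarrow> (nat, 'a) mpoly)"
    by (rule mpoly_const_hom)
  interpret cst: comm_ring_hom "mpoly_const :: 'a \<Rightarrow> (nat, 'a) mpoly"
    by (rule const_hom)
  have var1: "(mpoly_var j :: (nat, 'a) mpoly) \<in> order_ge 1" for j
    by (simp add: order_ge_def mpoly_var_def)
  have loc_y_form: "\<exists>h\<in>order_ge 1. loc (y_form j) = mpoly_const (y j w) + h" for j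
  proof
    let ?h = "\<Sum>k\<le>n. mpoly_const (Y j k) * (if k = i0 then 0 else mpoly_var k)"
    show "?h \<in> order_ge 1"
      by (intro order_ge_sum order_ge_scale) (auto intro: var1[simplified] order_ge_zero)
    have "g k = mpoly_const (w k) + (if k = i0 then 0 else mpoly_var k)" for k
      using w(2) by (simp add: g_def mpoly_const_def)
    then have "loc (y_form j) = (\<Sum>k\<le>n. mpoly_const (Y j k) * (mpoly_const (w k) + (if k = i0 then 0 else mpoly_var k)))"
      unfolding loc_def y_form_def mpoly_const.mpoly_subst_linear_form by simp
    then show "loc (y_form j) = mpoly_const (y j w) + ?h"
      by (simp add: distrib_left sum.distrib y_def cst.hom_sum cst.hom_mult)
  qed
  then obtain h where h: "h j \<in> order_ge 1" "loc (y_form j) = mpoly_const (y j w) + h j" for j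
    by metis
  have loc_m_form: "loc (m_form i) - mpoly_const (m i w) \<in> order_ge 1" for i
  proof -
    have "loc (m_form i) - mpoly_const (m i w) = h 0 + (\<Sum>j=1..n. mpoly_const (b i j) * h j)"
      by (simp add: m_form_def m_def loc_add loc_sum loc_mult loc_const h(2) distrib_left sum.distrib
          cst.hom_add cst.hom_sum cst.hom_mult)
    then show ?thesis
      using h(1) by (simp only:) (intro order_ge_add order_ge_sum order_ge_scale)
  qed
  define col where "col j = (if w \<in> center (Suc j) then 1 else 0 :: nat)" for j
  have loc_relation_mat: "loc (relation_mat i j) \<in> order_ge (col j)" if j: "j < n" for i j
  proof (cases "w \<in> center (Suc j)")
    case True
    then have "y (Suc j) w = 0" "m (Suc j) w = 0"
      by (auto simp: center_def)
    then have "loc (y_form (Suc j)) \<in> order_ge 1" "loc (m_form (Suc j)) \<in> order_ge 1"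
      using h[of "Suc j"] loc_m_form[of "Suc j"] by (simp_all add: mpoly_const_def)
    moreover have "loc (relation_mat i j) = (if i = j then loc (m_form (Suc j)) else 0) + mpoly_const (- b (Suc i) (Suc j)) * loc (y_form (Suc j))"
    proof -
      have "loc 0 = 0"
        by (simp add: loc_def)
      then show ?thesis
        by (simp add: relation_mat_def loc_diff loc_mult loc_const cst.hom_uminus)
    qed
    ultimately show ?thesis
      using True by (auto simp: col_def intro!: order_ge_add order_ge_scale order_ge_zero)
  qed (simp add: col_def)
  \<comment> \<open>On all subspaces together, first \<open>y\<^sub>1, \<dots>, y\<^sub>n\<close> vanish and then \<open>m\<^sub>1 = y\<^sub>0\<close>.\<close>
  have "\<exists>j\<in>{1..n}. w \<notin> center j"
  proof (rule ccontr)
    assume *: "\<not> ?thesis"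
    then have "y j w = 0" if "j \<in> {1..n}" for j
      using that by (auto simp: center_def)
    moreover from this have "y 0 w = 0"
      using * n_ge_2 by (auto simp: center_def m_def dest!: bspec[of _ _ 1])
    ultimately have "y l w = 0" if "l \<le> n" for l
      using that by (cases "l = 0") auto
    moreover have "w \<noteq> (\<lambda>_. 0)"
      using w(2) by auto
    ultimately show False
      using y_nonzero[OF w_space] by blast
  qed
  then obtain j where "j \<in> {1..n}" "w \<notin> center j"
    by blast
  then have "j - 1 < n" "w \<notin> center (Suc (j - 1))"
    by auto
  then obtain k where k: "k < n" "w \<notin> center (Suc k)"
    by blast
  have "loc F = fdet n (\<lambda>j i. if j = k then 1 else loc (relation_mat i j))"
  proof -
    have "loc F = fdet n (\<lambda>i j. loc (if j = k then 1 else relation_mat i j))"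
      unfolding F_eq_relation_minor[OF k(1)] relation_minor_def loc_def
      by (rule fdet_hom[OF mpoly_const.mpoly_subst_comm_ring_hom])
    also have "\<dots> = fdet n (\<lambda>i j. if j = k then 1 else loc (relation_mat i j))"
      by (rule fdet_cong) (simp add: loc_def)
    finally show ?thesis
      by (simp only: fdet_transpose[of n "\<lambda>j i. if j = k then 1 else loc (relation_mat i j)"])
  qed
  also have "\<dots> \<in> order_ge (\<Sum>j<n. col j)"
    by (rule fdet_order_ge) (use k(2) loc_relation_mat in \<open>auto simp: col_def\<close>)
  also have "(\<Sum>j<n. col j) = (\<Sum>j=1..n. if q \<subseteq> center j then 1 else 0)"
    by (simp add: sum.atLeast1_atMost_eq col_def q_center)
  also have "\<dots> = card {i \<in> {1..n}. q \<subseteq> center i}"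
    by (simp add: sum.If_cases Int_def)
  finally have "loc F \<in> order_ge (card {i \<in> {1..n}. q \<subseteq> center i})" .
  then have order: "loc f \<in> order_ge (card {i \<in> {1..n}. q \<subseteq> center i})"
    unfolding c(2) loc_mult by (rule order_ge_scale)
  have "loc f \<noteq> 0"
  proof -
    \<comment> \<open>A zero of neither \<open>F\<close> nor the coordinate \<open>i0\<close> lies in the affine chart after rescaling.\<close>
    have "mpoly_eval (\<lambda>_. 1) (mpoly_var i0 :: (nat, 'a) mpoly) \<noteq> 0"
      by simp
    then have "mpoly_var i0 \<noteq> (0 :: (nat, 'a) mpoly)"
      by force
    moreover have "F \<noteq> 0"
      using F_e0 by auto
    ultimately have "F * mpoly_var i0 \<noteq> 0"
      by simp
    then obtain u where "mpoly_eval u (F * mpoly_var i0) \<noteq> 0"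
      using mpoly_nonvanishing[OF infinite_field] by blast
    then have u: "mpoly_eval u F \<noteq> 0" "u i0 \<noteq> 0"
      by auto
    define u' where "u' = (\<lambda>k. inverse (u i0) * u k)"
    have "F \<in> homogeneous (n - 1)"
      using F_forms forms_subset_homogeneous by blast
    then have "mpoly_eval u' F \<noteq> 0"
      unfolding u'_def using homogeneous_eval_scale u by fastforce
    then have fu: "mpoly_eval u' f \<noteq> 0"
      using c by simp
    have "mpoly_eval (\<lambda>k. u' k - w k) (loc f) = mpoly_eval (\<lambda>k. mpoly_eval (\<lambda>k. u' k - w k) (g k)) f"
      unfolding loc_def by (rule mpoly_const.mpoly_subst_hom[OF mpoly_eval.mpoly_subst_comm_ring_hom]) simp
    also have "(\<lambda>k. mpoly_eval (\<lambda>k. u' k - w k) (g k)) = u'"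
      using u(2) by (auto simp: g_def u'_def fun_eq_iff)
    finally show ?thesis
      using fu by auto
  qed
  then obtain m0 where "m0 \<in> keys (loc f)"
    by (metis ex_in_conv keys_eq_empty)
  then have "\<exists>d. \<exists>m\<in>keys (loc f). monom_degree m = d"
    by blast
  from LeastI_ex[OF this] obtain m1 where m1: "m1 \<in> keys (loc f)"
    "monom_degree m1 = (LEAST d. \<exists>m\<in>keys (loc f). monom_degree m = d)"
    by blast
  have "divisor_mult (divisor_of F) q = monom_degree m1"
    unfolding divisor_mult_def Let_def f(1)[symmetric] loc m1(2) ..
  with order m1(1) show ?thesis
    by (auto simp: order_ge_def)
qed

end

section \<open>Dimension of the centres\<close>

context pencil_frame
begin

lemma y_node_dual: "i \<in> {1..n} \<Longrightarrow> i' \<in> {1..n} \<Longrightarrow> (\<Sum>k\<le>n. Y i k * node j i' k) = (if i = i' then 1 else 0)"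
  using y_node[of i j i'] by (simp add: y_def)

text \<open>The basis consists of nodes and hence is compatible with field extensions.\<close>

lemma center_eq_span:
  assumes j: "j \<in> {1..n}"
  shows "center j = coord.span (node j ` ({1..n} - {j}))"
proof
  show "coord.span (node j ` ({1..n} - {j})) \<subseteq> center j"
    by (intro coord.span_minimal center_subspace image_subsetI node_center) (use j in auto)
  show "center j \<subseteq> coord.span (node j ` ({1..n} - {j}))"
  proof
    fix v assume v: "v \<in> center j"
    define w where "w = (\<Sum>i\<in>{1..n} - {j}. coord_scale (y i v) (node j i))"
    have w: "w \<in> coord.span (node j ` ({1..n} - {j}))"
      unfolding w_def by (intro coord.span_sum coord.span_scale coord.span_base imageI)
    have y_w: "y l w = (\<Sum>i\<in>{1..n} - {j}. y i v * y l (node j i))" for l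
    proof -
      have "y l w = (\<Sum>k\<le>n. \<Sum>i\<in>{1..n} - {j}. y i v * (Y l k * node j i k))"
        by (simp add: w_def y_def[of l] sum_fun_apply coord_scale_apply sum_distrib_left mult_ac)
      then show ?thesis
        by (subst (asm) sum.swap) (simp add: y_def[of l] sum_distrib_left)
    qed
    have "v = w"
    proof (rule y_eqI)
      show "v \<in> coord_space n"
        using v by (simp add: center_def)
      show "w \<in> coord_space n"
      proof -
        have "node j ` ({1..n} - {j}) \<subseteq> coord_space n"
          by (auto simp: node_def)
        with w span_subset_coord_space show ?thesis
          by blast
      qed
      fix l assume l: "l \<le> n"
      show "y l v = y l w"
      proof (cases "l = 0")
        case True
        have "0 = y 0 v + (\<Sum>i=1..n. b j i * y i v)"
          using v by (simp add: center_def m_def)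
        also have "(\<Sum>i=1..n. b j i * y i v) = (\<Sum>i\<in>{1..n} - {j}. b j i * y i v)"
          using j b_diag[OF j] by (subst sum.remove[of _ j]) auto
        finally have "y 0 v = - (\<Sum>i\<in>{1..n} - {j}. b j i * y i v)"
          by (simp add: eq_neg_iff_add_eq_0)
        then show ?thesis
          unfolding True y_w by (simp add: y_node sum_negf mult.commute)
      next
        case False
        have "y l w = (\<Sum>i\<in>{1..n} - {j}. if i = l then y l v else 0)"
          unfolding y_w using l False by (intro sum.cong) (auto simp: y_node)
        also have "\<dots> = y l v"
          using v l False by (auto simp: center_def)
        finally show ?thesis ..
      qed
    qed
    with w show "v \<in> coord.span (node j ` ({1..n} - {j}))"
      by simp
  qed
qed

lemma center_codim2:
  assumes j: "j \<in> {1..n}"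
  shows "center j \<in> proj_subspaces n (n - 2)"
proof -
  have "coord.independent (node j ` ({1..n} - {j}))" "card (node j ` ({1..n} - {j})) = card ({1..n} - {j})"
    using independent_if_dual[where v = "node j" and I = "{1..n} - {j}" and n = n and Y = Y] y_node_dual by auto
  then have "coord.dim (center j) = n - 2 + 1"
    using j n_ge_2 by (simp add: center_eq_span coord.dim_eq_card_independent)
  then show ?thesis
    using center_subspace[of j] by (auto simp: proj_subspaces_def center_def)
qed

end

section \<open>Extension of scalars\<close>

lemma to_ac_hom: "comm_ring_hom (to_ac :: 'a::field \<Rightarrow> 'a alg_closure)"
  by unfold_locales auto

lemma forms_map_to_ac: "f \<in> forms n d \<Longrightarrow> Poly_Mapping.map to_ac f \<in> forms n d"
  by (auto simp: forms_def in_keys_iff Poly_Mapping.map.rep_eq)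

lemma map_to_ac_inj:
  assumes "Poly_Mapping.map to_ac f = Poly_Mapping.map to_ac g"
  shows "f = g"
proof (rule poly_mapping_eqI)
  have lookup: "lookup (Poly_Mapping.map to_ac h) m = to_ac (lookup h m)" for h m
    by (simp add: Poly_Mapping.map.rep_eq when_def)
  show "lookup f m = lookup g m" for m
    using arg_cong[OF assms, of "\<lambda>h. lookup h m"] by (simp add: lookup)
qed

lemma eval_map_to_ac: "mpoly_eval (\<lambda>k. to_ac (x k)) (Poly_Mapping.map to_ac f) = to_ac (mpoly_eval x f)"
proof -
  interpret C: coeff_hom "\<lambda>c. mpoly_const (to_ac c) :: ('b, 'a alg_closure) mpoly"
    by (rule coeff_hom_comp_const[OF to_ac_hom])
  have "mpoly_eval (\<lambda>k. to_ac (x k)) (Poly_Mapping.map to_ac f) = mpoly_subst to_ac (\<lambda>k. to_ac (x k)) f"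
    unfolding mpoly_map_conv_subst[OF to_ac_hom]
    by (subst C.mpoly_subst_hom[OF mpoly_eval.mpoly_subst_comm_ring_hom, of to_ac]) simp_all
  also have "\<dots> = to_ac (mpoly_eval x f)"
    by (rule mpoly_eval.mpoly_subst_hom[OF to_ac_hom, symmetric]) simp
  finally show ?thesis .
qed

lemma divisor_ac_divisor_of:
  fixes f :: "(nat, 'a::field) mpoly"
  shows "divisor_ac (divisor_of f) = divisor_of (Poly_Mapping.map to_ac f)"
proof -
  interpret P: comm_ring_hom "Poly_Mapping.map to_ac :: (nat, 'a) mpoly \<Rightarrow> (nat, 'a alg_closure) mpoly"
    by (rule mpoly_map_hom[OF to_ac_hom])
  have "divisor_of (Poly_Mapping.map to_ac g) = divisor_of (Poly_Mapping.map to_ac f)" if "g \<in> divisor_of f" for g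
  proof -
    obtain c where "c \<noteq> 0" "g = mpoly_const c * f"
      using \<open>g \<in> divisor_of f\<close> by (auto simp: divisor_of_def)
    then show ?thesis
      by (simp add: P.hom_mult mpoly_map_const[OF to_ac_hom] divisor_of_scale)
  qed
  moreover have "f \<in> divisor_of f"
    by (auto simp: divisor_of_def mpoly_const_def intro!: exI[of _ 1])
  ultimately show ?thesis
    unfolding divisor_ac_def by blast
qed

locale pencil_frame_over = pencil_frame n e Y b
  for n and e Y b :: "nat \<Rightarrow> nat \<Rightarrow> 'k::field_char_0"
begin

abbreviation "e_ac \<equiv> \<lambda>j k. to_ac (e j k)"
abbreviation "Y_ac \<equiv> \<lambda>j k. to_ac (Y j k)"
abbreviation "b_ac \<equiv> \<lambda>j k. to_ac (b j k)"

sublocale ac: pencil_frame_ac n e_ac Y_ac b_ac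
proof
  show "n \<ge> 2"
    by (rule n_ge_2)
  show "e_ac j \<in> coord_space n" if "j \<le> n" for j
    using e_space[OF that] by (simp add: coord_space_def)
  show "(\<Sum>k\<le>n. Y_ac i k * e_ac j k) = (if i = j then 1 else 0)" if "i \<le> n" "j \<le> n" for i j
    using arg_cong[OF dual[OF that], of to_ac] by (simp add: to_ac_sum)
  show "(\<Sum>j\<le>n. (\<Sum>k\<le>n. Y_ac j k * v k) * e_ac j i) = v i" if v: "v \<in> coord_space n" for v i
  proof -
    have unit: "(\<Sum>j\<le>n. Y j k * e j i) = coord_unit k i" if "k \<le> n" for k
    proof -
      have "(\<Sum>j\<le>n. (\<Sum>k'\<le>n. Y j k' * coord_unit k k') * e j i) = coord_unit k i"
        by (rule expand) (rule coord_unit_space[OF that])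
      then show ?thesis
        by (simp add: sum_coord_unit[OF that])
    qed
    have "(\<Sum>j\<le>n. (\<Sum>k\<le>n. Y_ac j k * v k) * e_ac j i) = (\<Sum>k\<le>n. v k * to_ac (\<Sum>j\<le>n. Y j k * e j i))"
      unfolding to_ac_sum sum_distrib_left sum_distrib_right
      by (subst sum.swap) (simp add: mult_ac)
    also have "\<dots> = (\<Sum>k\<le>n. if k = i then v i else 0)"
      by (intro sum.cong) (auto simp: unit coord_unit_def)
    also have "\<dots> = v i"
      using v by (auto simp: coord_space_def)
    finally show ?thesis .
  qed
  show "b_ac i i = 0" if "i \<in> {1..n}" for i
    using b_diag[OF that] by simp
  show "b_ac i j \<noteq> b_ac i' j"
    if "i \<in> {1..n}" "i' \<in> {1..n}" "j \<in> {1..n}" "i \<noteq> i'" "i \<noteq> j" "i' \<noteq> j" for i i' j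
    using b_distinct[OF that] by simp
qed

lemma ac_y: "ac.y i (\<lambda>k. to_ac (v k)) = to_ac (y i v)"
  by (simp add: ac.y_def y_def to_ac_sum)

lemma ac_m: "ac.m i (\<lambda>k. to_ac (v k)) = to_ac (m i v)"
  by (simp add: ac.m_def m_def ac_y to_ac_sum)

lemma ac_node: "ac.node i j = (\<lambda>k. to_ac (node i j k))"
  by (simp add: ac.node_def node_def ac.point_def point_def to_ac_sum fun_eq_iff if_distrib[of to_ac] cong: if_cong)

lemma subspace_ac_center:
  assumes j: "j \<in> {1..n}"
  shows "subspace_ac (center j) = ac.center j"
proof
  show "subspace_ac (center j) \<subseteq> ac.center j"
    unfolding subspace_ac_def
  proof (rule coord.span_minimal[OF _ ac.center_subspace], rule image_subsetI)
    fix v assume "v \<in> center j"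
    then show "(\<lambda>i. to_ac (v i)) \<in> ac.center j"
      by (simp add: center_def ac.center_def ac_y ac_m coord_space_def)
  qed
  show "ac.center j \<subseteq> subspace_ac (center j)"
    unfolding subspace_ac_def ac.center_eq_span[OF j]
    using node_center j by (intro coord.span_mono) (auto simp: ac_node)
qed

lemma map_F: "Poly_Mapping.map to_ac F = ac.F"
proof -
  interpret P: comm_ring_hom "Poly_Mapping.map to_ac :: (nat, 'k) mpoly \<Rightarrow> (nat, 'k alg_closure) mpoly"
    by (rule mpoly_map_hom[OF to_ac_hom])
  note maps = mpoly_map_const[OF to_ac_hom] mpoly_map_var[OF to_ac_hom]
  have y_form: "Poly_Mapping.map to_ac (y_form i) = ac.y_form i" for i
    by (simp add: y_form_def ac.y_form_def linear_form_def P.hom_sum P.hom_mult maps)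
  have m_form: "Poly_Mapping.map to_ac (m_form i) = ac.m_form i" for i
    by (simp add: m_form_def ac.m_form_def y_form P.hom_add P.hom_sum P.hom_mult maps)
  have relation_mat: "Poly_Mapping.map to_ac (relation_mat i j) = ac.relation_mat i j" for i j
    by (simp add: relation_mat_def ac.relation_mat_def y_form m_form P.hom_minus P.hom_mult maps)
  show ?thesis
    unfolding F_def ac.F_def relation_minor_def ac.relation_minor_def
    by (subst fdet_hom[OF mpoly_map_hom[OF to_ac_hom]], rule fdet_cong) (simp add: relation_mat)
qed

text \<open>Over the algebraic closure \<open>G\<close> is a multiple of \<open>F\<close>. The factor is the value of \<open>G\<close> at \<open>e\<^sub>0\<close>, so it lies in the
  ground field.\<close>

lemma map_forms_unique:
  assumes G: "G \<in> forms n (n - 1)" "G \<noteq> 0"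
    and contains: "\<And>j. j \<in> {1..n} \<Longrightarrow> divisor_contains n (divisor_ac (divisor_of G)) (ac.center j)"
  shows "divisor_of G = divisor_of F"
proof -
  let ?G = "Poly_Mapping.map to_ac G"
  have G_ac: "?G \<in> forms n (n - 1)"
    by (rule forms_map_to_ac) (rule G(1))
  interpret P: comm_ring_hom "Poly_Mapping.map to_ac :: (nat, 'k) mpoly \<Rightarrow> (nat, 'k alg_closure) mpoly"
    by (rule mpoly_map_hom[OF to_ac_hom])
  have "mpoly_eval v ?G = 0" if j: "j \<in> {1..n}" and v: "v \<in> ac.center j" for j v
  proof (cases "v = 0")
    case True
    have "?G \<in> homogeneous (n - 1)"
      using G_ac forms_subset_homogeneous by blast
    from homogeneous_eval_scale[OF this, of 0 v] have "mpoly_eval v ?G = 0 ^ (n - 1) * mpoly_eval v ?G"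
      using True by (simp add: zero_fun_def)
    moreover have "(0 :: 'k alg_closure) ^ (n - 1) = 0"
      using n_ge_2 by (intro zero_power) simp
    ultimately show ?thesis
      by (metis mult_zero_left)
  next
    case False
    have v': "v \<in> coord_space n"
      using v by (simp add: ac.center_def)
    have "coord.span {v} \<subseteq> ac.center j"
      using v coord.span_minimal[OF _ ac.center_subspace] by simp
    then have "coord.span {v} \<in> divisor_points n (divisor_of ?G)"
      using contains[OF j] proj_points_span[OF v' False]
      by (auto simp: divisor_contains_def divisor_ac_divisor_of)
    then show ?thesis
      using divisor_points_span_iff[OF G_ac v' False] by simp
  qed
  then have "?G = mpoly_const (mpoly_eval (e_ac 0) ?G) * ac.F"
    by (rule ac.F_unique[OF G_ac])
  also have "\<dots> = Poly_Mapping.map to_ac (mpoly_const (mpoly_eval (e 0) G) * F)"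
    by (simp add: eval_map_to_ac P.hom_mult mpoly_map_const[OF to_ac_hom] map_F)
  finally have "G = mpoly_const (mpoly_eval (e 0) G) * F"
    by (rule map_to_ac_inj)
  moreover from this have "mpoly_eval (e 0) G \<noteq> 0"
    using G(2) by (auto simp: mpoly_const_def)
  ultimately show ?thesis
    using divisor_of_scale by metis
qed

end

section \<open>Pairs of linear forms in general position\<close>

text \<open>Selections of \<open>n + 1\<close> of the \<open>2n\<close> forms \<open>(j, k)\<close>, the \<open>k\<close>-th form of the \<open>j\<close>-th pair: all first forms and one
  second form, or all first forms but the \<open>j\<close>-th and the second forms of two other pairs. Independence of the former provides
  coordinates in which every second form involves \<open>y\<^sub>0\<close>; that of the latter says \<open>b i j \<noteq> b i' j\<close>.\<close>

definition frame_rows :: "nat \<Rightarrow> (nat \<Rightarrow> nat \<times> nat) set" where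
  "frame_rows n =
    (\<lambda>j s. if s = 0 then (j, 1) else (s, 0)) ` {1..n} \<union>
    (\<lambda>(i, i', j) s. if s = 0 then (i, 1) else if s = j then (i', 1) else (s, 0)) `
      {(i, i', j). i \<in> {1..n} \<and> i' \<in> {1..n} \<and> j \<in> {1..n} \<and> i \<noteq> i' \<and> i \<noteq> j \<and> i' \<noteq> j}"

definition row_det :: "nat \<Rightarrow> (nat \<times> nat \<times> nat \<Rightarrow> 'a::comm_ring_1) \<Rightarrow> (nat \<Rightarrow> nat \<times> nat) \<Rightarrow> 'a" where
  "row_det n a r = fdet (Suc n) (\<lambda>s t. a (fst (r s), snd (r s), t))"

definition general_position :: "nat \<Rightarrow> (nat \<times> nat \<times> nat \<Rightarrow> 'a::comm_ring_1) \<Rightarrow> bool" where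
  "general_position n a \<longleftrightarrow> (\<forall>r\<in>frame_rows n. row_det n a r \<noteq> 0)"

text \<open>The action of \<open>2 \<times> 2\<close> matrices \<open>g j\<close> on the pairs of linear forms.\<close>

definition pair_act :: "(nat \<Rightarrow> nat \<Rightarrow> nat \<Rightarrow> 'a::comm_ring_1) \<Rightarrow> (nat \<times> nat \<times> nat \<Rightarrow> 'a) \<Rightarrow> nat \<times> nat \<times> nat \<Rightarrow> 'a" where
  "pair_act g a = (\<lambda>(j, k, t). \<Sum>h<2. g j k h * a (j, h, t))"

definition form_value :: "nat \<Rightarrow> (nat \<times> nat \<times> nat \<Rightarrow> 'a::comm_ring_1) \<Rightarrow> nat \<Rightarrow> nat \<Rightarrow> (nat \<Rightarrow> 'a) \<Rightarrow> 'a" where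
  "form_value n a j k v = (\<Sum>t\<le>n. a (j, k, t) * v t)"

lemma finite_frame_rows: "finite (frame_rows n)"
proof -
  have "finite {(i, i', j). i \<in> {1..n} \<and> i' \<in> {1..n} \<and> j \<in> {1..n} \<and> i \<noteq> i' \<and> i \<noteq> j \<and> i' \<noteq> j}"
    by (rule finite_subset[of _ "{1..n} \<times> {1..n} \<times> {1..n}"]) auto
  then show ?thesis
    by (simp add: frame_rows_def)
qed

lemma frame_rows_range:
  assumes "r \<in> frame_rows n" "s \<le> n"
  shows "fst (r s) \<in> {1..n}" "snd (r s) < 2"
  using assms by (auto simp: frame_rows_def split: if_splits)

lemma general_position_cong:
  assumes "\<And>j k t. j \<in> {1..n} \<Longrightarrow> k < 2 \<Longrightarrow> t \<le> n \<Longrightarrow> a (j, k, t) = a' (j, k, t)"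
  shows "general_position n a \<longleftrightarrow> general_position n a'"
proof -
  have "row_det n a r = row_det n a' r" if "r \<in> frame_rows n" for r
    unfolding row_det_def using frame_rows_range[OF that]
    by (intro fdet_cong assms) (auto simp: less_Suc_eq_le)
  then show ?thesis
    by (simp add: general_position_def)
qed

lemma form_value_sum: "form_value n a j k (\<lambda>i. \<Sum>x\<in>B. c x * v x i) = (\<Sum>x\<in>B. c x * form_value n a j k (v x))"
  unfolding form_value_def sum_distrib_left by (subst sum.swap) (simp add: mult_ac)

lemma form_value_diff: "form_value n a j k (\<lambda>i. u i - c * v i) = form_value n a j k u - c * form_value n a j k v"
  by (simp add: form_value_def right_diff_distrib sum_subtractf sum_distrib_left mult_ac)

lemma form_value_add: "form_value n a j k (\<lambda>i. c * u i + d * v i) = c * form_value n a j k u + d * form_value n a j k v"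
  by (simp add: form_value_def distrib_left sum.distrib sum_distrib_left mult_ac)

lemma zero_loci_form_value:
  "j \<in> {1..n} \<Longrightarrow> zero_loci n a j = {v \<in> coord_space n. \<forall>k<2. form_value n a j k v = 0}"
  by (simp add: zero_loci_def form_value_def)

lemma row_det_kernel:
  fixes a :: "nat \<times> nat \<times> nat \<Rightarrow> 'a::field"
  assumes "row_det n a r \<noteq> 0" "v \<in> coord_space n"
    and zero: "\<And>s. s \<le> n \<Longrightarrow> form_value n a (fst (r s)) (snd (r s)) v = 0"
  shows "v = (\<lambda>_. 0)"
proof (rule ccontr)
  assume "v \<noteq> (\<lambda>_. 0)"
  then obtain t where "v t \<noteq> 0"
    by auto
  then have "\<exists>t<Suc n. v t \<noteq> 0"
    using assms(2) by (intro exI[of _ t]) (auto simp: coord_space_def less_Suc_eq_le not_less[symmetric])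
  moreover have "(\<Sum>t<Suc n. a (fst (r s), snd (r s), t) * v t) = 0" if "s < Suc n" for s
    using zero[of s] that by (simp add: form_value_def lessThan_Suc_atMost)
  ultimately have "row_det n a r = 0"
    unfolding row_det_def fdet_eq_0_iff by blast
  with assms(1) show False ..
qed

text \<open>Take as coordinates the first forms of all pairs and the second form of the first pair, and divide each second form by
  its value at \<open>e\<^sub>0\<close>. The vectors \<open>u\<close> and \<open>w\<close> are dual to the \<open>j\<close>-th pair.\<close>

lemma general_position_frame:
  fixes a :: "nat \<times> nat \<times> nat \<Rightarrow> 'a::field"
  assumes n: "n \<ge> 2" and a: "general_position n a"
  obtains e Y b where "pencil_frame n e Y b"
    "\<And>j. j \<in> {1..n} \<Longrightarrow> zero_loci n a j = pencil_frame.center n Y b j"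
    "\<And>j. j \<in> {1..n} \<Longrightarrow> \<exists>u\<in>coord_space n. \<exists>w\<in>coord_space n.
      form_value n a j 0 u = 1 \<and> form_value n a j 1 u = 0 \<and>
      form_value n a j 0 w = 0 \<and> form_value n a j 1 w = 1"
proof -
  define r where "r j s = (if s = 0 then (j, 1) else (s, 0) :: nat \<times> nat)" for j s :: nat
  define r' where "r' i i' j s = (if s = 0 then (i, 1) else if s = j then (i', 1) else (s, 0) :: nat \<times> nat)"
    for i i' j s :: nat
  have det_r: "row_det n a (r j) \<noteq> 0" if "j \<in> {1..n}" for j
    using a that unfolding general_position_def frame_rows_def r_def by blast
  have det_r': "row_det n a (r' i i' j) \<noteq> 0"
    if "i \<in> {1..n}" "i' \<in> {1..n}" "j \<in> {1..n}" "i \<noteq> i'" "i \<noteq> j" "i' \<noteq> j" for i i' j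
  proof -
    have "r' i i' j = (\<lambda>(i, i', j) s. if s = 0 then (i, 1) else if s = j then (i', 1) else (s, 0)) (i, i', j)"
      by (simp add: r'_def fun_eq_iff)
    then have "r' i i' j \<in> frame_rows n"
      unfolding frame_rows_def using that by blast
    then show ?thesis
      using a by (simp add: general_position_def)
  qed
  define Y where "Y s t = a (fst (r 1 s), snd (r 1 s), t)" for s t
  have one: "1 \<in> {1..n}"
    using n by simp
  have "fdet (Suc n) Y \<noteq> 0"
    using det_r[OF one] by (simp add: row_det_def Y_def[abs_def])
  then obtain M where M: "\<And>i j. i < Suc n \<Longrightarrow> j < Suc n \<Longrightarrow> (\<Sum>k<Suc n. Y i k * M k j) = (if i = j then 1 else 0)"
    "\<And>i j. i < Suc n \<Longrightarrow> j < Suc n \<Longrightarrow> (\<Sum>k<Suc n. M i k * Y k j) = (if i = j then 1 else 0)"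
    using fdet_inverse by blast
  define e where "e j k = (if k \<le> n then M k j else 0)" for j k
  have e_space: "e j \<in> coord_space n" for j
    by (simp add: e_def coord_space_def)
  have dual: "(\<Sum>k\<le>n. Y i k * e j k) = (if i = j then 1 else 0)" if "i \<le> n" "j \<le> n" for i j
    using M(1)[of i j] that by (simp add: lessThan_Suc_atMost e_def)
  have expand: "(\<Sum>j\<le>n. (\<Sum>k\<le>n. Y j k * v k) * e j i) = v i" if v: "v \<in> coord_space n" for v i
  proof (cases "i \<le> n")
    case True
    have "(\<Sum>j\<le>n. (\<Sum>k\<le>n. Y j k * v k) * e j i) = (\<Sum>k\<le>n. v k * (\<Sum>j\<le>n. M i j * Y j k))"
      unfolding sum_distrib_left sum_distrib_right
      by (subst sum.swap) (simp add: e_def True mult_ac)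
    also have "\<dots> = (\<Sum>k\<le>n. if k = i then v i else 0)"
      using M(2)[of i] True by (intro sum.cong) (auto simp: lessThan_Suc_atMost less_Suc_eq_le)
    finally show ?thesis
      using True by simp
  next
    case False
    with v show ?thesis
      by (simp add: e_def coord_space_def)
  qed
  have Y0: "(\<Sum>k\<le>n. Y 0 k * v k) = form_value n a 1 1 v" for v
    by (simp add: Y_def r_def form_value_def)
  have Yj: "(\<Sum>k\<le>n. Y j k * v k) = form_value n a j 0 v" if "j \<in> {1..n}" for j v
    using that by (simp add: Y_def r_def form_value_def)
  have l_e: "form_value n a j 0 (e k) = (if j = k then 1 else 0)" if "j \<in> {1..n}" "k \<le> n" for j k
    using dual[of j k] that Yj[OF that(1), of "e k"] by simp
  have e_nonzero: "e 0 \<noteq> (\<lambda>_. 0)"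
    using dual[of 0 0] by auto
  define \<mu> where "\<mu> j = form_value n a j 1 (e 0)" for j
  have \<mu>': "form_value n a j (Suc 0) (e 0) = \<mu> j" for j
    by (simp add: \<mu>_def)
  have \<mu>: "\<mu> j \<noteq> 0" if j: "j \<in> {1..n}" for j
  proof
    assume "\<mu> j = 0"
    then have "form_value n a (fst (r j s)) (snd (r j s)) (e 0) = 0" if "s \<le> n" for s
      using that l_e[of s 0] by (auto simp: r_def \<mu>_def)
    with row_det_kernel[OF det_r[OF j] e_space] e_nonzero show False
      by blast
  qed
  define b where "b j i = (if i = j then 0 else form_value n a j 1 (e i) / \<mu> j)" for j i
  have frame: "pencil_frame n e Y b"
  proof
    fix i i' j assume ij: "i \<in> {1..n}" "i' \<in> {1..n}" "j \<in> {1..n}" "i \<noteq> i'" "i \<noteq> j" "i' \<noteq> j"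
    show "b i j \<noteq> b i' j"
    proof
      assume eq: "b i j = b i' j"
      \<comment> \<open>The common node would be a common zero of \<open>n + 1\<close> independent forms.\<close>
      define u where "u = (\<lambda>k. e j k - b i j * e 0 k)"
      have m_zero: "form_value n a i 1 u = 0" "form_value n a i' 1 u = 0"
        using eq \<mu>[OF ij(1)] \<mu>[OF ij(2)] ij unfolding u_def form_value_diff
        by (simp_all add: b_def \<mu>' field_simps)
      have l_zero: "form_value n a s 0 u = 0" if "s \<in> {1..n}" "s \<noteq> j" for s
        using that ij(3) unfolding u_def form_value_diff by (simp add: l_e)
      have "form_value n a j 0 u = 1"
        using ij(3) unfolding u_def form_value_diff by (simp add: l_e)
      then have "u \<noteq> (\<lambda>_. 0)"
        by (auto simp: form_value_def)
      moreover have "u \<in> coord_space n"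
        using e_space[of j] e_space[of 0] by (simp add: u_def coord_space_def)
      moreover have "form_value n a (fst (r' i i' j s)) (snd (r' i i' j s)) u = 0" if "s \<le> n" for s
        using m_zero l_zero[of s] that by (auto simp: r'_def)
      ultimately show False
        using row_det_kernel[OF det_r'[OF ij]] by blast
    qed
  qed (use n e_space dual expand in \<open>auto simp: b_def\<close>)
  interpret pencil_frame n e Y b
    by (rule frame)
  show thesis
  proof (rule that[OF frame])
    fix j assume j: "j \<in> {1..n}"
    have yj: "y j v = form_value n a j 0 v" for v
      using Yj[OF j] by (simp add: y_def)
    have mj: "form_value n a j 1 v = \<mu> j * m j v + form_value n a j 1 (e j) * y j v" if v: "v \<in> coord_space n" for v
    proof -
      have "form_value n a j 1 v = form_value n a j 1 (point (\<lambda>i. y i v))"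
        by (simp add: point_y[OF v])
      also have "\<dots> = (\<Sum>i\<le>n. y i v * form_value n a j 1 (e i))"
        unfolding point_def by (rule form_value_sum)
      also have "\<dots> = \<mu> j * y 0 v + (\<Sum>i=1..n. y i v * form_value n a j 1 (e i))"
        by (simp add: atMost_atLeast0 sum.atLeast_Suc_atMost \<mu>_def mult.commute)
      also have "(\<Sum>i=1..n. y i v * form_value n a j 1 (e i))
          = (\<Sum>i=1..n. \<mu> j * (b j i * y i v) + (if i = j then form_value n a j 1 (e j) * y j v else 0))"
        using \<mu>[OF j] by (intro sum.cong) (auto simp: b_def)
      also have "\<dots> = \<mu> j * (\<Sum>i=1..n. b j i * y i v) + form_value n a j 1 (e j) * y j v"
        using j by (simp add: sum.distrib sum_distrib_left)
      finally show ?thesis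
        by (simp add: m_def distrib_left)
    qed
    have "(\<forall>k<2. form_value n a j k v = 0) \<longleftrightarrow> form_value n a j 0 v = 0 \<and> form_value n a j 1 v = 0" for v
      by (auto simp: less_2_cases_iff)
    then show "zero_loci n a j = center j"
      unfolding zero_loci_form_value[OF j] center_def
      using \<mu>[OF j] mj yj by auto
    define c where "c = form_value n a j 1 (e j) / \<mu> j"
    show "\<exists>u\<in>coord_space n. \<exists>w\<in>coord_space n.
        form_value n a j 0 u = 1 \<and> form_value n a j 1 u = 0 \<and>
        form_value n a j 0 w = 0 \<and> form_value n a j 1 w = 1"
    proof (intro bexI conjI)
      show "form_value n a j 0 (\<lambda>i. e j i - c * e 0 i) = 1" "form_value n a j 1 (\<lambda>i. e j i - c * e 0 i) = 0"
        using j \<mu>[OF j] unfolding form_value_diff by (simp_all add: l_e c_def \<mu>')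
      have "form_value n a j k (\<lambda>i. inverse (\<mu> j) * e 0 i) = inverse (\<mu> j) * form_value n a j k (e 0)" for k
        by (simp add: form_value_def sum_distrib_left mult_ac)
      then show "form_value n a j 0 (\<lambda>i. inverse (\<mu> j) * e 0 i) = 0" "form_value n a j 1 (\<lambda>i. inverse (\<mu> j) * e 0 i) = 1"
        using j \<mu>[OF j] by (simp_all add: l_e \<mu>')
      show "(\<lambda>i. e j i - c * e 0 i) \<in> coord_space n" "(\<lambda>i. inverse (\<mu> j) * e 0 i) \<in> coord_space n"
        using j e_space[of j] e_space[of 0] by (simp_all add: coord_space_def)
    qed
  qed
qed

lemma general_position_codim2:
  fixes a :: "nat \<times> nat \<times> nat \<Rightarrow> 'a::field"
  assumes "n \<ge> 2" "general_position n a"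
  shows "zero_loci n a \<in> codim2_tuples n"
proof -
  obtain e Y b where frame: "pencil_frame n e Y b"
    and center: "\<And>j. j \<in> {1..n} \<Longrightarrow> zero_loci n a j = pencil_frame.center n Y b j"
    using general_position_frame[OF assms] by metis
  have "zero_loci n a j \<in> proj_subspaces n (n - 2)" if "j \<in> {1..n}" for j
    using pencil_frame.center_codim2[OF frame that] center[OF that] by simp
  then show ?thesis
    by (auto simp: codim2_tuples_def zero_loci_def)
qed

lemma form_value_pair_act: "form_value n (pair_act g a) j k v = (\<Sum>h<2. g j k h * form_value n a j h v)"
  unfolding form_value_def pair_act_def by (simp add: sum_distrib_left sum_distrib_right mult.assoc sum.swap[of _ "{..<2}"])

lemma zero_loci_pair_act:
  fixes a :: "nat \<times> nat \<times> nat \<Rightarrow> 'a::field"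
  assumes g: "\<And>j. j \<in> {1..n} \<Longrightarrow> fdet 2 (g j) \<noteq> 0"
  shows "zero_loci n (pair_act g a) = zero_loci n a"
proof
  fix j
  show "zero_loci n (pair_act g a) j = zero_loci n a j"
  proof (cases "j \<in> {1..n}")
    case True
    have "(\<forall>k<2. (\<Sum>h<2. g j k h * form_value n a j h v) = 0) \<longleftrightarrow> (\<forall>h<2. form_value n a j h v = 0)" for v
    proof
      assume *: "\<forall>k<2. (\<Sum>h<2. g j k h * form_value n a j h v) = 0"
      show "\<forall>h<2. form_value n a j h v = 0"
      proof (rule ccontr)
        assume "\<not> ?thesis"
        with * have "fdet 2 (g j) = 0"
          unfolding fdet_eq_0_iff by (intro exI[of _ "\<lambda>h. form_value n a j h v"]) simp
        with g[OF True] show False ..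
      qed
    qed simp
    then show ?thesis
      by (simp add: zero_loci_form_value[OF True] form_value_pair_act)
  next
    case False
    then show ?thesis
      by (simp only: zero_loci_def restrict_apply if_False)
  qed
qed

text \<open>A form that vanishes on the common zeros of the \<open>j\<close>-th pair of \<open>a\<close> is a combination of this pair, whose coefficients are
  its values at the dual vectors. This writes \<open>a'\<close> as a matrix \<open>g'\<close> times \<open>a\<close>. The matrix is invertible, since a
  kernel vector would give a zero of the \<open>j\<close>-th pair of \<open>a'\<close> that is not a zero of that of \<open>a\<close>.\<close>

lemma same_zero_loci_general_position:
  fixes a a' :: "nat \<times> nat \<times> nat \<Rightarrow> 'a::field"
  assumes n: "n \<ge> 2" and a: "general_position n a" and eq: "zero_loci n a' = zero_loci n a"
  obtains g where "\<And>j. j \<in> {1..n} \<Longrightarrow> fdet 2 (g j) \<noteq> 0" "general_position n (pair_act g a')"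
proof -
  have "\<exists>g. fdet 2 g \<noteq> 0 \<and> (\<forall>k<2. \<forall>t\<le>n. (\<Sum>h<2. g k h * a' (j, h, t)) = a (j, k, t))" if j: "j \<in> {1..n}" for j
  proof -
    obtain u w where uw: "u \<in> coord_space n" "w \<in> coord_space n"
      "form_value n a j 0 u = 1" "form_value n a j 1 u = 0"
      "form_value n a j 0 w = 0" "form_value n a j 1 w = 1"
      using general_position_frame[OF n a] j by metis
    define d where "d h = (if h = 0 then u else w)" for h :: nat
    define g' where "g' k h = form_value n a' j k (d h)" for k h
    have two: "(\<Sum>h<2. f h) = f 0 + f 1" for f :: "nat \<Rightarrow> 'a"
      by (simp add: numeral_2_eq_2)
    have zero: "form_value n a' j k v = 0" if "v \<in> coord_space n" "form_value n a j 0 v = 0" "form_value n a j 1 v = 0" "k < 2" for v k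
    proof -
      have "v \<in> zero_loci n a j"
        using that by (auto simp: zero_loci_form_value[OF j] less_2_cases_iff)
      then have "v \<in> zero_loci n a' j"
        by (simp add: eq)
      then show ?thesis
        using that by (simp add: zero_loci_form_value[OF j])
    qed
    have form_unit: "form_value n c j k (coord_unit t) = c (j, k, t)" if "t \<le> n" for c :: "nat \<times> nat \<times> nat \<Rightarrow> 'a" and k t
      unfolding form_value_def by (rule sum_coord_unit[OF that])
    have a': "a' (j, k, t) = (\<Sum>h<2. g' k h * a (j, h, t))" if k: "k < 2" and t: "t \<le> n" for k t
    proof -
      define v where "v = (\<lambda>i. (\<lambda>i. coord_unit t i - a (j, 0, t) * u i) i - a (j, 1, t) * w i)"
      have v: "form_value n c j k v = c (j, k, t) - a (j, 0, t) * form_value n c j k u - a (j, 1, t) * form_value n c j k w"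
        for c k
        unfolding v_def form_value_diff form_unit[OF t] ..
      have "form_value n a' j k v = 0"
      proof (rule zero[OF _ _ _ k])
        show "v \<in> coord_space n"
          using uw(1,2) coord_unit_space[OF t, where 'a = 'a] by (simp add: v_def coord_space_def)
      qed (simp_all add: v uw uw[simplified])
      then show ?thesis
        by (simp add: v two g'_def d_def algebra_simps)
    qed
    have "fdet 2 g' \<noteq> 0"
    proof
      assume "fdet 2 g' = 0"
      then obtain x where x: "\<exists>h<2. x h \<noteq> 0" "\<And>k. k < 2 \<Longrightarrow> (\<Sum>h<2. g' k h * x h) = 0"
        unfolding fdet_eq_0_iff by blast
      define v where "v = (\<lambda>i. x 0 * u i + x 1 * w i)"
      have v: "v \<in> coord_space n"
        using uw by (simp add: v_def coord_space_def)
      have "form_value n a' j k v = 0" if "k < 2" for k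
        using x(2)[OF that] unfolding v_def form_value_add two by (simp add: g'_def d_def mult.commute)
      then have "v \<in> zero_loci n a' j"
        using v by (simp add: zero_loci_form_value[OF j])
      then have "form_value n a j k v = 0" if "k < 2" for k
        using that by (simp add: eq zero_loci_form_value[OF j])
      from this[of 0] this[of 1] have "x 0 = 0" "x 1 = 0"
        unfolding v_def form_value_add by (simp_all add: uw uw[simplified])
      with x(1) show False
        by (auto simp: less_2_cases_iff)
    qed
    then obtain g where g: "\<And>k i. k < 2 \<Longrightarrow> i < 2 \<Longrightarrow> (\<Sum>h<2. g' k h * g h i) = (if k = i then 1 else 0)"
      "\<And>k i. k < 2 \<Longrightarrow> i < 2 \<Longrightarrow> (\<Sum>h<2. g k h * g' h i) = (if k = i then 1 else 0)"
      using fdet_inverse by blast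
    show ?thesis
    proof (intro exI[of _ g] conjI allI impI)
      show "fdet 2 g \<noteq> 0"
      proof
        assume "fdet 2 g = 0"
        then obtain x where x: "\<exists>h<2. x h \<noteq> 0" "\<And>k. k < 2 \<Longrightarrow> (\<Sum>h<2. g k h * x h) = 0"
          unfolding fdet_eq_0_iff by blast
        have "x k = 0" if k: "k < 2" for k
        proof -
          have "0 = (\<Sum>h<2. g' k h * (\<Sum>i<2. g h i * x i))"
            using x(2) by simp
          also have "\<dots> = (\<Sum>i<2. (\<Sum>h<2. g' k h * g h i) * x i)"
            unfolding sum_distrib_left sum_distrib_right by (subst sum.swap) (simp only: mult.assoc)
          also have "\<dots> = (\<Sum>i<2. if i = k then x k else 0)"
            using g(1)[OF k] by (intro sum.cong) auto
          finally show ?thesis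
            using k by simp
        qed
        with x(1) show False
          by blast
      qed
      fix k t assume k: "k < (2::nat)" and t: "t \<le> n"
      have "(\<Sum>h<2. g k h * a' (j, h, t)) = (\<Sum>h<2. g k h * (\<Sum>i<2. g' h i * a (j, i, t)))"
        using a'[OF _ t] by simp
      also have "\<dots> = (\<Sum>i<2. (\<Sum>h<2. g k h * g' h i) * a (j, i, t))"
        unfolding sum_distrib_left sum_distrib_right by (subst sum.swap) (simp only: mult.assoc)
      also have "\<dots> = (\<Sum>i<2. if i = k then a (j, k, t) else 0)"
        using g(2)[OF k] by (intro sum.cong) auto
      finally show "(\<Sum>h<2. g k h * a' (j, h, t)) = a (j, k, t)"
        using k by simp
    qed
  qed
  then have "\<forall>j\<in>{1..n}. \<exists>g. fdet 2 g \<noteq> 0 \<and> (\<forall>k<2. \<forall>t\<le>n. (\<Sum>h<2. g k h * a' (j, h, t)) = a (j, k, t))"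
    by (rule ballI)
  from bchoice[OF this] obtain g where g': "\<forall>j\<in>{1..n}. fdet 2 (g j) \<noteq> 0 \<and>
      (\<forall>k<2. \<forall>t\<le>n. (\<Sum>h<2. g j k h * a' (j, h, t)) = a (j, k, t))"
    by (rule exE)
  then have g: "\<And>j. j \<in> {1..n} \<Longrightarrow> fdet 2 (g j) \<noteq> 0"
    "\<And>j k t. j \<in> {1..n} \<Longrightarrow> k < 2 \<Longrightarrow> t \<le> n \<Longrightarrow> (\<Sum>h<2. g j k h * a' (j, h, t)) = a (j, k, t)"
    by simp_all
  have "general_position n (pair_act g a') \<longleftrightarrow> general_position n a"
    by (rule general_position_cong) (simp add: pair_act_def g(2))
  with a g(1) that show thesis
    by blast
qed

text \<open>A single polynomial describes the open condition: the product of all determinants.\<close>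

lemma general_position_poly:
  fixes g :: "nat \<Rightarrow> nat \<Rightarrow> nat \<Rightarrow> 'a::field"
  obtains P where "\<And>x. mpoly_eval x P \<noteq> 0 \<longleftrightarrow> general_position n (pair_act g x)"
proof -
  define P where "P = (\<Prod>r\<in>frame_rows n. row_det n
    (\<lambda>(j, k, t). \<Sum>h<2. mpoly_const (g j k h) * mpoly_var (j, h, t) :: (nat \<times> nat \<times> nat, 'a) mpoly) r)"
  have "mpoly_eval x P = (\<Prod>r\<in>frame_rows n. row_det n (pair_act g x) r)" for x
    unfolding P_def row_det_def mpoly_eval.mpoly_subst_prod fdet_hom[OF mpoly_eval.mpoly_subst_comm_ring_hom]
    by (simp add: pair_act_def mpoly_eval.mpoly_subst_sum)
  then show thesis
    using that[of P] by (simp add: general_position_def finite_frame_rows)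
qed

text \<open>The pairs \<open>X\<^sub>j\<close>, \<open>X\<^sub>0 + j (X\<^sub>1 + \<dots> + X\<^sub>n)\<close>.\<close>

definition sample_pairs :: "nat \<Rightarrow> nat \<times> nat \<times> nat \<Rightarrow> 'a::field_char_0" where
  "sample_pairs n = (\<lambda>(j, k, t)\<in>pair_coeffs n.
    if k = 0 then (if t = j then 1 else 0) else if t = 0 then 1 else of_nat j)"

lemma sample_pairs_general_position:
  "general_position n (sample_pairs n :: nat \<times> nat \<times> nat \<Rightarrow> 'a::field_char_0)"
proof -
  have l: "form_value n (sample_pairs n) j 0 v = v j" if "j \<in> {1..n}" for j and v :: "nat \<Rightarrow> 'a"
  proof -
    have "form_value n (sample_pairs n) j 0 v = (\<Sum>t\<le>n. if t = j then v j else 0)"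
      unfolding form_value_def using that by (intro sum.cong) (auto simp: sample_pairs_def)
    then show ?thesis
      using that by simp
  qed
  have m: "form_value n (sample_pairs n) j 1 v = v 0 + of_nat j * (\<Sum>t=1..n. v t)" if "j \<in> {1..n}" for j and v :: "nat \<Rightarrow> 'a"
  proof -
    have "form_value n (sample_pairs n) j 1 v = (\<Sum>t\<le>n. (if t = 0 then 1 else of_nat j) * v t)"
      unfolding form_value_def using that by (intro sum.cong) (auto simp: sample_pairs_def)
    then show ?thesis
      by (simp add: atMost_atLeast0 sum.atLeast_Suc_atMost sum_distrib_left)
  qed
  show ?thesis
    unfolding general_position_def
  proof
    fix r assume r: "r \<in> frame_rows n"
    show "row_det n (sample_pairs n :: nat \<times> nat \<times> nat \<Rightarrow> 'a) r \<noteq> 0"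
    proof
      assume "row_det n (sample_pairs n :: nat \<times> nat \<times> nat \<Rightarrow> 'a) r = 0"
      then obtain v :: "nat \<Rightarrow> 'a" where v: "\<exists>t<Suc n. v t \<noteq> 0"
        "\<And>s. s \<le> n \<Longrightarrow> form_value n (sample_pairs n) (fst (r s)) (snd (r s)) v = 0"
        unfolding row_det_def fdet_eq_0_iff form_value_def lessThan_Suc_atMost less_Suc_eq_le by blast
      from r consider j where "j \<in> {1..n}" "r = (\<lambda>s. if s = 0 then (j, 1) else (s, 0))"
        | i i' j where "i \<in> {1..n}" "i' \<in> {1..n}" "j \<in> {1..n}" "i \<noteq> i'" "i \<noteq> j" "i' \<noteq> j"
          "r = (\<lambda>s. if s = 0 then (i, 1) else if s = j then (i', 1) else (s, 0))"
        unfolding frame_rows_def by auto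
      then have "\<forall>t\<le>n. v t = 0"
      proof cases
        case 1
        have "v s = 0" if "s \<in> {1..n}" for s
          using v(2)[of s] l[OF that, of v] that 1(2) by simp
        moreover from this have "v 0 = 0"
          using v(2)[of 0] m[OF 1(1), of v] 1(2) by simp
        ultimately show ?thesis
          by (metis atLeastAtMost_iff le_zero_eq not_less_eq_eq One_nat_def)
      next
        case 2
        have zero: "v s = 0" if "s \<in> {1..n}" "s \<noteq> j" for s
          using v(2)[of s] l[OF that(1), of v] that 2(7) by simp
        have "(\<Sum>t=1..n. v t) = v j"
          using 2(3) zero by (subst sum.remove[of _ j]) (auto intro!: sum.neutral)
        then have "v 0 + of_nat i * v j = 0" "v 0 + of_nat i' * v j = 0"
          using v(2)[of 0] v(2)[of j] m[OF 2(1), of v] m[OF 2(2), of v] 2 by auto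
        then have eq: "v 0 + of_nat i * v j = 0" "(of_nat i - of_nat i') * v j = 0"
          by (simp, metis add_diff_cancel_left left_diff_distrib diff_self)
        then have "v j = 0"
          using 2(4) by simp
        with eq zero show ?thesis
          by (metis atLeastAtMost_iff le_zero_eq not_less_eq_eq One_nat_def add.right_neutral mult_zero_right)
      qed
      with v(1) show False
        by (auto simp: less_Suc_eq_le)
    qed
  qed
qed

section \<open>Every subspace of codimension two is a zero locus\<close>

text \<open>Extend a basis of \<open>W\<close> by two vectors to a basis of the whole space, and take the coordinate functions of
  these two vectors.\<close>

lemma codim2_equations:
  fixes W :: "(nat \<Rightarrow> 'a::field) set"
  assumes n: "n \<ge> 2" and W: "W \<in> proj_subspaces n (n - 2)"
  obtains f where "W = {v \<in> coord_space n. \<forall>k<2::nat. (\<Sum>t\<le>n. f k t * v t) = 0}"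
proof -
  have W': "coord.subspace W" "W \<subseteq> coord_space n" "coord.dim W = n - 1"
    using W n by (auto simp: proj_subspaces_def)
  obtain B where B: "B \<subseteq> W" "coord.independent B" "W \<subseteq> coord.span B" "card B = coord.dim W"
    using coord.basis_exists .
  obtain B' where B': "B \<subseteq> B'" "B' \<subseteq> coord_space n" "coord.independent B'" "coord_space n \<subseteq> coord.span B'"
    using coord.maximal_independent_subset_extend[OF _ B(2), of "coord_space n"] B(1) W'(2) by blast
  have card_B': "card B' = Suc n"
    using coord.basis_card_eq_dim[OF B'(2,4,3)] dim_coord_space by simp
  then have fin: "finite B'"
    by (metis card.infinite nat.distinct(1))
  then have "finite B"
    using B'(1) finite_subset by blast
  then have "card (B' - B) = 2"
    using card_Diff_subset[OF _ B'(1)] card_B' B(4) W'(3) n by simp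
  then obtain p q where pq: "B' - B = {p, q}"
    by (auto simp: card_2_iff)
  then have pq_notin: "p \<notin> B" "q \<notin> B"
    by blast+
  let ?R = "coord.representation B'"
  define c where "c k = (if k = 0 then p else q)" for k :: nat
  have rep: "(\<Sum>t\<le>n. ?R (coord_unit t) x * v t) = ?R v x" if "v \<in> coord_space n" for v x
  proof -
    have unit: "coord_unit t \<in> coord.span B'" if "t \<le> n" for t
      using coord_unit_space[OF that] B'(4) by blast
    have "?R v x = ?R (\<Sum>t\<le>n. coord_scale (v t) (coord_unit t)) x"
      using coord_expand[OF that] by simp
    also have "\<dots> = (\<Sum>t\<le>n. ?R (coord_scale (v t) (coord_unit t)) x)"
      by (subst coord.representation_sum[OF B'(3)]) (auto intro: coord.span_scale unit)
    also have "\<dots> = (\<Sum>t\<le>n. v t * ?R (coord_unit t) x)"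
      by (intro sum.cong refl, subst coord.representation_scale[OF B'(3)]) (auto intro: unit)
    finally show ?thesis
      by (simp add: mult.commute)
  qed
  have "v \<in> W \<longleftrightarrow> (\<forall>k<2. ?R v (c k) = 0)" if v: "v \<in> coord_space n" for v
  proof
    assume "v \<in> W"
    then have "?R v = coord.representation B v"
      using B(3) by (intro coord.representation_extend[OF B'(3) _ B'(1)]) blast
    moreover have "coord.representation B v (c k) = 0" for k
    proof (rule ccontr)
      assume "coord.representation B v (c k) \<noteq> 0"
      then have "c k \<in> B"
        by (rule coord.representation_ne_zero)
      with pq_notin show False
        by (auto simp: c_def split: if_splits)
    qed
    ultimately show "\<forall>k<2. ?R v (c k) = 0"
      by simp
  next
    assume "\<forall>k<2. ?R v (c k) = 0"
    then have "?R v (c 0) = 0" "?R v (c 1) = 0"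
      by simp_all
    then have pq0: "?R v p = 0" "?R v q = 0"
      by (simp_all add: c_def)
    have "v = (\<Sum>x\<in>B'. coord_scale (?R v x) x)"
      using coord.sum_representation_eq[OF B'(3) _ fin order_refl] v B'(4) by auto
    also have "\<dots> = (\<Sum>x\<in>B. coord_scale (?R v x) x)"
    proof (rule sum.mono_neutral_right[OF fin B'(1)])
      show "\<forall>x\<in>B' - B. coord_scale (?R v x) x = 0"
        unfolding pq using pq0 by (auto simp: coord_scale_def zero_fun_def)
    qed
    also have "\<dots> \<in> W"
      using B(1) W'(1) by (intro coord.subspace_sum coord.subspace_scale) auto
    finally show "v \<in> W" .
  qed
  then have "W = {v \<in> coord_space n. \<forall>k<2. (\<Sum>t\<le>n. ?R (coord_unit t) (c k) * v t) = 0}"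
    using W'(2) rep by auto
  then show thesis
    by (rule that)
qed

lemma codim2_tuple_zero_loci:
  fixes \<Lambda> :: "nat \<Rightarrow> (nat \<Rightarrow> 'a::field) set"
  assumes n: "n \<ge> 2" and \<Lambda>: "\<Lambda> \<in> codim2_tuples n"
  obtains a where "a \<in> independent_pairs n" "zero_loci n a = \<Lambda>"
proof -
  have "\<exists>f. \<Lambda> j = {v \<in> coord_space n. \<forall>k<2::nat. (\<Sum>t\<le>n. f k t * v t) = 0}" if "j \<in> {1..n}" for j
  proof -
    have "\<Lambda> j \<in> proj_subspaces n (n - 2)"
      using \<Lambda> that by (auto simp: codim2_tuples_def)
    then show ?thesis
      by (rule codim2_equations[OF n]) (rule exI)
  qed
  then have "\<forall>j\<in>{1..n}. \<exists>f. \<Lambda> j = {v \<in> coord_space n. \<forall>k<2::nat. (\<Sum>t\<le>n. f k t * v t) = 0}"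
    by blast
  from bchoice[OF this] obtain f where
    f: "\<And>j. j \<in> {1..n} \<Longrightarrow> \<Lambda> j = {v \<in> coord_space n. \<forall>k<2::nat. (\<Sum>t\<le>n. f j k t * v t) = 0}"
    by blast
  define a where "a = (\<lambda>(j, k, t)\<in>pair_coeffs n. f j k t)"
  have "zero_loci n a = \<Lambda>"
  proof
    fix j
    show "zero_loci n a j = \<Lambda> j"
    proof (cases "j \<in> {1..n}")
      case True
      then show ?thesis
        unfolding f[OF True] by (simp add: zero_loci_def a_def)
    next
      case False
      then show ?thesis
        using \<Lambda> by (auto simp: zero_loci_def codim2_tuples_def)
    qed
  qed
  moreover from this have "a \<in> independent_pairs n"
    using \<Lambda> by (auto simp: independent_pairs_def a_def)
  ultimately show thesis
    by (rule that[rotated])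
qed

section \<open>Openness and density of general position\<close>

definition generic_tuples :: "nat \<Rightarrow> (nat \<Rightarrow> (nat \<Rightarrow> 'a::field) set) set" where
  "generic_tuples n = zero_loci n ` {a. general_position n a}"

text \<open>The open set of the parameter space is the set of tuples in general position for one choice of equations. Its preimage
  consists of the \<open>a'\<close> for which \<open>pair_act g a'\<close> is in general position for some family \<open>g\<close> of invertible matrices,
  and for each fixed \<open>g\<close> this is an open condition.\<close>

lemma openin_generic_tuples:
  assumes n: "n \<ge> 2"
  shows "openin (codim2_zariski n) (generic_tuples n :: (nat \<Rightarrow> (nat \<Rightarrow> 'a::field) set) set)"
  unfolding openin_codim2_zariski
proof
  show "generic_tuples n \<subseteq> (codim2_tuples n :: (nat \<Rightarrow> (nat \<Rightarrow> 'a) set) set)"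
    using general_position_codim2[OF n] by (auto simp: generic_tuples_def)
  let ?I = "independent_pairs n :: (nat \<times> nat \<times> nat \<Rightarrow> 'a) set"
  let ?T = "subtopology (affine_zariski (pair_coeffs n)) ?I"
  show "openin ?T {a \<in> ?I. zero_loci n a \<in> generic_tuples n}"
  proof (subst openin_subopen, rule ballI)
    fix a' assume "a' \<in> {a \<in> ?I. zero_loci n a \<in> generic_tuples n}"
    then obtain a where a': "a' \<in> ?I" and a: "general_position n a" "zero_loci n a' = zero_loci n a"
      by (auto simp: generic_tuples_def)
    obtain g where g: "\<And>j. j \<in> {1..n} \<Longrightarrow> fdet 2 (g j) \<noteq> 0" "general_position n (pair_act g a')"
      using same_zero_loci_general_position[OF n a] by blast
    obtain P where P: "\<And>x. mpoly_eval x P \<noteq> 0 \<longleftrightarrow> general_position n (pair_act g x)"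
      using general_position_poly[where g = g and n = n] by blast
    define N where "N = {x \<in> pair_coeffs n \<rightarrow>\<^sub>E UNIV. mpoly_eval x P \<noteq> 0}"
    have "openin (affine_zariski (pair_coeffs n)) N"
      unfolding affine_zariski_def N_def by (rule topology_generated_by_Basis) blast
    then have "openin ?T (?I \<inter> N)"
      by (auto simp: openin_subtopology)
    moreover have "a' \<in> ?I \<inter> N"
      using a' g(2) P by (auto simp: N_def independent_pairs_def)
    moreover have "zero_loci n x \<in> generic_tuples n" if "x \<in> N" for x
    proof -
      have "zero_loci n x = zero_loci n (pair_act g x)"
        using zero_loci_pair_act[OF g(1)] by simp
      then show ?thesis
        using that P by (auto simp: generic_tuples_def N_def)
    qed
    ultimately show "\<exists>T. openin ?T T \<and> a' \<in> T \<and> T \<subseteq> {a \<in> ?I. zero_loci n a \<in> generic_tuples n}"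
      by (intro exI[of _ "?I \<inter> N"]) blast
  qed
qed

text \<open>On the line from any pairs of forms to the sample pairs, all but finitely many points are in general position, and all but
  finitely many lie in a given principal open set around the starting point.\<close>

lemma dense_open_generic_tuples:
  assumes n: "n \<ge> 2"
  shows "dense_open (codim2_zariski n) (generic_tuples n :: (nat \<Rightarrow> (nat \<Rightarrow> 'a::field_char_0) set) set)"
  unfolding dense_open_def topspace_codim2_zariski
proof
  let ?I = "independent_pairs n :: (nat \<times> nat \<times> nat \<Rightarrow> 'a) set"
  let ?Z = "codim2_zariski n :: (nat \<Rightarrow> (nat \<Rightarrow> 'a) set) topology"
  show "openin ?Z (generic_tuples n)"
    by (rule openin_generic_tuples[OF n])
  show "?Z closure_of (generic_tuples n) = codim2_tuples n"
  proof (intro equalityI subsetI)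
    fix \<Lambda> assume "\<Lambda> \<in> ?Z closure_of (generic_tuples n)"
    then show "\<Lambda> \<in> codim2_tuples n"
      using closure_of_subset_topspace[of ?Z "generic_tuples n"] unfolding topspace_codim2_zariski by (rule subsetD[rotated])
  next
    fix \<Lambda> :: "nat \<Rightarrow> (nat \<Rightarrow> 'a) set"
    assume \<Lambda>: "\<Lambda> \<in> codim2_tuples n"
    show "\<Lambda> \<in> ?Z closure_of (generic_tuples n)"
      unfolding in_closure_of topspace_codim2_zariski
    proof (intro conjI allI impI \<Lambda>)
      fix T assume T: "\<Lambda> \<in> T \<and> openin ?Z T"
      obtain a where a: "a \<in> ?I" "zero_loci n a = \<Lambda>"
        using codim2_tuple_zero_loci[OF n \<Lambda>] by blast
      obtain T' where T': "openin (affine_zariski (pair_coeffs n)) T'"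
        "{a \<in> ?I. zero_loci n a \<in> T} = T' \<inter> ?I"
        using T unfolding openin_codim2_zariski by (auto simp: openin_subtopology)
      have "a \<in> T'"
        using a T T'(2) by auto
      then obtain G where G: "mpoly_eval a G \<noteq> 0"
        "\<And>z. z \<in> pair_coeffs n \<rightarrow>\<^sub>E UNIV \<Longrightarrow> mpoly_eval z G \<noteq> 0 \<Longrightarrow> z \<in> T'"
        using affine_zariski_basic[OF T'(1)] by blast
      define unit where "unit j k h = (if k = h then 1 else 0 :: 'a)" for j k h :: nat
      have unit: "general_position n (pair_act unit x) \<longleftrightarrow> general_position n x" for x
      proof (rule general_position_cong)
        fix j k t :: nat assume "k < 2"
        have "(\<Sum>h<2. unit j k h * x (j, h, t)) = (\<Sum>h<2. if k = h then x (j, k, t) else 0)"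
          by (intro sum.cong) (auto simp: unit_def)
        then show "pair_act unit x (j, k, t) = x (j, k, t)"
          using \<open>k < 2\<close> by (simp add: pair_act_def)
      qed
      obtain P where P: "\<And>x. mpoly_eval x P \<noteq> 0 \<longleftrightarrow> general_position n (pair_act unit x)"
        using general_position_poly[where g = unit and n = n] by blast
      define d where "d i = (if i \<in> pair_coeffs n then sample_pairs n i - a i else 0)" for i
      have "general_position n (\<lambda>i. a i + d i)"
      proof -
        have "general_position n (\<lambda>i. a i + d i) \<longleftrightarrow> general_position n (sample_pairs n :: nat \<times> nat \<times> nat \<Rightarrow> 'a)"
          by (rule general_position_cong) (simp add: d_def)
        then show ?thesis
          using sample_pairs_general_position by blast
      qed
      then have "mpoly_eval (\<lambda>i. a i + d i) P \<noteq> 0"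
        by (simp add: P unit)
      then obtain s where s: "mpoly_eval (\<lambda>i. a i + s * d i) G \<noteq> 0" "mpoly_eval (\<lambda>i. a i + s * d i) P \<noteq> 0"
        using common_nonvanishing_on_line[OF G(1)] by blast
      define x where "x = (\<lambda>i. a i + s * d i)"
      have gen: "general_position n x"
        using s(2) by (simp add: P unit x_def)
      have x: "x \<in> pair_coeffs n \<rightarrow>\<^sub>E UNIV"
        using a(1) by (auto simp: x_def d_def independent_pairs_def PiE_def extensional_def)
      then have "x \<in> ?I"
        using general_position_codim2[OF n gen] by (simp add: independent_pairs_def)
      moreover have "x \<in> T'"
        using G(2)[OF x] s(1) by (simp add: x_def)
      ultimately have "zero_loci n x \<in> T"
        using T'(2) by blast
      then show "\<exists>\<Lambda>'. \<Lambda>' \<in> generic_tuples n \<and> \<Lambda>' \<in> T"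
        using gen by (auto simp: generic_tuples_def)
    qed
  qed
qed

lemma generic_tuple_divisor:
  fixes W :: "nat \<Rightarrow> (nat \<Rightarrow> 'k::field_char_0) set"
  assumes n: "n \<ge> 2" and "W \<in> generic_tuples n"
  shows "\<exists>Q\<in>effective_divisors n (n - 1).
       (\<forall>j\<in>{1..n}. divisor_contains n (divisor_ac Q) (subspace_ac (W j))) \<and>
       (\<forall>Q'\<in>effective_divisors n (n - 1).
          (\<forall>j\<in>{1..n}. divisor_contains n (divisor_ac Q') (subspace_ac (W j))) \<longrightarrow> Q' = Q) \<and>
       reduced_irreducible (divisor_ac Q) \<and>
       divisor_points n (divisor_ac Q) =
         {q \<in> proj_points n. \<exists>L. transversal n {1..n} (\<lambda>j. subspace_ac (W j)) L \<and> q \<subseteq> L} \<and>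
       (\<forall>q\<in>divisor_points n (divisor_ac Q).
          divisor_mult (divisor_ac Q) q \<ge> card {i \<in> {1..n}. q \<subseteq> subspace_ac (W i)}) \<and>
       (\<exists>V. dense_open (subtopology (proj_zariski n) (divisor_points n (divisor_ac Q))) V \<and>
          (\<forall>q\<in>V. \<exists>!L. transversal n {1..n} (\<lambda>j. subspace_ac (W j)) L \<and> q \<subseteq> L))"
proof -
  obtain a where a: "general_position n a" "W = zero_loci n a"
    using assms(2) by (auto simp: generic_tuples_def)
  obtain e Y b where frame: "pencil_frame n e Y b"
    and center: "\<And>j. j \<in> {1..n} \<Longrightarrow> zero_loci n a j = pencil_frame.center n Y b j"
    using general_position_frame[OF n a(1)] by metis
  interpret pencil_frame_over n e Y b
    using frame by (simp add: pencil_frame_over_def)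
  have W: "W j = center j" if "j \<in> {1..n}" for j
    using center[OF that] a(2) by simp
  show ?thesis
  proof (intro bexI[of _ "divisor_of F"] conjI)
    have W_ac: "subspace_ac (W j) = ac.center j" if "j \<in> {1..n}" for j
      using W[OF that] subspace_ac_center[OF that] by simp
    have trans: "transversal n {1..n} (\<lambda>j. subspace_ac (W j)) L \<longleftrightarrow> transversal n {1..n} ac.center L" for L
      by (simp add: transversal_def W_ac)
    have Q_ac: "divisor_ac (divisor_of F) = divisor_of ac.F"
      by (simp add: divisor_ac_divisor_of map_F)
    show "divisor_of F \<in> effective_divisors n (n - 1)"
      using F_forms F_e0 by (auto simp: effective_divisors_def)
    show "\<forall>j\<in>{1..n}. divisor_contains n (divisor_ac (divisor_of F)) (subspace_ac (W j))"
      using ac.F_contains_center by (simp add: Q_ac W_ac)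
    show "\<forall>Q'\<in>effective_divisors n (n - 1).
        (\<forall>j\<in>{1..n}. divisor_contains n (divisor_ac Q') (subspace_ac (W j))) \<longrightarrow> Q' = divisor_of F"
      using map_forms_unique by (auto simp: effective_divisors_def W_ac)
    show "reduced_irreducible (divisor_ac (divisor_of F))"
      unfolding Q_ac by (rule ac.divisor_F_reduced_irreducible)
    show "divisor_points n (divisor_ac (divisor_of F)) =
        {q \<in> proj_points n. \<exists>L. transversal n {1..n} (\<lambda>j. subspace_ac (W j)) L \<and> q \<subseteq> L}"
      unfolding Q_ac trans by (rule ac.divisor_points_F)
    have "{i \<in> {1..n}. q \<subseteq> subspace_ac (W i)} = {i \<in> {1..n}. q \<subseteq> ac.center i}" for q
      using W_ac by auto
    then show "\<forall>q\<in>divisor_points n (divisor_ac (divisor_of F)).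
        divisor_mult (divisor_ac (divisor_of F)) q \<ge> card {i \<in> {1..n}. q \<subseteq> subspace_ac (W i)}"
      unfolding Q_ac using ac.multiplicity_bound by (simp add: divisor_points_def)
    show "\<exists>V. dense_open (subtopology (proj_zariski n) (divisor_points n (divisor_ac (divisor_of F)))) V \<and>
        (\<forall>q\<in>V. \<exists>!L. transversal n {1..n} (\<lambda>j. subspace_ac (W j)) L \<and> q \<subseteq> L)"
      unfolding Q_ac trans by (rule ac.dense_unique_transversal)
  qed
qed

theorem proposition2p4:
  fixes n :: nat
  assumes "n \<ge> 2"
  shows "\<exists>U :: (nat \<Rightarrow> (nat \<Rightarrow> 'k::field_char_0) set) set.
    dense_open (codim2_zariski n) U \<and>
    (\<forall>W\<in>U. \<exists>Q\<in>effective_divisors n (n - 1).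
       (\<forall>j\<in>{1..n}. divisor_contains n (divisor_ac Q) (subspace_ac (W j))) \<and>
       (\<forall>Q'\<in>effective_divisors n (n - 1).
          (\<forall>j\<in>{1..n}. divisor_contains n (divisor_ac Q') (subspace_ac (W j))) \<longrightarrow> Q' = Q) \<and>
       reduced_irreducible (divisor_ac Q) \<and>
       divisor_points n (divisor_ac Q) =
         {q \<in> proj_points n. \<exists>L. transversal n {1..n} (\<lambda>j. subspace_ac (W j)) L \<and> q \<subseteq> L} \<and>
       (\<forall>q\<in>divisor_points n (divisor_ac Q).
          divisor_mult (divisor_ac Q) q \<ge> card {i \<in> {1..n}. q \<subseteq> subspace_ac (W i)}) \<and>
       (\<exists>V. dense_open (subtopology (proj_zariski n) (divisor_points n (divisor_ac Q))) V \<and>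
          (\<forall>q\<in>V. \<exists>!L. transversal n {1..n} (\<lambda>j. subspace_ac (W j)) L \<and> q \<subseteq> L)))"
proof (intro exI[of _ "generic_tuples n"] conjI ballI)
  show "dense_open (codim2_zariski n) (generic_tuples n :: (nat \<Rightarrow> (nat \<Rightarrow> 'k) set) set)"
    by (rule dense_open_generic_tuples[OF assms])
qed (rule generic_tuple_divisor[OF assms])

end
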